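(* Let $\mathfrak{g}$ be a semisimple Lie algebra over $\mathbb{C}$, let $V_1,\dots,V_k$ be pairwise non-isomorphic irreducible finite dimensional $\mathfrak{g}$-representations, and let $S\subseteq V$ be finite dimensional $\mathfrak{g}$-representations with $cl(V)=\sum_{i=1}^k n_i\,cl(V_i)$ and $cl(S)=\sum_{i=1}^k s_i\,cl(V_i)$. Then the variety $Gr_{\mathfrak{g}}(V,S)$ of all subrepresentations of $V$ isomorphic to $S$ is irreducible, smooth, and $$\dim Gr_{\mathfrak{g}}(V,S)=\sum_{i=1}^k(n_i-s_i)s_i.$$
   Context: $cl(V)$ denotes the class of $V$ in the representation ring $R(\mathfrak{g})$ of finite dimensional $\mathfrak{g}$-representations; thus $n_i$ and $s_i$ are the multiplicities of $V_i$ in $V$ and $S$. $Gr_{\mathfrak{g}}(V,S)$ is the set of $\mathfrak{g}$-subrepresentations of $V$ isomorphic to $S$, viewed as a subvariety of the Grassmannian of $(\dim S)$-dimensional subspaces of $V$. *)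

theory Defs
  imports
    "HOL-Analysis.Analysis"
    "HOL-Algebra.Free_Abelian_Groups"
    "HOL-Library.Function_Algebras"
begin

section \<open>Semisimple complex Lie algebras\<close>

record 'g lie_alg =
  lscale :: "complex \<Rightarrow> 'g \<Rightarrow> 'g"
  lbracket :: "'g \<Rightarrow> 'g \<Rightarrow> 'g"

locale lie_algebra =
  fixes L :: "'g::ab_group_add lie_alg"
  assumes vector_space_lscale: "vector_space (lscale L)"
    and linear_right: "Vector_Spaces.linear (lscale L) (lscale L) (\<lambda>y. lbracket L x y)"
    and linear_left: "Vector_Spaces.linear (lscale L) (lscale L) (\<lambda>x. lbracket L x y)"
    and alternating: "lbracket L x x = 0"
    and jacobi: "lbracket L x (lbracket L y z) + lbracket L y (lbracket L z x)
                  + lbracket L z (lbracket L x y) = 0"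

definition lie_ideal :: "'g::ab_group_add lie_alg \<Rightarrow> 'g set \<Rightarrow> bool" where
  "lie_ideal L I \<longleftrightarrow> module.subspace (lscale L) I \<and> (\<forall>x. \<forall>y\<in>I. lbracket L x y \<in> I)"

definition derived_algebra :: "'g::ab_group_add lie_alg \<Rightarrow> 'g set \<Rightarrow> 'g set" where
  "derived_algebra L I = module.span (lscale L) {lbracket L x y | x y. x \<in> I \<and> y \<in> I}"

definition lie_solvable :: "'g::ab_group_add lie_alg \<Rightarrow> 'g set \<Rightarrow> bool" where
  "lie_solvable L I \<longleftrightarrow> (\<exists>m. (derived_algebra L ^^ m) I = {0})"

text \<open>Semisimple means finite dimensional with zero radical, the radical being the largest
  solvable ideal. The zero algebra is therefore allowed.\<close>

locale semisimple_lie_algebra = lie_algebra +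
  assumes finite_dim: "\<exists>B. finite B \<and> module.span (lscale L) B = UNIV"
    and radical_zero: "\<And>I. lie_ideal L I \<Longrightarrow> lie_solvable L I \<Longrightarrow> I = {0}"


section \<open>Finite dimensional representations\<close>

text \<open>A representation lives on a subspace \<open>space R\<close> of an ambient vector space (a type together
  with a scalar multiplication). The values of \<open>act R\<close> outside \<open>space R\<close> are irrelevant.\<close>

record ('g, 'v) rep =
  space :: "'v set"
  scl :: "complex \<Rightarrow> 'v \<Rightarrow> 'v"
  act :: "'g \<Rightarrow> 'v \<Rightarrow> 'v"

definition linear_on ::
  "(complex \<Rightarrow> 'v \<Rightarrow> 'v) \<Rightarrow> (complex \<Rightarrow> 'w \<Rightarrow> 'w) \<Rightarrow> 'v::ab_group_add set
    \<Rightarrow> ('v \<Rightarrow> 'w::ab_group_add) \<Rightarrow> bool" where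
  "linear_on s1 s2 U f \<longleftrightarrow>
    (\<forall>u\<in>U. \<forall>v\<in>U. f (u + v) = f u + f v) \<and> (\<forall>c. \<forall>u\<in>U. f (s1 c u) = s2 c (f u))"

locale fd_representation = lie_algebra L
  for L :: "'g::ab_group_add lie_alg" +
  fixes R :: "('g, 'v::ab_group_add) rep"
  assumes vector_space_scl: "vector_space (scl R)"
    and subspace_space: "module.subspace (scl R) (space R)"
    and finite_dim_space: "\<exists>B. finite B \<and> B \<subseteq> space R \<and> module.span (scl R) B = space R"
    and act_closed: "\<And>x v. v \<in> space R \<Longrightarrow> act R x v \<in> space R"
    and act_linear: "\<And>x. linear_on (scl R) (scl R) (space R) (act R x)"
    and act_linear_alg: "\<And>v. v \<in> space R \<Longrightarrow> linear_on (lscale L) (scl R) UNIV (\<lambda>x. act R x v)"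
    and act_bracket: "\<And>x y v. v \<in> space R \<Longrightarrow>
          act R (lbracket L x y) v = act R x (act R y v) - act R y (act R x v)"

definition rep_iso ::
  "('g, 'v::ab_group_add) rep \<Rightarrow> ('g, 'w::ab_group_add) rep \<Rightarrow> bool" where
  "rep_iso R R' \<longleftrightarrow>
    (\<exists>f. bij_betw f (space R) (space R') \<and> linear_on (scl R) (scl R') (space R) f \<and>
         (\<forall>x. \<forall>v\<in>space R. f (act R x v) = act R' x (f v)))"

definition is_subrep :: "('g, 'v::ab_group_add) rep \<Rightarrow> 'v set \<Rightarrow> bool" where
  "is_subrep R T \<longleftrightarrow> module.subspace (scl R) T \<and> T \<subseteq> space R \<and> (\<forall>x. \<forall>v\<in>T. act R x v \<in> T)"

definition subrep :: "('g, 'v) rep \<Rightarrow> 'v set \<Rightarrow> ('g, 'v) rep" where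
  "subrep R T = R\<lparr>space := T\<rparr>"

definition irreducible_rep ::
  "'g::ab_group_add lie_alg \<Rightarrow> ('g, 'v::ab_group_add) rep \<Rightarrow> bool" where
  "irreducible_rep L R \<longleftrightarrow> fd_representation L R \<and> space R \<noteq> {0} \<and>
    (\<forall>T. is_subrep R T \<longrightarrow> T = {0} \<or> T = space R)"

definition rep_sum :: "('g, 'v) rep \<Rightarrow> ('g, 'w) rep \<Rightarrow> ('g, 'v \<times> 'w) rep" where
  "rep_sum R R' =
    \<lparr>space = space R \<times> space R',
     scl = (\<lambda>c (u, w). (scl R c u, scl R' c w)),
     act = (\<lambda>x (u, w). (act R x u, act R' x w))\<rparr>"


section \<open>The representation ring\<close>

definition fun_scale :: "complex \<Rightarrow> ('i \<Rightarrow> complex) \<Rightarrow> 'i \<Rightarrow> complex" where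
  "fun_scale c f = (\<lambda>i. c * f i)"

lemma vector_space_fun_scale: "vector_space (fun_scale :: complex \<Rightarrow> ('i \<Rightarrow> complex) \<Rightarrow> _)"
  by unfold_locales (auto simp: fun_scale_def algebra_simps)

text \<open>The isomorphism classes of finite dimensional representations do not form a type, so the
  free abelian group is built on the representations carried by subspaces of \<open>nat \<Rightarrow> complex\<close>;
  every finite dimensional representation is isomorphic to one of these. Dividing by
  \<open>[A] - [B] - [C]\<close> whenever \<open>A\<close> is isomorphic to the direct sum of \<open>B\<close> and \<open>C\<close> also identifies
  isomorphic representations (take \<open>C = 0\<close>). Only the additive group of the representation ring
  is constructed; as usual in HOL-Algebra it is written multiplicatively.\<close>

definition model_reps ::
  "'g::ab_group_add lie_alg \<Rightarrow> ('g, nat \<Rightarrow> complex) rep set" where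
  "model_reps L = {R. fd_representation L R \<and> scl R = fun_scale}"

definition sum_relations ::
  "'g::ab_group_add lie_alg \<Rightarrow> (('g, nat \<Rightarrow> complex) rep \<Rightarrow>\<^sub>0 int) set" where
  "sum_relations L =
    {frag_of A - frag_of B - frag_of C | A B C.
      A \<in> model_reps L \<and> B \<in> model_reps L \<and> C \<in> model_reps L \<and> rep_iso A (rep_sum B C)}"

definition relation_subgroup ::
  "'g::ab_group_add lie_alg \<Rightarrow> (('g, nat \<Rightarrow> complex) rep \<Rightarrow>\<^sub>0 int) set" where
  "relation_subgroup L = generate (free_Abelian_group (model_reps L)) (sum_relations L)"

definition rep_ring ::
  "'g::ab_group_add lie_alg \<Rightarrow> (('g, nat \<Rightarrow> complex) rep \<Rightarrow>\<^sub>0 int) set monoid" where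
  "rep_ring L = free_Abelian_group (model_reps L) Mod relation_subgroup L"

definition cl ::
  "'g::ab_group_add lie_alg \<Rightarrow> ('g, 'v::ab_group_add) rep
    \<Rightarrow> (('g, nat \<Rightarrow> complex) rep \<Rightarrow>\<^sub>0 int) set" where
  "cl L R = relation_subgroup L #>\<^bsub>free_Abelian_group (model_reps L)\<^esub>
              frag_of (SOME A. A \<in> model_reps L \<and> rep_iso R A)"


section \<open>Irreducibility and dimension of topological spaces\<close>

definition irreducible_space :: "'a topology \<Rightarrow> bool" where
  "irreducible_space X \<longleftrightarrow> topspace X \<noteq> {} \<and>
    (\<forall>A B. closedin X A \<and> closedin X B \<and> A \<union> B = topspace X
             \<longrightarrow> A = topspace X \<or> B = topspace X)"

text \<open>Krull dimension: the supremum of the lengths \<open>m\<close> of chains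
  \<open>Z 0 \<subset> Z 1 \<subset> \<dots> \<subset> Z m\<close> of irreducible closed subsets (\<open>0\<close> for the empty space).\<close>

definition krull_dim :: "'a topology \<Rightarrow> enat" where
  "krull_dim X = Sup {enat m | m. \<exists>Z.
     (\<forall>i\<le>m. closedin X (Z i) \<and> irreducible_space (subtopology X (Z i))) \<and>
     (\<forall>i<m. Z i \<subset> Z (Suc i))}"

definition local_dim :: "'a topology \<Rightarrow> 'a \<Rightarrow> enat" where
  "local_dim X p = (INF U\<in>{U. openin X U \<and> p \<in> U}. krull_dim (subtopology X U))"

definition locally_closed_in :: "'a topology \<Rightarrow> 'a set \<Rightarrow> bool" where
  "locally_closed_in X A \<longleftrightarrow> (\<exists>U C. openin X U \<and> closedin X C \<and> A = U \<inter> C)"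


section \<open>Affine space\<close>

text \<open>For a finite index set \<open>I\<close>, affine space with coordinates indexed by \<open>I\<close> is realised as the
  space of functions supported in \<open>I\<close>.\<close>

definition affine_space :: "'i set \<Rightarrow> ('i \<Rightarrow> complex) set" where
  "affine_space I = {p. \<forall>i. i \<notin> I \<longrightarrow> p i = 0}"

inductive_set polynomial_functions :: "'i set \<Rightarrow> (('i \<Rightarrow> complex) \<Rightarrow> complex) set"
  for I :: "'i set" where
  const: "(\<lambda>p. c) \<in> polynomial_functions I"
| coord: "i \<in> I \<Longrightarrow> (\<lambda>p. p i) \<in> polynomial_functions I"
| add: "f \<in> polynomial_functions I \<Longrightarrow> g \<in> polynomial_functions I
          \<Longrightarrow> (\<lambda>p. f p + g p) \<in> polynomial_functions I"
| mult: "f \<in> polynomial_functions I \<Longrightarrow> g \<in> polynomial_functions I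
          \<Longrightarrow> (\<lambda>p. f p * g p) \<in> polynomial_functions I"

definition zariski_open :: "'i set \<Rightarrow> ('i \<Rightarrow> complex) set \<Rightarrow> bool" where
  "zariski_open I U \<longleftrightarrow>
    (\<exists>F \<subseteq> polynomial_functions I. U = {p \<in> affine_space I. \<exists>f\<in>F. f p \<noteq> 0})"

definition zariski :: "'i set \<Rightarrow> ('i \<Rightarrow> complex) topology" where
  "zariski I = topology (zariski_open I)"

lemma istopology_zariski_open: "istopology (zariski_open I)"
  unfolding istopology_def
proof (intro conjI allI impI)
  fix S T assume "zariski_open I S" "zariski_open I T"
  then obtain F G where F: "F \<subseteq> polynomial_functions I" "S = {p \<in> affine_space I. \<exists>f\<in>F. f p \<noteq> 0}"
    and G: "G \<subseteq> polynomial_functions I" "T = {p \<in> affine_space I. \<exists>f\<in>G. f p \<noteq> 0}"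
    unfolding zariski_open_def by auto
  let ?H = "{\<lambda>p. f p * g p | f g. f \<in> F \<and> g \<in> G}"
  have "?H \<subseteq> polynomial_functions I"
    using F(1) G(1) by (auto intro!: polynomial_functions.mult)
  moreover have "S \<inter> T = {p \<in> affine_space I. \<exists>h\<in>?H. h p \<noteq> 0}"
  proof (intro equalityI subsetI)
    fix p assume "p \<in> S \<inter> T"
    then obtain f g where fg: "p \<in> affine_space I" "f \<in> F" "g \<in> G" "f p \<noteq> 0" "g p \<noteq> 0"
      unfolding F(2) G(2) by blast
    then have "(\<lambda>p. f p * g p) \<in> ?H" by blast
    with fg show "p \<in> {p \<in> affine_space I. \<exists>h\<in>?H. h p \<noteq> 0}"
      by (intro CollectI conjI bexI[of _ "\<lambda>p. f p * g p"]) auto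
  next
    fix p assume "p \<in> {p \<in> affine_space I. \<exists>h\<in>?H. h p \<noteq> 0}"
    then obtain f g where "p \<in> affine_space I" "f \<in> F" "g \<in> G" "f p * g p \<noteq> 0"
      by blast
    then show "p \<in> S \<inter> T"
      unfolding F(2) G(2) by auto
  qed
  ultimately show "zariski_open I (S \<inter> T)"
    unfolding zariski_open_def by blast
next
  fix K assume K: "\<forall>U\<in>K. zariski_open I U"
  let ?F = "{f \<in> polynomial_functions I. \<forall>p\<in>affine_space I. f p \<noteq> 0 \<longrightarrow> p \<in> \<Union>K}"
  have "\<Union>K = {p \<in> affine_space I. \<exists>f\<in>?F. f p \<noteq> 0}"
  proof (intro equalityI subsetI)
    fix p assume "p \<in> \<Union>K"
    then obtain U where U: "U \<in> K" "p \<in> U" by blast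
    with K obtain F where F: "F \<subseteq> polynomial_functions I"
      "U = {p \<in> affine_space I. \<exists>f\<in>F. f p \<noteq> 0}"
      unfolding zariski_open_def by blast
    with U obtain f where f: "f \<in> F" "f p \<noteq> 0" "p \<in> affine_space I" by blast
    have "q \<in> \<Union>K" if "q \<in> affine_space I" "f q \<noteq> 0" for q
      using that f(1) F(2) U(1) by blast
    with f F(1) have "f \<in> ?F" by blast
    with f show "p \<in> {p \<in> affine_space I. \<exists>f\<in>?F. f p \<noteq> 0}" by blast
  next
    fix p assume "p \<in> {p \<in> affine_space I. \<exists>f\<in>?F. f p \<noteq> 0}"
    then show "p \<in> \<Union>K" by blast
  qed
  moreover have "?F \<subseteq> polynomial_functions I" by blast
  ultimately show "zariski_open I (\<Union>K)"
    unfolding zariski_open_def by blast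
qed

lemma openin_zariski: "openin (zariski I) U \<longleftrightarrow> zariski_open I U"
  by (simp add: zariski_def topology_inverse' istopology_zariski_open)

text \<open>The tangent space at \<open>p\<close> of a locally closed \<open>X\<close>: the vectors killed by the differentials
  at \<open>p\<close> of all polynomials in the ideal of \<open>X\<close>. A point of \<open>X\<close> is nonsingular if the dimension of
  the tangent space equals the local dimension.\<close>

definition tangent_space :: "'i set \<Rightarrow> ('i \<Rightarrow> complex) set \<Rightarrow> ('i \<Rightarrow> complex) \<Rightarrow> ('i \<Rightarrow> complex) set"
  where
  "tangent_space I X p =
    {v \<in> affine_space I. \<forall>f\<in>polynomial_functions I. (\<forall>x\<in>X. f x = 0) \<longrightarrow>
       deriv (\<lambda>t::complex. f (\<lambda>i. p i + t * v i)) 0 = 0}"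

definition nonsingular_at :: "'i set \<Rightarrow> ('i \<Rightarrow> complex) set \<Rightarrow> ('i \<Rightarrow> complex) \<Rightarrow> bool" where
  "nonsingular_at I X p \<longleftrightarrow>
    enat (vector_space.dim fun_scale (tangent_space I X p))
      = local_dim (subtopology (zariski I) X) p"


section \<open>Grassmannians\<close>

definition grassmannian ::
  "(complex \<Rightarrow> 'v \<Rightarrow> 'v) \<Rightarrow> 'v::ab_group_add set \<Rightarrow> nat \<Rightarrow> 'v set set" where
  "grassmannian s V d = {T. module.subspace s T \<and> T \<subseteq> V \<and> vector_space.dim s T = d}"

definition ordered_basis ::
  "(complex \<Rightarrow> 'v \<Rightarrow> 'v) \<Rightarrow> 'v::ab_group_add set \<Rightarrow> (nat \<Rightarrow> 'v) \<Rightarrow> bool" where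
  "ordered_basis s V b \<longleftrightarrow>
    inj_on b {..<vector_space.dim s V} \<and>
    \<not> module.dependent s (b ` {..<vector_space.dim s V}) \<and>
    module.span s (b ` {..<vector_space.dim s V}) = V"

text \<open>The standard affine charts: an ordered basis \<open>b\<close> splits \<open>V\<close> as \<open>A \<oplus> B\<close> with
  \<open>A\<close> spanned by the first \<open>d\<close> basis vectors, and the matrix \<open>c\<close> of a linear map from \<open>A\<close> to \<open>B\<close>
  is sent to the graph of that map.\<close>

definition chart_index :: "(complex \<Rightarrow> 'v \<Rightarrow> 'v) \<Rightarrow> 'v::ab_group_add set \<Rightarrow> nat \<Rightarrow> (nat \<times> nat) set"
  where
  "chart_index s V d = {..<d} \<times> {d..<vector_space.dim s V}"

definition gr_chart ::
  "(complex \<Rightarrow> 'v \<Rightarrow> 'v) \<Rightarrow> 'v::ab_group_add set \<Rightarrow> nat \<Rightarrow> (nat \<Rightarrow> 'v)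
    \<Rightarrow> (nat \<times> nat \<Rightarrow> complex) \<Rightarrow> 'v set" where
  "gr_chart s V d b c =
    module.span s ((\<lambda>i. b i + (\<Sum>j\<in>{d..<vector_space.dim s V}. s (c (i, j)) (b j))) ` {..<d})"

definition chart_preimage ::
  "(complex \<Rightarrow> 'v \<Rightarrow> 'v) \<Rightarrow> 'v::ab_group_add set \<Rightarrow> nat \<Rightarrow> (nat \<Rightarrow> 'v) \<Rightarrow> 'v set set
    \<Rightarrow> (nat \<times> nat \<Rightarrow> complex) set" where
  "chart_preimage s V d b X = {c \<in> affine_space (chart_index s V d). gr_chart s V d b c \<in> X}"

text \<open>The Zariski topology of the Grassmannian is glued from the charts.\<close>

definition gr_open ::
  "(complex \<Rightarrow> 'v \<Rightarrow> 'v) \<Rightarrow> 'v::ab_group_add set \<Rightarrow> nat \<Rightarrow> 'v set set \<Rightarrow> bool" where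
  "gr_open s V d U \<longleftrightarrow> U \<subseteq> grassmannian s V d \<and>
    (\<forall>b. ordered_basis s V b
       \<longrightarrow> openin (zariski (chart_index s V d)) (chart_preimage s V d b U))"

definition gr_zariski ::
  "(complex \<Rightarrow> 'v \<Rightarrow> 'v) \<Rightarrow> 'v::ab_group_add set \<Rightarrow> nat \<Rightarrow> 'v set topology" where
  "gr_zariski s V d = topology (gr_open s V d)"

lemma istopology_gr_open: "istopology (gr_open s V d)"
  unfolding istopology_def
proof (intro conjI allI impI)
  fix S T assume "gr_open s V d S" "gr_open s V d T"
  moreover have "chart_preimage s V d b (S \<inter> T)
      = chart_preimage s V d b S \<inter> chart_preimage s V d b T" for b
    by (auto simp: chart_preimage_def)
  ultimately show "gr_open s V d (S \<inter> T)"
    by (auto simp: gr_open_def)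
next
  fix K assume "\<forall>U\<in>K. gr_open s V d U"
  moreover have "chart_preimage s V d b (\<Union>K) = (\<Union>U\<in>K. chart_preimage s V d b U)" for b
    by (auto simp: chart_preimage_def)
  ultimately show "gr_open s V d (\<Union>K)"
    by (auto simp: gr_open_def)
qed

lemma openin_gr_zariski: "openin (gr_zariski s V d) U \<longleftrightarrow> gr_open s V d U"
  by (simp add: gr_zariski_def topology_inverse' istopology_gr_open)

text \<open>Nonsingularity is a local notion invariant under isomorphism, so at each point it may be
  tested in any one chart around that point.\<close>

definition gr_smooth ::
  "(complex \<Rightarrow> 'v \<Rightarrow> 'v) \<Rightarrow> 'v::ab_group_add set \<Rightarrow> nat \<Rightarrow> 'v set set \<Rightarrow> bool" where
  "gr_smooth s V d X \<longleftrightarrow>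
    (\<forall>T\<in>X. \<exists>b c. ordered_basis s V b \<and> c \<in> chart_preimage s V d b X \<and> gr_chart s V d b c = T \<and>
        nonsingular_at (chart_index s V d) (chart_preimage s V d b X) c)"

definition Gr_rep :: "('g, 'v::ab_group_add) rep \<Rightarrow> 'v set \<Rightarrow> 'v set set" where
  "Gr_rep V S = {T. is_subrep V T \<and> rep_iso (subrep V T) (subrep V S)}"

end

theory Submission
  imports Defs "HOL-Computational_Algebra.Fundamental_Theorem_Algebra"
    "Jordan_Normal_Form.Determinant"
begin

text \<open>Dimensions of spaces of equivariant maps are additive in both arguments, hence are computed by
  classes in the representation ring. Comparing \<open>Hom(V, V)\<close> with \<open>Hom(V, V')\<close>, where \<open>V'\<close> is the sum of
  all images of the \<open>W i\<close> in \<open>V\<close>, gives \<open>V' = V\<close>, so neither complete reducibility nor the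
  Krull-Schmidt theorem is needed. Any two members \<open>T\<close>, \<open>T'\<close> of \<open>Gr_rep V S\<close> then have a common
  complement \<open>K\<close> that is a subrepresentation, and in the chart of the Grassmannian given by a basis
  adapted to \<open>V = T \<oplus> K\<close>, which contains \<open>T\<close> and \<open>T'\<close>, the set \<open>Gr_rep V S\<close> becomes the linear
  subspace \<open>Hom(T, K)\<close> of the space of matrices. Its dimension is the sum of the
  \<open>s i * (n i - s i)\<close>, so everything reduces to linear subspaces of affine space.\<close>

section \<open>Finite dimensional subspaces\<close>

text \<open>The hypotheses tie \<open>V\<close> and \<open>S\<close> to the \<open>W i\<close> only
  through an equation between cosets of a quotient group, with integer exponents. From such an
  equation one can read off exactly the values of additive functions. Dimensions of Hom spaces are
  suitable ones: their additivity needs only the projections of a direct sum, and since a subspace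
  of full finite dimension is everything, equal numbers turn back into equal Hom spaces. For
  endomorphisms of \<open>V\<close> this catches the identity map. The topology of the Grassmannian
  refers to all charts at once, so even the openness of one chart domain needs the transition maps
  to every other chart; they are written as adjugate over determinant to be visibly rational.
  Irreducibility is not a local property. It is global here because any two points share an
  irreducible open piece; dimension and smoothness can then be read off in single charts. For a
  linear space the upper bound of the Krull dimension is the hard half, as chains of arbitrary
  irreducible closed sets have to be bounded and not only flags of linear ones.\<close>

definition finitely_spanned ::
  "('k::field \<Rightarrow> 'v \<Rightarrow> 'v) \<Rightarrow> 'v::ab_group_add set \<Rightarrow> bool" where
  "finitely_spanned s A \<longleftrightarrow> (\<exists>B. finite B \<and> A \<subseteq> module.span s B)"

lemma (in vector_space) finitely_spannedI: "finite B \<Longrightarrow> A \<subseteq> span B \<Longrightarrow> finitely_spanned scale A"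
  unfolding finitely_spanned_def by blast

lemma (in vector_space) finitely_spanned_mono: "finitely_spanned scale B \<Longrightarrow> A \<subseteq> B \<Longrightarrow> finitely_spanned scale A"
  unfolding finitely_spanned_def by blast

lemma (in vector_space) finitely_spanned_independent:
  assumes "finitely_spanned scale A" "B \<subseteq> A" "independent B"
  shows "finite B"
  using assms independent_span_bound unfolding finitely_spanned_def by blast

lemma (in vector_space) finitely_spanned_basis:
  assumes "finitely_spanned scale A"
  obtains B where "B \<subseteq> A" "independent B" "finite B" "A \<subseteq> span B" "card B = dim A"
  using basis_exists[of A] finitely_spanned_independent[OF assms] by metis

text \<open>\<open>dim\<close> is the cardinality of a basis and hence 0 when the bases are
  infinite. Monotonicity therefore requires a finite spanning set for the larger side.\<close>

lemma (in vector_space) dim_mono_finitely_spanned: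
  assumes "A \<subseteq> span B" "finitely_spanned scale B"
  shows "dim A \<le> dim B"
proof -
  obtain C where C: "C \<subseteq> B" "independent C" "finite C" "B \<subseteq> span C" "card C = dim B"
    using finitely_spanned_basis[OF assms(2)] .
  then have "A \<subseteq> span C"
    using assms(1) span_minimal[of B "span C"] by blast
  then show ?thesis
    using dim_le_card[of A C] C by simp
qed

lemma (in vector_space) subspace_dim_equal_finitely_spanned:
  assumes "subspace A" "A \<subseteq> B" "finitely_spanned scale B" "dim B \<le> dim A"
  shows "A = B"
proof -
  obtain C where C: "C \<subseteq> A" "independent C" "finite C" "A \<subseteq> span C" "card C = dim A"
    using finitely_spanned_basis[OF finitely_spanned_mono[OF assms(3,2)]] .
  have "B \<subseteq> span C"
  proof
    fix x assume x: "x \<in> B"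
    show "x \<in> span C"
    proof (rule ccontr)
      assume "x \<notin> span C"
      then have ind: "independent (insert x C)"
        using C(2) by (rule independent_insertI)
      have "x \<notin> C"
        using \<open>x \<notin> span C\<close> span_base by metis
      have "dim (insert x C) \<le> dim B"
        by (rule dim_mono_finitely_spanned[OF _ assms(3)])
          (use x C(1) assms(2) span_superset[of B] in auto)
      then show False
        using dim_eq_card_independent[OF ind] C \<open>x \<notin> C\<close> assms(4) by simp
    qed
  qed
  then show ?thesis
    using C(1) assms(1,2) span_minimal by blast
qed

lemma (in vector_space) dim_direct_sum:
  assumes A: "subspace A" "finitely_spanned scale A" and B: "subspace B" "finitely_spanned scale B"
    and AB: "A \<inter> B = {0}"
  shows "dim {a + b | a b. a \<in> A \<and> b \<in> B} = dim A + dim B"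
proof -
  obtain C where C: "C \<subseteq> A" "independent C" "finite C" "A \<subseteq> span C" "card C = dim A"
    using finitely_spanned_basis[OF A(2)] .
  obtain D where D: "D \<subseteq> B" "independent D" "finite D" "B \<subseteq> span D" "card D = dim B"
    using finitely_spanned_basis[OF B(2)] .
  have sC: "span C = A" and sD: "span D = B"
    using C D A B span_subspace by blast+
  have disj: "C \<inter> D = {}"
  proof (rule ccontr)
    assume "C \<inter> D \<noteq> {}"
    then obtain x where x: "x \<in> C" "x \<in> D" by blast
    then have "x \<in> A \<inter> B" using C(1) D(1) by blast
    then have "0 \<in> C" using AB x(1) by simp
    then show False
      using C(2) dependent_zero by simp
  qed
  have ind: "independent (C \<union> D)"
  proof (rule independent_if_scalars_zero)
    show "finite (C \<union> D)" using C D by simp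
    fix f x assume sum: "(\<Sum>x\<in>C \<union> D. scale (f x) x) = 0" and x: "x \<in> C \<union> D"
    have eq: "(\<Sum>x\<in>C. scale (f x) x) + (\<Sum>x\<in>D. scale (f x) x) = 0"
      using sum sum.union_disjoint[OF C(3) D(3) disj, of "\<lambda>x. scale (f x) x"] by simp
    have a: "(\<Sum>x\<in>C. scale (f x) x) \<in> A"
      using C(1) A(1) by (intro subspace_sum subspace_scale) auto
    have b: "(\<Sum>x\<in>D. scale (f x) x) \<in> B"
      using D(1) B(1) by (intro subspace_sum subspace_scale) auto
    have "(\<Sum>x\<in>C. scale (f x) x) = - (\<Sum>x\<in>D. scale (f x) x)"
      using eq by (simp add: eq_neg_iff_add_eq_0)
    then have "(\<Sum>x\<in>C. scale (f x) x) \<in> A \<inter> B"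
      using a b subspace_neg[OF B(1)] by simp
    then have "(\<Sum>x\<in>C. scale (f x) x) = 0" "(\<Sum>x\<in>D. scale (f x) x) = 0"
      using AB eq by auto
    then show "f x = 0"
      using x independentD[OF C(2) C(3) order_refl] independentD[OF D(2) D(3) order_refl]
      by blast
  qed
  have "card (C \<union> D) = dim {a + b | a b. a \<in> A \<and> b \<in> B}"
  proof (rule basis_card_eq_dim[OF _ _ ind])
    show "C \<union> D \<subseteq> {a + b | a b. a \<in> A \<and> b \<in> B}"
    proof
      fix x assume "x \<in> C \<union> D"
      then have "x + 0 \<in> {a + b | a b. a \<in> A \<and> b \<in> B} \<or> 0 + x \<in> {a + b | a b. a \<in> A \<and> b \<in> B}"
        using C D subspace_0[OF A(1)] subspace_0[OF B(1)] by blast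
      then show "x \<in> {a + b | a b. a \<in> A \<and> b \<in> B}" by simp
    qed
    show "{a + b | a b. a \<in> A \<and> b \<in> B} \<subseteq> span (C \<union> D)"
      unfolding span_Un sC sD by blast
  qed
  then show ?thesis
    using card_Un_disjoint[OF C(3) D(3) disj] C D by simp
qed

lemma (in vector_space) not_in_union_two_subspaces:
  assumes "subspace A" "subspace B" "subspace C" "A \<subset> C" "B \<subset> C"
  obtains x where "x \<in> C" "x \<notin> A" "x \<notin> B"
proof -
  obtain x y where x: "x \<in> C" "x \<notin> A" and y: "y \<in> C" "y \<notin> B"
    using assms by blast
  show thesis
  proof (cases "x \<in> B \<and> y \<in> A")
    \<comment> \<open>Each of the two vectors lies in the other subspace, so their sum lies in
      neither.\<close>
    case True
    have "x + y \<notin> A"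
      using subspace_diff[OF assms(1), of "x + y" y] True x by auto
    moreover have "x + y \<notin> B"
      using subspace_diff[OF assms(2), of "x + y" x] True y by auto
    ultimately show ?thesis
      using that subspace_add[OF assms(3)] x y by blast
  qed (use that x y in blast)
qed


text \<open>Formulated for indexed families because the iterates of a map, or the monomials in some
  functions, may coincide. A repeated member is itself a relation, with coefficients 1 and
  -1.\<close>

lemma (in vector_space) family_relation:
  assumes "finite I" "v ` I \<subseteq> U" "finitely_spanned scale U" "dim U < card I"
  obtains c where "\<exists>i\<in>I. c i \<noteq> 0" "(\<Sum>i\<in>I. scale (c i) (v i)) = 0"
proof (cases "inj_on v I")
  case True
  have "dependent (v ` I)"
  proof (rule ccontr)
    assume "independent (v ` I)"
    then have "card (v ` I) \<le> dim U"
      using dim_eq_card_independent dim_mono_finitely_spanned[of "v ` I" U] assms(2,3)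
        span_superset[of U] by (metis order_trans)
    then show False using card_image[OF True] assms(4) by simp
  qed
  then obtain u where u: "\<exists>x\<in>v ` I. u x \<noteq> 0" "(\<Sum>x\<in>v ` I. scale (u x) x) = 0"
    using dependent_finite[OF finite_imageI[OF assms(1)]] by blast
  show thesis
  proof (rule that[of "u \<circ> v"])
    show "\<exists>i\<in>I. (u \<circ> v) i \<noteq> 0" using u(1) by auto
    show "(\<Sum>i\<in>I. scale ((u \<circ> v) i) (v i)) = 0"
      using u(2) sum.reindex[OF True, of "\<lambda>x. scale (u x) x"] by (simp add: comp_def)
  qed
next
  case False
  then obtain i j where ij: "i \<in> I" "j \<in> I" "i \<noteq> j" "v i = v j"
    unfolding inj_on_def by blast
  show thesis
  proof (rule that[of "\<lambda>l. if l = i then 1 else if l = j then - 1 else 0"])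
    show "\<exists>l\<in>I. (if l = i then 1 else if l = j then - 1 else 0) \<noteq> (0::'a)"
      using ij(1) by (intro bexI[of _ i]) auto
    have "(\<Sum>l\<in>I. scale (if l = i then 1 else if l = j then - 1 else 0) (v l))
        = (\<Sum>l\<in>{i, j}. scale (if l = i then 1 else if l = j then - 1 else 0) (v l))"
      using assms(1) ij by (intro sum.mono_neutral_right) auto
    then show "(\<Sum>l\<in>I. scale (if l = i then 1 else if l = j then - 1 else 0) (v l)) = 0"
      using ij by simp
  qed
qed

text \<open>\<open>linear_on\<close> says nothing about values off \<open>U\<close>. Extending from
  a basis of \<open>U\<close> gives a total linear map, to which the theory of linear maps
  applies.\<close>

lemma linear_on_extend:
  assumes vs: "vector_space s1" "vector_space s2"
    and "linear_on s1 s2 U f" "module.subspace s1 U"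
  obtains g where "Vector_Spaces.linear s1 s2 g" "\<And>u. u \<in> U \<Longrightarrow> g u = f u"
proof -
  interpret vector_space_pair s1 s2 using vs by (rule vector_space_pair.intro)
  note assms = assms(3-)
  obtain B where B: "B \<subseteq> U" "vs1.independent B" "U \<subseteq> vs1.span B"
    using vs1.basis_exists by metis
  obtain g where g: "Vector_Spaces.linear s1 s2 g" "\<And>x. x \<in> B \<Longrightarrow> g x = f x"
    using linear_independent_extend[OF B(2), of f] by blast
  interpret g: Vector_Spaces.linear s1 s2 g by (rule g(1))
  have f0: "f 0 = 0"
    using assms vs1.subspace_0[OF assms(2)] unfolding linear_on_def
    by (metis add.left_neutral add_left_cancel add.right_neutral)
  have "u \<in> U \<and> g u = f u" if "u \<in> vs1.span B" for u
    using that
  proof (induction rule: vs1.span_induct_alt)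
    case base
    then show ?case using f0 vs1.subspace_0[OF assms(2)] g.zero by simp
  next
    case (step c x y)
    then have "s1 c x \<in> U" "x \<in> U"
      using B(1) vs1.subspace_scale[OF assms(2)] by blast+
    then show ?case
      using assms(1) step g(2) vs1.subspace_add[OF assms(2)]
      unfolding linear_on_def by (simp add: g.add g.scale)
  qed
  then show thesis
    using that g(1) B(3) by blast
qed

lemma dim_image_linear_on:
  assumes vs: "vector_space s1" "vector_space s2"
    and "linear_on s1 s2 U f" "module.subspace s1 U" "inj_on f U" "finitely_spanned s1 U"
  shows "vector_space.dim s2 (f ` U) = vector_space.dim s1 U"
    and "module.subspace s2 (f ` U)" and "finitely_spanned s2 (f ` U)"
proof -
  interpret vector_space_pair s1 s2 using vs by (rule vector_space_pair.intro)
  note assms = assms(3-)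
  obtain g where g: "Vector_Spaces.linear s1 s2 g" "\<And>u. u \<in> U \<Longrightarrow> g u = f u"
    using linear_on_extend[OF vs assms(1,2)] by blast
  interpret g: Vector_Spaces.linear s1 s2 g by (rule g(1))
  have im: "f ` U = g ` U" using g(2) by simp
  have inj: "inj_on g U"
    using assms(3) g(2) unfolding inj_on_def by metis
  obtain B where B: "B \<subseteq> U" "vs1.independent B" "finite B" "U \<subseteq> vs1.span B" "card B = vs1.dim U"
    using vs1.finitely_spanned_basis[OF assms(4)] .
  have sB: "vs1.span B = U" using B assms(2) vs1.span_subspace by blast
  have "vs2.independent (g ` B)"
    using linear_independent_injective_image[OF g(1) B(2)] inj sB by simp
  moreover have span: "vs2.span (g ` B) = g ` U"
    using linear_span_image[OF g(1)] sB by simp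
  moreover have "card (g ` B) = card B"
    using inj_on_subset[OF inj B(1)] by (rule card_image)
  ultimately show "vs2.dim (f ` U) = vs1.dim U"
    using vs2.dim_span_eq_card_independent[of "g ` B"] im B(5) by simp
  show "vs2.subspace (f ` U)"
    unfolding im using linear_subspace_image[OF g(1) assms(2)] .
  show "finitely_spanned s2 (f ` U)"
    using B(3) span im by (intro vs2.finitely_spannedI[of "g ` B"]) simp_all
qed

section \<open>Spaces of equivariant maps\<close>

definition fscale :: "(complex \<Rightarrow> 'w \<Rightarrow> 'w) \<Rightarrow> complex \<Rightarrow> ('v \<Rightarrow> 'w) \<Rightarrow> 'v \<Rightarrow> 'w" where
  "fscale s c f = (\<lambda>x. s c (f x))"

lemma vector_space_fscale:
  assumes "vector_space s"
  shows "vector_space (fscale s :: complex \<Rightarrow> ('v \<Rightarrow> 'w::ab_group_add) \<Rightarrow> 'v \<Rightarrow> 'w)"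
proof -
  interpret vector_space s by (rule assms)
  show ?thesis
    by unfold_locales (auto simp: fscale_def scale_right_distrib scale_left_distrib)
qed

lemma sum_fun_eval: "(\<Sum>i\<in>I. F i) x = (\<Sum>i\<in>I. F i x)"
  for F :: "'i \<Rightarrow> 'v \<Rightarrow> 'w::ab_group_add"
  by (induction I rule: infinite_finite_induct) auto

lemma linear_on_zero:
  assumes "linear_on s1 s2 U f" "0 \<in> U"
  shows "f 0 = 0"
  using assms unfolding linear_on_def by (metis add.right_neutral add_left_cancel)

text \<open>Equivariant maps are normalised to vanish outside \<open>space R\<close>, so that they form a
  subspace of a function space.\<close>

definition rep_hom ::
  "('g, 'v::ab_group_add) rep \<Rightarrow> ('g, 'w::ab_group_add) rep \<Rightarrow> ('v \<Rightarrow> 'w) set" where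
  "rep_hom R R' = {f. linear_on (scl R) (scl R') (space R) f \<and> f ` space R \<subseteq> space R' \<and>
     (\<forall>x. \<forall>v\<in>space R. f (act R x v) = act R' x (f v)) \<and> (\<forall>v. v \<notin> space R \<longrightarrow> f v = 0)}"

definition hom_dim ::
  "('g, 'v::ab_group_add) rep \<Rightarrow> ('g, 'w::ab_group_add) rep \<Rightarrow> nat" where
  "hom_dim R R' = vector_space.dim (fscale (scl R')) (rep_hom R R')"

lemma space_subrep [simp]: "space (subrep R A) = A"
  and scl_subrep [simp]: "scl (subrep R A) = scl R"
  and act_subrep [simp]: "act (subrep R A) = act R"
  by (simp_all add: subrep_def)

lemma subrep_space [simp]: "subrep R (space R) = R"
  by (simp add: subrep_def)

lemma (in fd_representation) finitely_spanned_space: "finitely_spanned (scl R) (space R)"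
  using finite_dim_space unfolding finitely_spanned_def by blast

lemma (in fd_representation) zero_in_space: "0 \<in> space R"
  using module.subspace_0[OF _ subspace_space] vector_space_scl module_iff_vector_space by blast

lemma fd_representation_subrep:
  assumes "fd_representation L R" "is_subrep R A"
  shows "fd_representation L (subrep R A)"
proof -
  interpret fd_representation L R by (rule assms(1))
  interpret vs: vector_space "scl R" by (rule vector_space_scl)
  have A: "vs.subspace A" "A \<subseteq> space R" "\<And>x v. v \<in> A \<Longrightarrow> act R x v \<in> A"
    using assms(2) unfolding is_subrep_def by auto
  obtain B where B: "B \<subseteq> A" "finite B" "A \<subseteq> vs.span B"
    using vs.finitely_spanned_basis[OF vs.finitely_spanned_mono[OF finitely_spanned_space A(2)]]
    by metis
  then have "vs.span B = A" using A(1) vs.span_subspace by blast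
  then show ?thesis
    using A B act_linear act_linear_alg act_bracket vector_space_scl
    by (intro fd_representation.intro fd_representation_axioms.intro lie_algebra_axioms)
      (auto simp: linear_on_def subset_iff)
qed

lemma rep_homD:
  assumes "f \<in> rep_hom R R'"
  shows "linear_on (scl R) (scl R') (space R) f"
    and "v \<in> space R \<Longrightarrow> f v \<in> space R'"
    and "v \<in> space R \<Longrightarrow> f (act R x v) = act R' x (f v)"
    and "v \<notin> space R \<Longrightarrow> f v = 0"
    and "u \<in> space R \<Longrightarrow> v \<in> space R \<Longrightarrow> f (u + v) = f u + f v"
    and "v \<in> space R \<Longrightarrow> f (scl R c v) = scl R' c (f v)"
  using assms unfolding rep_hom_def linear_on_def by auto

lemma rep_hom_zero:
  assumes "f \<in> rep_hom R R'"
  shows "f 0 = 0"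
  using rep_homD(1,4)[OF assms] linear_on_zero by metis

lemma rep_hom_comp:
  assumes "f \<in> rep_hom Q R" "g \<in> rep_hom R R'"
  shows "g \<circ> f \<in> rep_hom Q R'"
  using assms rep_hom_zero[OF assms(2)] unfolding rep_hom_def linear_on_def
  by (auto simp: image_subset_iff)

lemma rep_hom_target:
  assumes "is_subrep R A"
  shows "f \<in> rep_hom Q (subrep R A) \<longleftrightarrow> f \<in> rep_hom Q R \<and> f ` space Q \<subseteq> A"
  using assms unfolding rep_hom_def is_subrep_def by auto

lemma is_subrepD:
  assumes "fd_representation L R" "is_subrep R A"
  shows "0 \<in> A" and "u \<in> A \<Longrightarrow> v \<in> A \<Longrightarrow> u + v \<in> A" and "u \<in> A \<Longrightarrow> v \<in> A \<Longrightarrow> u - v \<in> A"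
    and "u \<in> A \<Longrightarrow> scl R c u \<in> A" and "u \<in> A \<Longrightarrow> u \<in> space R" and "u \<in> A \<Longrightarrow> act R x u \<in> A"
    and "module.subspace (scl R) A"
proof -
  interpret fd_representation L R by (rule assms(1))
  interpret vector_space "scl R" by (rule vector_space_scl)
  have sub: "subspace A" "A \<subseteq> space R" "\<And>x v. v \<in> A \<Longrightarrow> act R x v \<in> A"
    using assms(2) unfolding is_subrep_def by auto
  show "0 \<in> A" and "u \<in> A \<Longrightarrow> v \<in> A \<Longrightarrow> u + v \<in> A" and "u \<in> A \<Longrightarrow> v \<in> A \<Longrightarrow> u - v \<in> A"
    and "u \<in> A \<Longrightarrow> scl R c u \<in> A" and "u \<in> A \<Longrightarrow> u \<in> space R" and "u \<in> A \<Longrightarrow> act R x u \<in> A"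
    and "module.subspace (scl R) A"
    using sub subspace_0[OF sub(1)] subspace_add[OF sub(1)] subspace_diff[OF sub(1)]
      subspace_scale[OF sub(1)] by auto
qed

lemma is_subrep_space: "fd_representation L R \<Longrightarrow> is_subrep R (space R)"
  unfolding is_subrep_def
  using fd_representation.subspace_space fd_representation.act_closed by blast

lemma rep_hom_source:
  assumes "fd_representation L R" "is_subrep R A" "f \<in> rep_hom R Q"
  shows "(\<lambda>v. if v \<in> A then f v else 0) \<in> rep_hom (subrep R A) Q"
  using is_subrepD[OF assms(1,2)] rep_homD[OF assms(3)]
  unfolding rep_hom_def linear_on_def by auto

lemma
  fixes R :: "('g::ab_group_add, 'v::ab_group_add) rep" and R' :: "('g, 'w::ab_group_add) rep"
  assumes R: "fd_representation L R" and R': "fd_representation L R'"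
  shows rep_hom_subspace: "module.subspace (fscale (scl R')) (rep_hom R R')"
    and finitely_spanned_rep_hom: "finitely_spanned (fscale (scl R')) (rep_hom R R')"
proof -
  interpret R: fd_representation L R by (rule R)
  interpret R': fd_representation L R' by (rule R')
  interpret vs: vector_space "scl R" by (rule R.vector_space_scl)
  interpret vs': vector_space "scl R'" by (rule R'.vector_space_scl)
  interpret fs: vector_space "fscale (scl R') :: complex \<Rightarrow> ('v \<Rightarrow> 'w) \<Rightarrow> 'v \<Rightarrow> 'w"
    by (rule vector_space_fscale) (rule R'.vector_space_scl)
  note R_closed = is_subrepD[OF R is_subrep_space[OF R]]
  note R'_closed = is_subrepD[OF R' is_subrep_space[OF R']]
  have act_lin: "act R' x (u + v) = act R' x u + act R' x v"
      "act R' x (scl R' c u) = scl R' c (act R' x u)"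
    if "u \<in> space R'" "v \<in> space R'" for x u v c
    using R'.act_linear that unfolding linear_on_def by auto
  have act_0: "act R' x 0 = 0" for x
    using linear_on_zero[OF R'.act_linear R'.zero_in_space] .
  show "fs.subspace (rep_hom R R')"
    by (rule fs.subspaceI)
      (auto simp: rep_hom_def linear_on_def fscale_def act_lin act_0 R'_closed image_subset_iff
        R'.zero_in_space vs'.scale_right_distrib vs'.scale_left_commute)
  obtain B where B: "B \<subseteq> space R" "vs.independent B" "finite B" "space R \<subseteq> vs.span B"
    using vs.finitely_spanned_basis[OF R.finitely_spanned_space] by metis
  obtain C where C: "finite C" "C \<subseteq> space R'" "vs'.span C = space R'"
    using R'.finite_dim_space by blast
  \<comment> \<open>\<open>e b v\<close> is the coordinate at \<open>b\<close> times
    \<open>v\<close>. These maps need not be equivariant, but with \<open>v\<close> from the finite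
    set \<open>C\<close> they span every normalised linear map into \<open>space R'\<close>, hence
    also the equivariant ones.\<close>
  define e where "e b v = (\<lambda>x. if x \<in> space R then scl R' (vs.representation B x b) v else 0)"
    for b v
  have e_lin: "Vector_Spaces.linear (scl R') (fscale (scl R')) (e b)" for b
    by unfold_locales
      (auto simp: e_def fscale_def fun_eq_iff vs'.scale_right_distrib vs'.scale_left_commute)
  show "finitely_spanned (fscale (scl R')) (rep_hom R R')"
  proof (rule fs.finitely_spannedI)
    show "finite (\<Union>b\<in>B. e b ` C)" using B C by blast
    show "rep_hom R R' \<subseteq> fs.span (\<Union>b\<in>B. e b ` C)"
    proof
      fix f assume f: "f \<in> rep_hom R R'"
      obtain g where g: "Vector_Spaces.linear (scl R) (scl R') g"
        "\<And>u. u \<in> space R \<Longrightarrow> g u = f u"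
        using linear_on_extend[OF R.vector_space_scl R'.vector_space_scl rep_homD(1)[OF f]
            R.subspace_space] by blast
      interpret g: Vector_Spaces.linear "scl R" "scl R'" g by (rule g(1))
      have eq: "f = (\<Sum>b\<in>B. e b (f b))"
      proof
        fix x
        show "f x = (\<Sum>b\<in>B. e b (f b)) x"
        proof (cases "x \<in> space R")
          case True
          then have "x = (\<Sum>b\<in>B. scl R (vs.representation B x b) b)"
            using vs.sum_representation_eq[OF B(2) _ B(3) order_refl, of x] B(4) by auto
          then have "f x = (\<Sum>b\<in>B. scl R' (vs.representation B x b) (g b))"
            using g(2)[OF True] by (metis (no_types, lifting) g.scale g.sum sum.cong)
          also have "\<dots> = (\<Sum>b\<in>B. e b (f b) x)"
            using g(2) B(1) True by (intro sum.cong) (auto simp: e_def)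
          finally show ?thesis by (simp add: sum_fun_eval)
        qed (use rep_homD(4)[OF f] in \<open>auto simp: sum_fun_eval e_def\<close>)
      qed
      have "e b (f b) \<in> fs.span (\<Union>b\<in>B. e b ` C)" if "b \<in> B" for b
      proof -
        have "f b \<in> vs'.span C"
          using C(3) rep_homD(2)[OF f] B(1) that by blast
        then have "e b (f b) \<in> fs.span (e b ` C)"
          using module_hom.span_image[OF e_lin[unfolded linear_iff_module_hom]] by blast
        then show ?thesis
          using fs.span_mono[of "e b ` C" "\<Union>b\<in>B. e b ` C"] that by blast
      qed
      then have "(\<Sum>b\<in>B. e b (f b)) \<in> fs.span (\<Union>b\<in>B. e b ` C)"
        by (rule fs.span_sum)
      then show "f \<in> fs.span (\<Union>b\<in>B. e b ` C)"
        by (rule eq[THEN ssubst])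
    qed
  qed
qed

lemma hom_dim_pullback:
  assumes R: "fd_representation L R" and R': "fd_representation L R'"
    and inj: "inj_on (\<lambda>f. f \<circ> p) (rep_hom R R')"
  shows "vector_space.dim (fscale (scl R')) ((\<lambda>f. f \<circ> p) ` rep_hom R R') = hom_dim R R'"
    and "module.subspace (fscale (scl R')) ((\<lambda>f. f \<circ> p) ` rep_hom R R')"
    and "finitely_spanned (fscale (scl R')) ((\<lambda>f. f \<circ> p) ` rep_hom R R')"
proof -
  have vs: "vector_space (scl R')"
    using R' by (rule fd_representation.vector_space_scl)
  have lin: "linear_on (fscale (scl R')) (fscale (scl R')) (rep_hom R R') (\<lambda>f. f \<circ> p)"
    by (auto simp: linear_on_def fscale_def fun_eq_iff)
  note * = dim_image_linear_on[OF vector_space_fscale vector_space_fscale lin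
      rep_hom_subspace[OF R R'] inj finitely_spanned_rep_hom[OF R R'], OF vs vs]
  show "vector_space.dim (fscale (scl R')) ((\<lambda>f. f \<circ> p) ` rep_hom R R') = hom_dim R R'"
    and "module.subspace (fscale (scl R')) ((\<lambda>f. f \<circ> p) ` rep_hom R R')"
    and "finitely_spanned (fscale (scl R')) ((\<lambda>f. f \<circ> p) ` rep_hom R R')"
    using * by (simp_all add: hom_dim_def)
qed

text \<open>The isomorphism in \<open>rep_iso\<close> is arbitrary off \<open>space R\<close>;
  cutting it and its inverse off to 0 puts both into \<open>rep_hom\<close>. The inverse inherits
  linearity and equivariance by applying \<open>g (f v) = v\<close> to sums, multiples and
  translates of preimages.\<close>

lemma rep_isoE:
  assumes "fd_representation L R" "rep_iso R R'"
  obtains f g where "f \<in> rep_hom R R'" "g \<in> rep_hom R' R"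
    "\<And>v. v \<in> space R \<Longrightarrow> g (f v) = v" "\<And>v. v \<in> space R' \<Longrightarrow> f (g v) = v"
proof -
  obtain h where h: "bij_betw h (space R) (space R')" "linear_on (scl R) (scl R') (space R) h"
    "\<And>x v. v \<in> space R \<Longrightarrow> h (act R x v) = act R' x (h v)"
    using assms(2) unfolding rep_iso_def by blast
  define f where "f v = (if v \<in> space R then h v else 0)" for v
  define g where "g w = (if w \<in> space R' then inv_into (space R) h w else 0)" for w
  note closed = is_subrepD[OF assms(1) is_subrep_space[OF assms(1)]]
  have f: "f \<in> rep_hom R R'"
    using h closed unfolding rep_hom_def f_def linear_on_def bij_betw_def by auto
  have gf: "g (f v) = v" if "v \<in> space R" for v
    using h(1) that unfolding g_def f_def by (auto simp: bij_betw_def)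
  have fg: "f (g w) = w" and gR: "g w \<in> space R" if "w \<in> space R'" for w
    using h(1) that unfolding g_def f_def
    by (auto simp: bij_betw_def f_inv_into_f inv_into_into)
  have g: "g \<in> rep_hom R' R"
  proof -
    have "g (u + v) = g u + g v" if "u \<in> space R'" "v \<in> space R'" for u v
      using gf[OF closed(2)[OF gR gR], OF that] rep_homD(5)[OF f gR gR] fg that by simp
    moreover have "g (scl R' c u) = scl R c (g u)" if "u \<in> space R'" for u c
      using gf[OF closed(4)[OF gR]] rep_homD(6)[OF f gR] fg that by simp
    moreover have "g (act R' x u) = act R x (g u)" if "u \<in> space R'" for u x
      using gf[OF closed(6)[OF gR]] rep_homD(3)[OF f gR] fg that by simp
    ultimately show ?thesis
      using gR unfolding rep_hom_def linear_on_def by (auto simp: g_def)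
  qed
  show thesis by (rule that[OF f g gf fg])
qed

lemma rep_isoI:
  assumes "f \<in> rep_hom R R'" "g ` space R' \<subseteq> space R"
    "\<And>v. v \<in> space R \<Longrightarrow> g (f v) = v" "\<And>v. v \<in> space R' \<Longrightarrow> f (g v) = v"
  shows "rep_iso R R'"
  unfolding rep_iso_def
proof (intro exI conjI)
  show "bij_betw f (space R) (space R')"
    using assms rep_homD(2)[OF assms(1)] by (intro bij_betw_byWitness[of _ g]) auto
qed (use rep_homD[OF assms(1)] in auto)

lemma rep_iso_refl: "rep_iso R R"
  unfolding rep_iso_def linear_on_def by (rule exI[of _ id]) auto

lemma rep_iso_sym:
  assumes "fd_representation L R" "rep_iso R R'"
  shows "rep_iso R' R"
proof -
  obtain f g where "f \<in> rep_hom R R'" "g \<in> rep_hom R' R"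
    "\<And>v. v \<in> space R \<Longrightarrow> g (f v) = v" "\<And>v. v \<in> space R' \<Longrightarrow> f (g v) = v"
    using rep_isoE[OF assms] by blast
  then show ?thesis
    using rep_homD(2) by (intro rep_isoI[of g R' R f]) blast+
qed

lemma rep_iso_trans:
  assumes "rep_iso R1 R2" "rep_iso R2 R3"
  shows "rep_iso R1 R3"
proof -
  obtain f g where f: "bij_betw f (space R1) (space R2)" "linear_on (scl R1) (scl R2) (space R1) f"
    "\<And>x v. v \<in> space R1 \<Longrightarrow> f (act R1 x v) = act R2 x (f v)"
    and g: "bij_betw g (space R2) (space R3)" "linear_on (scl R2) (scl R3) (space R2) g"
    "\<And>x v. v \<in> space R2 \<Longrightarrow> g (act R2 x v) = act R3 x (g v)"
    using assms unfolding rep_iso_def by blast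
  have "f v \<in> space R2" if "v \<in> space R1" for v
    using f(1) that bij_betwE by blast
  then have "linear_on (scl R1) (scl R3) (space R1) (g \<circ> f)"
    "\<And>x v. v \<in> space R1 \<Longrightarrow> (g \<circ> f) (act R1 x v) = act R3 x ((g \<circ> f) v)"
    using f g unfolding linear_on_def by auto
  then show ?thesis
    unfolding rep_iso_def using bij_betw_trans[OF f(1) g(1)] by blast
qed

section \<open>Isomorphism invariance of Hom dimensions\<close>

lemma hom_dim_iso_left:
  assumes R: "fd_representation L R" and R2: "fd_representation L R2"
    and Q: "fd_representation L Q" and iso: "rep_iso R R2"
  shows "hom_dim R Q = hom_dim R2 Q"
proof -
  obtain f g where fg: "f \<in> rep_hom R R2" "g \<in> rep_hom R2 R"
    "\<And>v. v \<in> space R \<Longrightarrow> g (f v) = v" "\<And>v. v \<in> space R2 \<Longrightarrow> f (g v) = v"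
    using rep_isoE[OF R iso] by blast
  have eq1: "h \<circ> f \<circ> g = h" if "h \<in> rep_hom R2 Q" for h
  proof
    fix v
    show "(h \<circ> f \<circ> g) v = h v"
      by (cases "v \<in> space R2") (simp_all add: fg(4) rep_homD(4)[OF that] rep_homD(4)[OF fg(2)] rep_hom_zero[OF fg(1)] rep_hom_zero[OF that])
  qed
  have eq2: "h \<circ> g \<circ> f = h" if "h \<in> rep_hom R Q" for h
  proof
    fix v
    show "(h \<circ> g \<circ> f) v = h v"
      by (cases "v \<in> space R") (simp_all add: fg(3) rep_homD(4)[OF that] rep_homD(4)[OF fg(1)] rep_hom_zero[OF fg(2)] rep_hom_zero[OF that])
  qed
  have "(\<lambda>h. h \<circ> g) ` rep_hom R Q = rep_hom R2 Q"
  proof (intro equalityI subsetI)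
    fix h assume h: "h \<in> rep_hom R2 Q"
    show "h \<in> (\<lambda>h. h \<circ> g) ` rep_hom R Q"
      using eq1[OF h] rep_hom_comp[OF fg(1) h] by (intro image_eqI[of _ _ "h \<circ> f"]) simp_all
  qed (use rep_hom_comp[OF fg(2)] in blast)
  moreover have inj: "inj_on (\<lambda>h. h \<circ> g) (rep_hom R Q)"
    using eq2 by (intro inj_on_inverseI[of _ "\<lambda>h. h \<circ> f"]) simp
  ultimately show ?thesis
    using hom_dim_pullback(1)[OF R Q inj] by (simp add: hom_dim_def)
qed

lemma hom_dim_iso_right:
  assumes R: "fd_representation L R" and R2: "fd_representation L R2"
    and Q: "fd_representation L Q" and iso: "rep_iso R R2"
  shows "hom_dim Q R = hom_dim Q R2"
proof -
  obtain f g where fg: "f \<in> rep_hom R R2" "g \<in> rep_hom R2 R"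
    "\<And>v. v \<in> space R \<Longrightarrow> g (f v) = v" "\<And>v. v \<in> space R2 \<Longrightarrow> f (g v) = v"
    using rep_isoE[OF R iso] by blast
  have eq1: "f \<circ> (g \<circ> h) = h" if "h \<in> rep_hom Q R2" for h
  proof
    fix v
    show "(f \<circ> (g \<circ> h)) v = h v"
      by (cases "v \<in> space Q") (simp_all add: fg(4) rep_homD(2,4)[OF that] rep_hom_zero[OF fg(2)] rep_hom_zero[OF fg(1)])
  qed
  have eq2: "g \<circ> (f \<circ> h) = h" if "h \<in> rep_hom Q R" for h
  proof
    fix v
    show "(g \<circ> (f \<circ> h)) v = h v"
      by (cases "v \<in> space Q") (simp_all add: fg(3) rep_homD(2,4)[OF that] rep_hom_zero[OF fg(2)] rep_hom_zero[OF fg(1)])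
  qed
  have im: "(\<lambda>h. f \<circ> h) ` rep_hom Q R = rep_hom Q R2"
  proof (intro equalityI subsetI)
    fix h assume h: "h \<in> rep_hom Q R2"
    show "h \<in> (\<lambda>h. f \<circ> h) ` rep_hom Q R"
      using eq1[OF h] rep_hom_comp[OF h fg(2)] by (intro image_eqI[of _ _ "g \<circ> h"]) simp_all
  qed (use rep_hom_comp[OF _ fg(1)] in blast)
  have inj: "inj_on (\<lambda>h. f \<circ> h) (rep_hom Q R)"
    using eq2 by (intro inj_on_inverseI[of _ "\<lambda>h. g \<circ> h"]) simp
  have lin: "linear_on (fscale (scl R)) (fscale (scl R2)) (rep_hom Q R) (\<lambda>h. f \<circ> h)"
    unfolding linear_on_def
  proof (intro conjI ballI allI)
    fix h h' assume h: "h \<in> rep_hom Q R" "h' \<in> rep_hom Q R"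
    show "f \<circ> (h + h') = (f \<circ> h) + (f \<circ> h')"
    proof
      fix v
      show "(f \<circ> (h + h')) v = ((f \<circ> h) + (f \<circ> h')) v"
        using rep_homD(5)[OF fg(1)] rep_homD(2,4)[OF h(1)] rep_homD(2,4)[OF h(2)] rep_hom_zero[OF fg(1)]
        by (cases "v \<in> space Q") auto
    qed
  next
    fix c h assume h: "h \<in> rep_hom Q R"
    interpret vs: vector_space "scl R" using R by (rule fd_representation.vector_space_scl)
    interpret vs2: vector_space "scl R2" using R2 by (rule fd_representation.vector_space_scl)
    show "f \<circ> fscale (scl R) c h = fscale (scl R2) c (f \<circ> h)"
    proof
      fix v
      show "(f \<circ> fscale (scl R) c h) v = fscale (scl R2) c (f \<circ> h) v"
        using rep_homD(6)[OF fg(1)] rep_homD(2,4)[OF h] rep_hom_zero[OF fg(1)]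
        by (cases "v \<in> space Q") (auto simp: fscale_def)
    qed
  qed
  show ?thesis
    using dim_image_linear_on(1)[OF vector_space_fscale vector_space_fscale lin
        rep_hom_subspace[OF Q R] inj finitely_spanned_rep_hom[OF Q R],
        OF R[THEN fd_representation.vector_space_scl] R2[THEN fd_representation.vector_space_scl]]
    unfolding hom_dim_def im by simp
qed

section \<open>Internal direct sums and additivity of Hom dimensions\<close>

definition rep_direct_sum :: "('g, 'v::ab_group_add) rep \<Rightarrow> 'v set \<Rightarrow> 'v set \<Rightarrow> bool" where
  "rep_direct_sum R A B \<longleftrightarrow> is_subrep R A \<and> is_subrep R B \<and> A \<inter> B = {0} \<and>
     {a + b | a b. a \<in> A \<and> b \<in> B} = space R"

text \<open>The components of a vector are unique because \<open>A\<close> and \<open>B\<close> meet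
  only in 0. Each law for \<open>p\<close> and \<open>q\<close> follows by comparing two
  decompositions of the same vector.\<close>

lemma rep_direct_sumE:
  assumes R: "fd_representation L R" and sum: "rep_direct_sum R A B"
  obtains p q where "p \<in> rep_hom R (subrep R A)" "q \<in> rep_hom R (subrep R B)"
    "\<And>v. v \<in> space R \<Longrightarrow> v = p v + q v"
    "\<And>a. a \<in> A \<Longrightarrow> p a = a" "\<And>a. a \<in> A \<Longrightarrow> q a = 0"
    "\<And>b. b \<in> B \<Longrightarrow> p b = 0" "\<And>b. b \<in> B \<Longrightarrow> q b = b"
proof -
  interpret fd_representation L R by (rule R)
  interpret vs: vector_space "scl R" by (rule vector_space_scl)
  have A: "is_subrep R A" and B: "is_subrep R B" and AB: "A \<inter> B = {0}"
    and dec: "space R = {a + b | a b. a \<in> A \<and> b \<in> B}"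
    using sum unfolding rep_direct_sum_def by auto
  note Ac = is_subrepD[OF R A] and Bc = is_subrepD[OF R B]
  have uniq: "a = a' \<and> b = b'" if "a \<in> A" "a' \<in> A" "b \<in> B" "b' \<in> B" "a + b = a' + b'" for a a' b b'
  proof -
    have "a - a' = b' - b" using that(5) by (simp add: algebra_simps)
    then have "a - a' \<in> A \<inter> B" using Ac(3)[OF that(1,2)] Bc(3)[OF that(4,3)] by simp
    then show ?thesis using AB that(5) by auto
  qed
  have "\<forall>v. \<exists>a b. (v \<in> space R \<longrightarrow> a \<in> A \<and> b \<in> B \<and> v = a + b) \<and> (v \<notin> space R \<longrightarrow> a = 0 \<and> b = 0)"
    using dec by blast
  then obtain p q where pq: "\<And>v. v \<in> space R \<Longrightarrow> p v \<in> A" "\<And>v. v \<in> space R \<Longrightarrow> q v \<in> B"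
    "\<And>v. v \<in> space R \<Longrightarrow> v = p v + q v" "\<And>v. v \<notin> space R \<Longrightarrow> p v = 0"
    "\<And>v. v \<notin> space R \<Longrightarrow> q v = 0"
    by metis
  note Rc = is_subrepD[OF R is_subrep_space[OF R]]
  have act_add: "act R x (u + v) = act R x u + act R x v" if "u \<in> space R" "v \<in> space R" for x u v
    using act_linear that unfolding linear_on_def by auto
  have add: "p (u + v) = p u + p v \<and> q (u + v) = q u + q v" if "u \<in> space R" "v \<in> space R" for u v
  proof (rule uniq)
    show "p (u + v) + q (u + v) = p u + p v + (q u + q v)"
      using pq(3)[OF that(1)] pq(3)[OF that(2)] pq(3)[OF Rc(2)[OF that]] by (simp add: algebra_simps)
  qed (use pq Rc Ac Bc that in auto)
  have scale: "p (scl R c u) = scl R c (p u) \<and> q (scl R c u) = scl R c (q u)" if "u \<in> space R" for u c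
  proof (rule uniq)
    show "p (scl R c u) + q (scl R c u) = scl R c (p u) + scl R c (q u)"
      using pq(3)[OF that] pq(3)[OF Rc(4)[OF that]] by (metis vs.scale_right_distrib)
  qed (use pq Rc Ac Bc that in auto)
  have actpq: "p (act R x u) = act R x (p u) \<and> q (act R x u) = act R x (q u)" if "u \<in> space R" for u x
  proof (rule uniq)
    show "p (act R x u) + q (act R x u) = act R x (p u) + act R x (q u)"
      using pq(3)[OF that] pq(3)[OF Rc(6)[OF that]] act_add Ac(5) Bc(5) pq(1,2) that by metis
  qed (use pq Rc Ac Bc that in auto)
  show thesis
  proof (rule that)
    show "p \<in> rep_hom R (subrep R A)" "q \<in> rep_hom R (subrep R B)"
      using pq add scale actpq unfolding rep_hom_def linear_on_def by auto
    show "v = p v + q v" if "v \<in> space R" for v using pq(3)[OF that] .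
    show "p a = a" "q a = 0" if "a \<in> A" for a
      using uniq[of "p a" a "q a" 0] pq Ac(5) Bc(1) that by auto
    show "p b = 0" "q b = b" if "b \<in> B" for b
      using uniq[of "p b" 0 "q b" b] pq Bc(5) Ac(1) that by auto
  qed
qed

text \<open>A map into a summand is literally a map into \<open>R\<close>, so the two Hom spaces are
  complementary subspaces of \<open>rep_hom Q R\<close>.\<close>

lemma hom_dim_direct_sum_right:
  fixes R :: "('g::ab_group_add, 'v::ab_group_add) rep" and Q :: "('g, 'w::ab_group_add) rep"
  assumes R: "fd_representation L R" and Q: "fd_representation L Q" and sum: "rep_direct_sum R A B"
  shows "hom_dim Q R = hom_dim Q (subrep R A) + hom_dim Q (subrep R B)"
proof -
  have A: "is_subrep R A" and B: "is_subrep R B" and AB: "A \<inter> B = {0}"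
    using sum unfolding rep_direct_sum_def by auto
  obtain p q where pq: "p \<in> rep_hom R (subrep R A)" "q \<in> rep_hom R (subrep R B)"
    "\<And>v. v \<in> space R \<Longrightarrow> v = p v + q v"
    "\<And>a. a \<in> A \<Longrightarrow> p a = a" "\<And>a. a \<in> A \<Longrightarrow> q a = 0"
    "\<And>b. b \<in> B \<Longrightarrow> p b = 0" "\<And>b. b \<in> B \<Longrightarrow> q b = b"
    using rep_direct_sumE[OF R sum] by blast
  note fdA = fd_representation_subrep[OF R A] and fdB = fd_representation_subrep[OF R B]
  interpret vs: vector_space "fscale (scl R) :: complex \<Rightarrow> ('w \<Rightarrow> 'v) \<Rightarrow> 'w \<Rightarrow> 'v"
    using R by (intro vector_space_fscale) (rule fd_representation.vector_space_scl)
  have "rep_hom Q R = {a + b | a b. a \<in> rep_hom Q (subrep R A) \<and> b \<in> rep_hom Q (subrep R B)}"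
  proof (intro equalityI subsetI)
    fix f assume f: "f \<in> rep_hom Q R"
    have "f = (p \<circ> f) + (q \<circ> f)"
    proof
      fix v
      show "f v = ((p \<circ> f) + (q \<circ> f)) v"
        using pq(3) rep_homD(2,4)[OF f] rep_hom_zero[OF pq(1)] rep_hom_zero[OF pq(2)]
        by (cases "v \<in> space Q") auto
    qed
    then show "f \<in> {a + b | a b. a \<in> rep_hom Q (subrep R A) \<and> b \<in> rep_hom Q (subrep R B)}"
      using rep_hom_comp[OF f pq(1)] rep_hom_comp[OF f pq(2)] by blast
  next
    fix f assume "f \<in> {a + b | a b. a \<in> rep_hom Q (subrep R A) \<and> b \<in> rep_hom Q (subrep R B)}"
    then show "f \<in> rep_hom Q R"
      using rep_hom_target[OF A, of _ Q] rep_hom_target[OF B, of _ Q]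
        vs.subspace_add[OF rep_hom_subspace[OF Q R]] by blast
  qed
  moreover have "rep_hom Q (subrep R A) \<inter> rep_hom Q (subrep R B) = {0}"
  proof -
    have "0 \<in> rep_hom Q (subrep R A) \<inter> rep_hom Q (subrep R B)"
      using vs.subspace_0 rep_hom_subspace[OF Q fdA] rep_hom_subspace[OF Q fdB] by simp
    moreover have "f = 0" if f: "f \<in> rep_hom Q (subrep R A)" "f \<in> rep_hom Q (subrep R B)" for f
    proof
      fix v
      show "f v = 0 v"
        using rep_homD(2,4)[OF f(1), of v] rep_homD(2)[OF f(2), of v] AB by auto
    qed
    ultimately show ?thesis by blast
  qed
  ultimately show ?thesis
    using vs.dim_direct_sum[OF rep_hom_subspace[OF Q fdA, simplified]
        finitely_spanned_rep_hom[OF Q fdA, simplified]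
        rep_hom_subspace[OF Q fdB, simplified] finitely_spanned_rep_hom[OF Q fdB, simplified]]
    by (simp add: hom_dim_def)
qed

text \<open>A map out of a summand vanishes off that summand and is in general not a member of
  \<open>rep_hom R Q\<close>. Precomposition with the projections embeds the two Hom spaces into
  \<open>rep_hom R Q\<close> as \<open>?F\<close> and \<open>?G\<close>, which are complementary
  there.\<close>

lemma hom_dim_direct_sum_left:
  fixes R :: "('g::ab_group_add, 'v::ab_group_add) rep" and Q :: "('g, 'w::ab_group_add) rep"
  assumes R: "fd_representation L R" and Q: "fd_representation L Q" and sum: "rep_direct_sum R A B"
  shows "hom_dim R Q = hom_dim (subrep R A) Q + hom_dim (subrep R B) Q"
proof -
  have A: "is_subrep R A" and B: "is_subrep R B" and AB: "A \<inter> B = {0}"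
    using sum unfolding rep_direct_sum_def by auto
  obtain p q where pq: "p \<in> rep_hom R (subrep R A)" "q \<in> rep_hom R (subrep R B)"
    "\<And>v. v \<in> space R \<Longrightarrow> v = p v + q v"
    "\<And>a. a \<in> A \<Longrightarrow> p a = a" "\<And>a. a \<in> A \<Longrightarrow> q a = 0"
    "\<And>b. b \<in> B \<Longrightarrow> p b = 0" "\<And>b. b \<in> B \<Longrightarrow> q b = b"
    using rep_direct_sumE[OF R sum] by blast
  note fdA = fd_representation_subrep[OF R A] and fdB = fd_representation_subrep[OF R B]
  interpret vs: vector_space "fscale (scl Q) :: complex \<Rightarrow> ('v \<Rightarrow> 'w) \<Rightarrow> 'v \<Rightarrow> 'w"
    using Q by (intro vector_space_fscale) (rule fd_representation.vector_space_scl)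
  let ?F = "(\<lambda>f. f \<circ> p) ` rep_hom (subrep R A) Q" and ?G = "(\<lambda>f. f \<circ> q) ` rep_hom (subrep R B) Q"
  have inj: "inj_on (\<lambda>f. f \<circ> p) (rep_hom (subrep R A) Q)"
  proof (rule inj_onI, rule ext)
    fix f g v assume fg: "f \<in> rep_hom (subrep R A) Q" "g \<in> rep_hom (subrep R A) Q" "f \<circ> p = g \<circ> p"
    show "f v = g v"
      using pq(4) fun_cong[OF fg(3), of v] rep_homD(4)[OF fg(1), of v] rep_homD(4)[OF fg(2), of v]
      by (cases "v \<in> A") auto
  qed
  have inj': "inj_on (\<lambda>f. f \<circ> q) (rep_hom (subrep R B) Q)"
  proof (rule inj_onI, rule ext)
    fix f g v assume fg: "f \<in> rep_hom (subrep R B) Q" "g \<in> rep_hom (subrep R B) Q" "f \<circ> q = g \<circ> q"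
    show "f v = g v"
      using pq(7) fun_cong[OF fg(3), of v] rep_homD(4)[OF fg(1), of v] rep_homD(4)[OF fg(2), of v]
      by (cases "v \<in> B") auto
  qed
  note F = hom_dim_pullback[OF fdA Q inj] and G = hom_dim_pullback[OF fdB Q inj']
  have "rep_hom R Q = {a + b | a b. a \<in> ?F \<and> b \<in> ?G}"
  proof (intro equalityI subsetI)
    fix f assume f: "f \<in> rep_hom R Q"
    let ?f = "\<lambda>v. if v \<in> A then f v else 0" and ?g = "\<lambda>v. if v \<in> B then f v else 0"
    have "f = (?f \<circ> p) + (?g \<circ> q)"
    proof
      fix v
      show "f v = ((?f \<circ> p) + (?g \<circ> q)) v"
      proof (cases "v \<in> space R")
        case True
        then have "p v \<in> A" "q v \<in> B" using rep_homD(2)[OF pq(1)] rep_homD(2)[OF pq(2)] by auto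
        moreover from this have "f (p v + q v) = f (p v) + f (q v)"
          using rep_homD(5)[OF f] is_subrepD(5)[OF R A] is_subrepD(5)[OF R B] by blast
        ultimately show ?thesis
          using pq(3)[OF True] by simp
      next
        case False
        then show ?thesis
          using rep_homD(4)[OF f] rep_homD(4)[OF pq(1)] rep_homD(4)[OF pq(2)] rep_hom_zero[OF f]
          by auto
      qed
    qed
    then show "f \<in> {a + b | a b. a \<in> ?F \<and> b \<in> ?G}"
      using rep_hom_source[OF R A f] rep_hom_source[OF R B f] by blast
  next
    fix f assume "f \<in> {a + b | a b. a \<in> ?F \<and> b \<in> ?G}"
    then show "f \<in> rep_hom R Q"
      using rep_hom_comp[OF pq(1)] rep_hom_comp[OF pq(2)]
        vs.subspace_add[OF rep_hom_subspace[OF R Q]] by blast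
  qed
  moreover have "?F \<inter> ?G = {0}"
  proof -
    have "0 \<in> ?F \<inter> ?G"
      using vs.subspace_0 F(2) G(2) by simp
    moreover have "h = 0" if h: "h \<in> ?F" "h \<in> ?G" for h
    proof
      fix v
      obtain f g where fg: "f \<in> rep_hom (subrep R A) Q" "h = f \<circ> p" "g \<in> rep_hom (subrep R B) Q" "h = g \<circ> q"
        using h by blast
      have "f a = 0" if "a \<in> A" for a
        using pq(4,5)[OF that] fg rep_hom_zero[OF fg(3)] by (metis comp_apply)
      then show "h v = 0 v"
        using fg(2) rep_homD(4)[OF fg(1)] by auto
    qed
    ultimately show ?thesis by blast
  qed
  ultimately show ?thesis
    using vs.dim_direct_sum[OF F(2,3) G(2,3)] F(1) G(1) by (simp add: hom_dim_def)
qed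

section \<open>External direct sums\<close>

lemma fd_representation_rep_sum:
  assumes R: "fd_representation L R" and R': "fd_representation L R'"
  shows "fd_representation L (rep_sum R R')"
proof -
  interpret R: fd_representation L R by (rule R)
  interpret R': fd_representation L R' by (rule R')
  interpret vs: vector_space "scl R" by (rule R.vector_space_scl)
  interpret vs': vector_space "scl R'" by (rule R'.vector_space_scl)
  have vsum: "vector_space (scl (rep_sum R R'))"
    by unfold_locales (auto simp: rep_sum_def vs.scale_right_distrib vs.scale_left_distrib
        vs'.scale_right_distrib vs'.scale_left_distrib)
  interpret s: vector_space "scl (rep_sum R R')" by (rule vsum)
  have sub: "s.subspace (space (rep_sum R R'))"
    by (rule s.subspaceI)
      (auto simp: rep_sum_def zero_prod_def R.zero_in_space R'.zero_in_space
        is_subrepD[OF R is_subrep_space[OF R]] is_subrepD[OF R' is_subrep_space[OF R']])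
  obtain B where B: "finite B" "B \<subseteq> space R" "vs.span B = space R" using R.finite_dim_space by blast
  obtain C where C: "finite C" "C \<subseteq> space R'" "vs'.span C = space R'" using R'.finite_dim_space by blast
  let ?D = "(\<lambda>v. (v, 0)) ` B \<union> (\<lambda>v. (0, v)) ` C"
  have lin1: "module_hom (scl R) (scl (rep_sum R R')) (\<lambda>v. (v, 0))"
    and lin2: "module_hom (scl R') (scl (rep_sum R R')) (\<lambda>v. (0, v))"
    by (unfold_locales, auto simp: rep_sum_def)+
  have "s.span ?D = space (rep_sum R R')"
  proof (rule s.span_subspace[OF _ _ sub])
    show "?D \<subseteq> space (rep_sum R R')"
      using B(2) C(2) R.zero_in_space R'.zero_in_space by (auto simp: rep_sum_def)
    show "space (rep_sum R R') \<subseteq> s.span ?D"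
    proof
      fix x assume "x \<in> space (rep_sum R R')"
      then obtain u w where x: "x = (u, 0) + (0, w)" "u \<in> space R" "w \<in> space R'"
        by (auto simp: rep_sum_def)
      have "(u, 0) \<in> s.span ((\<lambda>v. (v, 0)) ` B)"
        using module_hom.span_image[OF lin1, of B] x(2) B(3) by blast
      moreover have "(0, w) \<in> s.span ((\<lambda>v. (0, v)) ` C)"
        using module_hom.span_image[OF lin2, of C] x(3) C(3) by blast
      ultimately show "x \<in> s.span ?D"
        unfolding x(1) s.span_Un by blast
    qed
  qed
  moreover have "finite ?D" using B C by blast
  ultimately have "\<exists>B. finite B \<and> B \<subseteq> space (rep_sum R R') \<and> s.span B = space (rep_sum R R')"
    using s.span_superset by metis
  then show ?thesis
    using vsum sub R.act_closed R'.act_closed R.act_linear R'.act_linear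
      R.act_linear_alg R'.act_linear_alg R.act_bracket R'.act_bracket
    by (intro fd_representation.intro fd_representation_axioms.intro R.lie_algebra_axioms)
      (auto simp: rep_sum_def linear_on_def)
qed

lemma rep_sum_summands:
  assumes R: "fd_representation L R" and R': "fd_representation L R'"
  shows "rep_direct_sum (rep_sum R R') (space R \<times> {0}) ({0} \<times> space R')"
    and "rep_iso R (subrep (rep_sum R R') (space R \<times> {0}))"
    and "rep_iso R' (subrep (rep_sum R R') ({0} \<times> space R'))"
proof -
  interpret R: fd_representation L R by (rule R)
  interpret R': fd_representation L R' by (rule R')
  interpret vs: vector_space "scl R" by (rule R.vector_space_scl)
  interpret vs': vector_space "scl R'" by (rule R'.vector_space_scl)
  interpret s: vector_space "scl (rep_sum R R')"
    using fd_representation_rep_sum[OF R R'] by (rule fd_representation.vector_space_scl)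
  have act0: "act R x 0 = 0" "act R' x 0 = 0" for x
    using linear_on_zero[OF R.act_linear R.zero_in_space]
      linear_on_zero[OF R'.act_linear R'.zero_in_space] by auto
  note closed = is_subrepD[OF R is_subrep_space[OF R]] is_subrepD[OF R' is_subrep_space[OF R']]
  have "is_subrep (rep_sum R R') (space R \<times> {0})" "is_subrep (rep_sum R R') ({0} \<times> space R')"
    unfolding is_subrep_def
    by (intro conjI s.subspaceI; auto simp: rep_sum_def zero_prod_def closed act0)+
  moreover have "{a + b | a b. a \<in> space R \<times> {0} \<and> b \<in> {0} \<times> space R'} = space (rep_sum R R')"
    by (auto simp: rep_sum_def)
  moreover have "(space R \<times> {0}) \<inter> ({0} \<times> space R') = {0}"
    using R.zero_in_space R'.zero_in_space by (auto simp: zero_prod_def)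
  ultimately show "rep_direct_sum (rep_sum R R') (space R \<times> {0}) ({0} \<times> space R')"
    unfolding rep_direct_sum_def by blast
  show "rep_iso R (subrep (rep_sum R R') (space R \<times> {0}))"
    unfolding rep_iso_def
    by (intro exI[of _ "\<lambda>v. (v, 0)"])
      (auto simp: rep_sum_def linear_on_def act0 bij_betw_def inj_on_def)
  show "rep_iso R' (subrep (rep_sum R R') ({0} \<times> space R'))"
    unfolding rep_iso_def
    by (intro exI[of _ "\<lambda>v. (0, v)"])
      (auto simp: rep_sum_def linear_on_def act0 bij_betw_def inj_on_def)
qed

text \<open>The two equations say that \<open>hom_dim _ Q\<close> and \<open>hom_dim Q _\<close>
  respect the relations in \<open>sum_relations\<close>, so that both descend to the representation
  ring.\<close>

lemma hom_dim_rep_sum: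
  assumes A: "fd_representation L A" and B: "fd_representation L B" and C: "fd_representation L C"
    and Q: "fd_representation L Q" and iso: "rep_iso A (rep_sum B C)"
  shows "hom_dim A Q = hom_dim B Q + hom_dim C Q" and "hom_dim Q A = hom_dim Q B + hom_dim Q C"
proof -
  let ?S = "rep_sum B C"
  note S = fd_representation_rep_sum[OF B C] and sum = rep_sum_summands[OF B C]
  have sub: "is_subrep ?S (space B \<times> {0})" "is_subrep ?S ({0} \<times> space C)"
    using sum(1) unfolding rep_direct_sum_def by auto
  note fB = fd_representation_subrep[OF S sub(1)] and fC = fd_representation_subrep[OF S sub(2)]
  show "hom_dim A Q = hom_dim B Q + hom_dim C Q"
    using hom_dim_iso_left[OF A S Q iso] hom_dim_direct_sum_left[OF S Q sum(1)]
      hom_dim_iso_left[OF B fB Q sum(2)] hom_dim_iso_left[OF C fC Q sum(3)] by simp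
  show "hom_dim Q A = hom_dim Q B + hom_dim Q C"
    using hom_dim_iso_right[OF A S Q iso] hom_dim_direct_sum_right[OF S Q sum(1)]
      hom_dim_iso_right[OF B fB Q sum(2)] hom_dim_iso_right[OF C fC Q sum(3)] by simp
qed

section \<open>Schur's lemma\<close>

text \<open>The vector p(f) v. The recursion applies \<open>f\<close> to the argument instead of the
  result, so additivity and homogeneity in \<open>p\<close> hold for any function \<open>f\<close>;
  linearity of \<open>f\<close> on \<open>U\<close> enters only in \<open>P_diff\<close>.\<close>

definition poly_op ::
  "(complex \<Rightarrow> 'v \<Rightarrow> 'v) \<Rightarrow> ('v \<Rightarrow> 'v) \<Rightarrow> complex poly \<Rightarrow> 'v::ab_group_add \<Rightarrow> 'v" where
  "poly_op s f p = fold_coeffs (\<lambda>a g v. s a v + g (f v)) p (\<lambda>v. 0)"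

text \<open>Some nonzero polynomial in \<open>f\<close> kills a given nonzero vector of
  \<open>U\<close>. Over the complex numbers it has a root \<open>c\<close>: either the vector is an
  eigenvector for \<open>c\<close>, or its image under f - c is a nonzero vector killed by the
  cofactor, whose degree is smaller.\<close>

lemma eigenvector_exists:
  assumes vs: "vector_space s" and U: "module.subspace s U" "finitely_spanned s U" "U \<noteq> {0}"
    and f: "linear_on s s U f" "f ` U \<subseteq> U"
  obtains c u where "u \<in> U" "u \<noteq> 0" "f u = s c u"
proof -
  interpret vector_space s by (rule vs)
  have fU: "f v \<in> U" if "v \<in> U" for v using f(2) that by blast
  have f_add: "f (u + v) = f u + f v" and f_scale: "f (s c u) = s c (f u)" if "u \<in> U" "v \<in> U" for u v c
    using f(1) that unfolding linear_on_def by auto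
  note U_closed = subspace_add[OF U(1)] subspace_scale[OF U(1)] subspace_0[OF U(1)]
  have P0: "poly_op s f 0 v = 0" for v
    by (simp add: poly_op_def)
  have PC: "poly_op s f (pCons a p) v = s a v + poly_op s f p (f v)" for a p v
    unfolding poly_op_def by (cases "p = 0 \<and> a = 0") auto
  have P_add: "poly_op s f (p + q) v = poly_op s f p v + poly_op s f q v" for p q v
    by (induction p q arbitrary: v rule: poly_induct2) (simp_all add: P0 PC scale_left_distrib)
  have P_smult: "poly_op s f (Polynomial.smult c p) v = s c (poly_op s f p v)" for c p v
    by (induction p arbitrary: v) (simp_all add: P0 PC scale_right_distrib)
  have P_diff: "poly_op s f p (f v + s c v) = poly_op s f p (f v) + s c (poly_op s f p v)"
    if "v \<in> U" for p c v
    using that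
    by (induction p arbitrary: v)
      (simp_all add: P0 PC scale_right_distrib f_add f_scale fU U_closed scale_left_commute algebra_simps)
  have P_lin: "poly_op s f ([:c, 1:] * q) v = poly_op s f q (f v + s c v)" if "v \<in> U" for c q v
    by (simp add: P_add P_smult PC P_diff[OF that])
  have P_monom: "poly_op s f (monom c i) v = s c ((f ^^ i) v)" for c i v
    by (induction i arbitrary: v) (simp_all add: monom_0 monom_Suc PC P0 funpow_swap1)
  have P_sum: "poly_op s f (sum g I) v = (\<Sum>i\<in>I. poly_op s f (g i) v)"
    for g :: "nat \<Rightarrow> complex poly" and I v
    by (induction I rule: infinite_finite_induct) (simp_all add: P0 P_add)
  have eigen: "\<exists>c u. u \<in> U \<and> u \<noteq> 0 \<and> f u = s c u"
    if "p \<noteq> 0" "v \<in> U" "v \<noteq> 0" "poly_op s f p v = 0" for p v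
    using that
  proof (induction "degree p" arbitrary: p v rule: less_induct)
    case less
    show ?case
    proof (cases "degree p = 0")
      case True
      then obtain a where "p = [:a:]" "a \<noteq> 0"
        using less.prems(1) degree_eq_zeroE by (metis pCons_0_0)
      then show ?thesis using less.prems by (simp add: PC P0)
    next
      case False
      then obtain c where "poly p c = 0"
        using fundamental_theorem_of_algebra[of p] by (auto simp: constant_degree)
      then obtain q where q: "p = [:- c, 1:] * q"
        unfolding poly_eq_0_iff_dvd by blast
      then have "q \<noteq> 0" using less.prems(1) by auto
      then have deg: "degree q < degree p"
        unfolding q by (subst degree_mult_eq) auto
      show ?thesis
      proof (cases "f v + s (- c) v = 0")
        case True
        then have "f v = s c v" by (simp add: scale_minus_left)
        then show ?thesis using less.prems by blast
      next
        case False
        moreover have "f v + s (- c) v \<in> U"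
          using fU U_closed less.prems(2) by blast
        moreover have "poly_op s f q (f v + s (- c) v) = 0"
          using P_lin[OF less.prems(2), of "- c" q] less.prems(4) unfolding q by (simp only:)
        ultimately show ?thesis
          using less.hyps[OF deg \<open>q \<noteq> 0\<close>] by blast
      qed
    qed
  qed
  obtain v where v: "v \<in> U" "v \<noteq> 0"
    using U(3) U_closed(3) by blast
  have "(f ^^ i) v \<in> U" for i
    by (induction i) (simp_all add: v fU)
  \<comment> \<open>The indices \<open>{..dim U}\<close> number one more than the dimension, which
    forces a linear relation among the iterates.\<close>
  then have "(\<lambda>i. (f ^^ i) v) ` {..dim U} \<subseteq> U" by blast
  from family_relation[OF _ this U(2)]
  obtain c where c: "\<exists>i\<in>{..dim U}. c i \<noteq> 0" "(\<Sum>i\<le>dim U. s (c i) ((f ^^ i) v)) = 0"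
    by auto
  define p where "p = (\<Sum>i\<le>dim U. monom (c i) i)"
  have "coeff p k = c k" if "k \<le> dim U" for k
    using that by (simp add: p_def coeff_sum)
  then have "p \<noteq> 0"
    using c(1) by auto
  moreover have "poly_op s f p v = 0"
    unfolding p_def P_sum P_monom by (rule c(2))
  ultimately show thesis
    using eigen v that by blast
qed

lemma is_subrep_kernel:
  assumes R: "fd_representation L R" and R': "fd_representation L R'" and f: "f \<in> rep_hom R R'"
  shows "is_subrep R {v \<in> space R. f v = 0}"
proof -
  interpret R: fd_representation L R by (rule R)
  interpret R': fd_representation L R' by (rule R')
  interpret vs: vector_space "scl R" by (rule R.vector_space_scl)
  interpret vs': vector_space "scl R'" by (rule R'.vector_space_scl)
  have "act R' x 0 = 0" for x
    using linear_on_zero[OF R'.act_linear R'.zero_in_space] .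
  then show ?thesis
    unfolding is_subrep_def
    using rep_homD[OF f] rep_hom_zero[OF f] is_subrepD[OF R is_subrep_space[OF R]]
    by (auto intro!: vs.subspaceI)
qed

lemma is_subrep_image:
  assumes R: "fd_representation L R" and R': "fd_representation L R'" and f: "f \<in> rep_hom R R'"
  shows "is_subrep R' (f ` space R)"
proof -
  interpret R: fd_representation L R by (rule R)
  interpret R': fd_representation L R' by (rule R')
  interpret vs': vector_space "scl R'" by (rule R'.vector_space_scl)
  note closed = is_subrepD[OF R is_subrep_space[OF R]]
  have "vs'.subspace (f ` space R)"
  proof (rule vs'.subspaceI)
    show "0 \<in> f ` space R"
      using rep_hom_zero[OF f] closed(1) by (metis imageI)
    show "x + y \<in> f ` space R" if "x \<in> f ` space R" "y \<in> f ` space R" for x y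
      using that rep_homD(5)[OF f] closed(2) by (auto simp: image_iff) metis
    show "scl R' c x \<in> f ` space R" if "x \<in> f ` space R" for c x
      using that rep_homD(6)[OF f] closed(4) by (auto simp: image_iff) metis
  qed
  moreover have "act R' x v \<in> f ` space R" if "v \<in> f ` space R" for x v
    using that rep_homD(3)[OF f] closed(6) by (auto simp: image_iff) metis
  ultimately show ?thesis
    unfolding is_subrep_def using rep_homD(2)[OF f] by blast
qed

lemma rep_hom_inj_on:
  assumes R: "fd_representation L R" and f: "f \<in> rep_hom R R'"
    and ker: "\<And>v. v \<in> space R \<Longrightarrow> f v = 0 \<Longrightarrow> v = 0"
  shows "inj_on f (space R)"
proof (rule inj_onI)
  fix u v assume uv: "u \<in> space R" "v \<in> space R" "f u = f v"
  note closed = is_subrepD[OF R is_subrep_space[OF R]]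
  have "f u = f (u - v) + f v"
    using rep_homD(5)[OF f closed(3)[OF uv(1,2)] uv(2)] by simp
  then have "f (u - v) = 0" using uv(3) by simp
  then show "u = v" using ker[OF closed(3)[OF uv(1,2)]] by simp
qed

lemma hom_dim_irreducible_not_iso:
  assumes R: "irreducible_rep L R" and R': "irreducible_rep L R'" and "\<not> rep_iso R R'"
  shows "hom_dim R R' = 0"
proof -
  have fd: "fd_representation L R" "fd_representation L R'"
    using R R' unfolding irreducible_rep_def by auto
  interpret fs: vector_space "fscale (scl R')"
    by (rule vector_space_fscale) (rule fd_representation.vector_space_scl[OF fd(2)])
  have "f = 0" if f: "f \<in> rep_hom R R'" for f
  proof (rule ccontr)
    assume "f \<noteq> 0"
    then obtain v where v: "f v \<noteq> 0" by (auto simp: fun_eq_iff)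
    then have vR: "v \<in> space R" using rep_homD(4)[OF f] by blast
    have "{v \<in> space R. f v = 0} = {0}"
      using is_subrep_kernel[OF fd f] R v vR unfolding irreducible_rep_def by blast
    then have inj: "inj_on f (space R)"
      using rep_hom_inj_on[OF fd(1) f] by blast
    moreover have "f ` space R = space R'"
      using is_subrep_image[OF fd f] R' v vR unfolding irreducible_rep_def by blast
    ultimately have "rep_iso R R'"
      unfolding rep_iso_def bij_betw_def using rep_homD(1,3)[OF f] by blast
    then show False using assms(3) by simp
  qed
  then have "rep_hom R R' \<subseteq> fs.span {}" by auto
  from fs.dim_le_card[OF this] show ?thesis
    by (simp add: hom_dim_def)
qed

text \<open>Subtracting an eigenvalue from an endomorphism leaves one with a nonzero kernel. The
  kernel is a subrepresentation, hence everything, and the endomorphism is scalar.\<close>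

lemma hom_dim_irreducible_self:
  assumes R: "irreducible_rep L R"
  shows "hom_dim R R = 1"
proof -
  have fd: "fd_representation L R" and ne: "space R \<noteq> {0}"
    using R unfolding irreducible_rep_def by auto
  interpret fd_representation L R by (rule fd)
  interpret vs: vector_space "scl R" by (rule vector_space_scl)
  interpret fs: vector_space "fscale (scl R)"
    by (rule vector_space_fscale) (rule vector_space_scl)
  \<comment> \<open>The identity as a member of \<open>rep_hom R R\<close>, which demands the value
    0 off \<open>space R\<close>.\<close>
  define e where "e v = (if v \<in> space R then v else 0)" for v
  note closed = is_subrepD[OF fd is_subrep_space[OF fd]]
  have e: "e \<in> rep_hom R R"
    using closed unfolding rep_hom_def linear_on_def e_def by auto
  have "f \<in> fs.span {e}" if f: "f \<in> rep_hom R R" for f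
  proof -
    have "f ` space R \<subseteq> space R" using rep_homD(2)[OF f] by blast
    then obtain c u where cu: "u \<in> space R" "u \<noteq> 0" "f u = scl R c u"
      using eigenvector_exists[OF vector_space_scl subspace_space finitely_spanned_space ne
          rep_homD(1)[OF f]] by blast
    define g where "g = f - fscale (scl R) c e"
    have g: "g \<in> rep_hom R R"
      unfolding g_def
      by (intro fs.subspace_diff[OF rep_hom_subspace[OF fd fd]]
          fs.subspace_scale[OF rep_hom_subspace[OF fd fd]] f e)
    have "g u = 0" using cu by (simp add: g_def fscale_def e_def)
    then have "{v \<in> space R. g v = 0} = space R"
      using is_subrep_kernel[OF fd fd g] R cu unfolding irreducible_rep_def by blast
    then have "g v = 0" for v using rep_homD(4)[OF g] by blast
    then have "g = 0" by (simp add: fun_eq_iff)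
    then have "f = fscale (scl R) c e" by (simp add: g_def)
    then show ?thesis by (simp add: fs.span_base fs.span_scale)
  qed
  moreover have "e \<noteq> 0"
  proof
    assume "e = 0"
    then have "e v = 0" for v by simp
    then have "v = 0" if "v \<in> space R" for v
      using that unfolding e_def by metis
    then show False using ne closed(1) by blast
  qed
  then have "fs.independent {e}" by simp
  ultimately have "card {e} = fs.dim (rep_hom R R)"
    using e by (intro fs.basis_card_eq_dim) auto
  then show ?thesis by (simp add: hom_dim_def)
qed


section \<open>Additive functions on the representation ring\<close>

text \<open>The action is conjugated by \<open>\<phi>\<close>, with \<open>inv_into\<close> as
  inverse on the image. This moves a representation over an arbitrary type into the fixed type on
  which the representation ring is built.\<close>

lemma transport_representation:
  assumes R: "fd_representation L R" and vs: "vector_space s"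
    and lin: "linear_on (scl R) s (space R) \<phi>" and inj: "inj_on \<phi> (space R)"
  defines "A \<equiv> \<lparr>space = \<phi> ` space R, scl = s,
    act = (\<lambda>x u. \<phi> (act R x (inv_into (space R) \<phi> u)))\<rparr>"
  shows "fd_representation L A" and "rep_iso R A"
proof -
  interpret R: fd_representation L R by (rule R)
  interpret vs: vector_space s by (rule vs)
  note closed = is_subrepD[OF R is_subrep_space[OF R]]
  have inv [simp]: "inv_into (space R) \<phi> (\<phi> v) = v" if "v \<in> space R" for v
    using inv_into_f_f[OF inj that] .
  have \<phi>_add: "\<phi> u + \<phi> v = \<phi> (u + v)" if "u \<in> space R" "v \<in> space R" for u v
    using lin that unfolding linear_on_def by auto
  have \<phi>_scale: "s c (\<phi> u) = \<phi> (scl R c u)" if "u \<in> space R" for u c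
    using lin that unfolding linear_on_def by auto
  have \<phi>_diff: "\<phi> u - \<phi> v = \<phi> (u - v)" if "u \<in> space R" "v \<in> space R" for u v
    using \<phi>_add[OF closed(3)[OF that] that(2)] by (simp add: algebra_simps)
  have act_add: "act R x (u + v) = act R x u + act R x v"
    if "u \<in> space R" "v \<in> space R" for x u v
    using R.act_linear that unfolding linear_on_def by auto
  have act_scale: "act R x (scl R c u) = scl R c (act R x u)" if "u \<in> space R" for x u c
    using R.act_linear that unfolding linear_on_def by auto
  have alg_lin: "act R (x + y) u = act R x u + act R y u" "act R (lscale L c x) u = scl R c (act R x u)"
    if "u \<in> space R" for x y u c
    using R.act_linear_alg that unfolding linear_on_def by auto
  note image = dim_image_linear_on(2,3)[OF R.vector_space_scl vs lin R.subspace_space inj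
      R.finitely_spanned_space]
  obtain B where B: "B \<subseteq> \<phi> ` space R" "finite B" "\<phi> ` space R \<subseteq> vs.span B"
    using vs.finitely_spanned_basis[OF image(2)] by metis
  have "\<exists>B. finite B \<and> B \<subseteq> \<phi> ` space R \<and> vs.span B = \<phi> ` space R"
    using B vs.span_subspace[OF B(1,3) image(1)] by blast
  then show "fd_representation L A"
  proof (intro fd_representation.intro fd_representation_axioms.intro R.lie_algebra_axioms)
    show "linear_on (scl A) (scl A) (space A) (act A x)" for x
      unfolding linear_on_def A_def
      by (simp add: \<phi>_add \<phi>_scale closed act_add act_scale)
    show "linear_on (lscale L) (scl A) UNIV (\<lambda>x. act A x v)" if "v \<in> space A" for v
      using that unfolding linear_on_def A_def
      by (auto simp: \<phi>_add \<phi>_scale closed alg_lin)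
    show "act A (lbracket L x y) v = act A x (act A y v) - act A y (act A x v)"
      if "v \<in> space A" for x y v
    proof -
      obtain w where w: "v = \<phi> w" "w \<in> space R" using \<open>v \<in> space A\<close> unfolding A_def by auto
      show ?thesis
        using \<phi>_diff[of "act R x (act R y w)" "act R y (act R x w)"]
        by (simp add: A_def w closed(6) R.act_bracket)
    qed
    show "act A x v \<in> space A" if "v \<in> space A" for x v
      using that unfolding A_def by (auto simp: closed)
  qed (use image(1) vs in \<open>simp_all add: A_def\<close>)
  show "rep_iso R A"
    unfolding rep_iso_def A_def using lin inj
    by (intro exI[of _ \<phi>]) (auto simp: bij_betw_def)
qed

text \<open>Coordinates in a finite basis, padded with zeros, embed \<open>space R\<close> into
  \<open>nat \<Rightarrow> complex\<close>. Hence the choice made by \<open>SOME\<close> in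
  \<open>cl\<close> has a witness.\<close>

lemma model_rep_exists:
  assumes R: "fd_representation L R"
  shows "\<exists>A. A \<in> model_reps L \<and> rep_iso R A"
proof -
  interpret fd_representation L R by (rule R)
  interpret vs: vector_space "scl R" by (rule vector_space_scl)
  obtain B where B: "B \<subseteq> space R" "vs.independent B" "finite B" "space R \<subseteq> vs.span B"
    using vs.finitely_spanned_basis[OF finitely_spanned_space] by metis
  obtain h where h: "bij_betw h {0..<card B} B"
    using ex_bij_betw_nat_finite[OF B(3)] by blast
  define \<phi> where "\<phi> v = (\<lambda>i. if i < card B then vs.representation B v (h i) else 0)" for v
  have "linear_on (scl R) fun_scale (space R) \<phi>"
    using B(2,4) unfolding linear_on_def \<phi>_def fun_scale_def
    by (auto simp: fun_eq_iff vs.representation_add vs.representation_scale subset_iff)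
  moreover have "inj_on \<phi> (space R)"
  proof (rule inj_onI)
    fix u v assume uv: "u \<in> space R" "v \<in> space R" "\<phi> u = \<phi> v"
    have "vs.representation B u b = vs.representation B v b" if "b \<in> B" for b
    proof -
      obtain i where "i < card B" "b = h i"
        using h \<open>b \<in> B\<close> unfolding bij_betw_def by (metis atLeastLessThan_iff imageE)
      then show ?thesis using fun_cong[OF uv(3), of i] by (simp add: \<phi>_def)
    qed
    then have "(\<Sum>b\<in>B. scl R (vs.representation B u b) b) = (\<Sum>b\<in>B. scl R (vs.representation B v b) b)"
      by simp
    moreover have "(\<Sum>b\<in>B. scl R (vs.representation B w b) b) = w" if "w \<in> space R" for w
      using vs.sum_representation_eq[OF B(2) _ B(3) order_refl] B(4) that by blast
    ultimately show "u = v" using uv(1,2) by simp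
  qed
  ultimately show ?thesis
    using transport_representation[OF R vector_space_fun_scale]
    unfolding model_reps_def by fastforce
qed

definition model_of ::
  "'g::ab_group_add lie_alg \<Rightarrow> ('g, 'v::ab_group_add) rep \<Rightarrow> ('g, nat \<Rightarrow> complex) rep" where
  "model_of L R = (SOME A. A \<in> model_reps L \<and> rep_iso R A)"

lemma model_of:
  assumes "fd_representation L R"
  shows "model_of L R \<in> model_reps L" "rep_iso R (model_of L R)" "fd_representation L (model_of L R)"
  using someI_ex[OF model_rep_exists[OF assms]] unfolding model_of_def model_reps_def by auto

lemma relation_subgroup_normal: "relation_subgroup L \<lhd> free_Abelian_group (model_reps L)"
proof -
  interpret comm_group "free_Abelian_group (model_reps L)"
    by (rule abelian_free_Abelian_group)
  have "sum_relations L \<subseteq> carrier (free_Abelian_group (model_reps L))"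
  proof
    fix x assume "x \<in> sum_relations L"
    then obtain A B C where x: "x = frag_of A - frag_of B - frag_of C"
      "A \<in> model_reps L" "B \<in> model_reps L" "C \<in> model_reps L"
      unfolding sum_relations_def by blast
    have "Poly_Mapping.keys x \<subseteq> {A} \<union> {B} \<union> {C}"
      unfolding x(1) using keys_diff[of "frag_of A - frag_of B" "frag_of C"]
        keys_diff[of "frag_of A" "frag_of B"] by auto
    then show "x \<in> carrier (free_Abelian_group (model_reps L))"
      using x(2-4) by auto
  qed
  then show ?thesis
    unfolding relation_subgroup_def
    using generate_is_subgroup subgroup_imp_normal by blast
qed

text \<open>\<open>N\<close> extends to a homomorphism on the free abelian group. Additivity puts
  the relations into its kernel, a subgroup, which then contains everything they generate; so the
  homomorphism factors through \<open>rep_ring L\<close> and can be applied to the equation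
  \<open>cl\<close>. The conclusion is about \<open>model_of\<close> because \<open>N\<close> is
  defined on models only.\<close>

lemma additive_function_on_classes:
  fixes N :: "('g::ab_group_add, nat \<Rightarrow> complex) rep \<Rightarrow> int"
  assumes additive: "\<And>A B C. A \<in> model_reps L \<Longrightarrow> B \<in> model_reps L \<Longrightarrow> C \<in> model_reps L
      \<Longrightarrow> rep_iso A (rep_sum B C) \<Longrightarrow> N A = N B + N C"
    and V: "fd_representation L V" and W: "\<And>i. i \<in> I \<Longrightarrow> fd_representation L (W i)"
    and "finite I"
    and cl: "cl L V = (\<Otimes>\<^bsub>rep_ring L\<^esub>i\<in>I. cl L (W i) [^]\<^bsub>rep_ring L\<^esub> (n i :: int))"
  shows "N (model_of L V) = (\<Sum>i\<in>I. n i * N (model_of L (W i)))"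
proof -
  let ?F = "free_Abelian_group (model_reps L)"
  interpret F: comm_group ?F by (rule abelian_free_Abelian_group)
  interpret normal "relation_subgroup L" ?F by (rule relation_subgroup_normal)
  interpret Q: comm_group "rep_ring L"
    unfolding rep_ring_def using F.abelian_FactGroup subgroup_axioms by blast
  interpret Z: comm_group integer_group by (rule abelian_integer_group)
  obtain h where h: "h \<in> hom ?F integer_group" "\<And>A. A \<in> model_reps L \<Longrightarrow> h (frag_of A) = N A"
    using Z.free_Abelian_group_universal[of N "model_reps L"] by auto
  interpret h: group_hom ?F integer_group h
    by unfold_locales (rule h(1))
  have hdiff: "h (x - y) = h x - h y" if "x \<in> carrier ?F" "y \<in> carrier ?F" for x y
  proof -
    have "x - y \<in> carrier ?F"
      using that keys_diff[of x y] by auto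
    then show ?thesis
      using h.hom_mult[of "x - y" y] that by simp
  qed
  have "sum_relations L \<subseteq> kernel ?F integer_group h"
  proof
    fix x assume "x \<in> sum_relations L"
    then obtain A B C where x: "x = frag_of A - frag_of B - frag_of C"
      "A \<in> model_reps L" "B \<in> model_reps L" "C \<in> model_reps L" "rep_iso A (rep_sum B C)"
      unfolding sum_relations_def by blast
    have c: "frag_of A \<in> carrier ?F" "frag_of B \<in> carrier ?F" "frag_of C \<in> carrier ?F"
      using x by simp_all
    have c': "frag_of A - frag_of B \<in> carrier ?F" "x \<in> carrier ?F"
      using x(2-4) keys_diff[of "frag_of A - frag_of B" "frag_of C"]
        keys_diff[of "frag_of A" "frag_of B"] unfolding x(1) by auto
    show "x \<in> kernel ?F integer_group h"
      using c' additive[OF x(2-5)] unfolding kernel_def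
      by (simp add: x(1) hdiff[OF c'(1) c(3)] hdiff[OF c(1,2)] h(2) x(2-4))
  qed
  then have "relation_subgroup L \<subseteq> kernel ?F integer_group h"
    unfolding relation_subgroup_def
    using F.generate_subgroup_incl h.subgroup_kernel by blast
  then obtain g where g: "g \<in> hom (rep_ring L) integer_group"
    "\<And>x. x \<in> carrier ?F \<Longrightarrow> g (relation_subgroup L #>\<^bsub>?F\<^esub> x) = h x"
    using h.FactGroup_universal_kernel[OF relation_subgroup_normal] unfolding rep_ring_def by blast
  have cl_eq: "g (cl L R) = N (model_of L R)" and cl_carrier: "cl L R \<in> carrier (rep_ring L)"
    if "fd_representation L R" for R :: "('g, 'x::ab_group_add) rep"
  proof -
    have c: "frag_of (model_of L R) \<in> carrier ?F"
      using model_of(1)[OF that] by simp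
    then show "g (cl L R) = N (model_of L R)"
      unfolding cl_def using g(2) h(2) model_of(1)[OF that] by (simp add: model_of_def)
    show "cl L R \<in> carrier (rep_ring L)"
      unfolding cl_def rep_ring_def carrier_FactGroup using c by (auto simp: model_of_def)
  qed
  \<comment> \<open>\<open>rep_ring L\<close> is written multiplicatively and
    \<open>integer_group\<close> additively: powers, also negative ones, become multiples and the
    product becomes a sum. Subsets \<open>J\<close> of \<open>I\<close> occur only to make the
    induction possible.\<close>
  have g_prod: "g (\<Otimes>\<^bsub>rep_ring L\<^esub>i\<in>J. cl L (W i) [^]\<^bsub>rep_ring L\<^esub> n i)
      = (\<Sum>i\<in>J. n i * N (model_of L (W i)))" if "J \<subseteq> I" for J
    using finite_subset[OF that \<open>finite I\<close>] that
  proof (induction J rule: finite_induct)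
    case empty
    then show ?case
      using hom_one[OF g(1) Q.is_group group_integer_group] by simp
  next
    case (insert j J)
    have pow: "cl L (W i) [^]\<^bsub>rep_ring L\<^esub> n i \<in> carrier (rep_ring L)" if "i \<in> insert j J" for i
      using cl_carrier[OF W] insert.prems that by auto
    have "g (cl L (W j) [^]\<^bsub>rep_ring L\<^esub> n j) = n j * N (model_of L (W j))"
      using hom_int_pow[OF g(1) cl_carrier[OF W] Q.is_group group_integer_group, of j "n j"]
        cl_eq[OF W] insert.prems by simp
    then show ?case
      using insert pow hom_mult[OF g(1)] by (simp add: Q.finprod_insert Pi_def)
  qed
  show ?thesis
    using g_prod[of I] cl_eq[OF V] unfolding cl by simp
qed

text \<open>Both are instances of \<open>additive_function_on_classes\<close>, for
  \<open>hom_dim _ K\<close> and \<open>hom_dim K _\<close>; isomorphism invariance then replaces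
  each model by the representation it stands for.\<close>

lemma
  assumes V: "fd_representation L V" and W: "\<And>i. i \<in> I \<Longrightarrow> fd_representation L (W i)"
    and K: "fd_representation L K" and "finite I"
    and cl: "cl L V = (\<Otimes>\<^bsub>rep_ring L\<^esub>i\<in>I. cl L (W i) [^]\<^bsub>rep_ring L\<^esub> (n i :: int))"
  shows hom_dim_class_left: "int (hom_dim V K) = (\<Sum>i\<in>I. n i * int (hom_dim (W i) K))"
    and hom_dim_class_right: "int (hom_dim K V) = (\<Sum>i\<in>I. n i * int (hom_dim K (W i)))"
proof -
  have fd: "fd_representation L A" if "A \<in> model_reps L" for A
    using that unfolding model_reps_def by simp
  note additive = additive_function_on_classes[OF _ V W \<open>finite I\<close> cl]
  have left: "int (hom_dim (model_of L V) K) = (\<Sum>i\<in>I. n i * int (hom_dim (model_of L (W i)) K))"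
    by (rule additive) (use hom_dim_rep_sum(1)[OF fd fd fd K] in auto)
  have right: "int (hom_dim K (model_of L V)) = (\<Sum>i\<in>I. n i * int (hom_dim K (model_of L (W i))))"
    by (rule additive) (use hom_dim_rep_sum(2)[OF fd fd fd K] in auto)
  have model: "hom_dim (model_of L R) K = hom_dim R K" "hom_dim K (model_of L R) = hom_dim K R"
    if R: "fd_representation L R" for R :: "('a, 'x::ab_group_add) rep"
    using hom_dim_iso_left[OF R model_of(3)[OF R] K model_of(2)[OF R]]
      hom_dim_iso_right[OF R model_of(3)[OF R] K model_of(2)[OF R]] by simp_all
  show "int (hom_dim V K) = (\<Sum>i\<in>I. n i * int (hom_dim (W i) K))"
    using left model[OF V] model[OF W] by simp
  show "int (hom_dim K V) = (\<Sum>i\<in>I. n i * int (hom_dim K (W i)))"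
    using right model[OF V] model[OF W] by simp
qed

section \<open>Common complements\<close>

lemma is_subrep_preimage:
  assumes R: "fd_representation L R" and R': "fd_representation L R'" and f: "f \<in> rep_hom R R'"
    and U: "is_subrep R' U"
  shows "is_subrep R {v \<in> space R. f v \<in> U}"
proof -
  interpret R: fd_representation L R by (rule R)
  interpret vs: vector_space "scl R" by (rule R.vector_space_scl)
  show ?thesis
    unfolding is_subrep_def
    using rep_homD[OF f] rep_hom_zero[OF f] is_subrepD[OF R is_subrep_space[OF R]] is_subrepD[OF R' U]
    by (auto intro!: vs.subspaceI)
qed

lemma is_subrep_sums:
  assumes R: "fd_representation L R" and A: "is_subrep R A" and B: "is_subrep R B"
  shows "is_subrep R {a + b | a b. a \<in> A \<and> b \<in> B}"
proof -
  interpret fd_representation L R by (rule R)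
  interpret vs: vector_space "scl R" by (rule vector_space_scl)
  note Ac = is_subrepD[OF R A] and Bc = is_subrepD[OF R B]
  have "act R x (a + b) = act R x a + act R x b" if "a \<in> A" "b \<in> B" for x a b
    using act_linear[of x] Ac(5)[OF that(1)] Bc(5)[OF that(2)] unfolding linear_on_def by blast
  moreover have "a + b \<in> space R" if "a \<in> A" "b \<in> B" for a b
    using is_subrepD(2)[OF R is_subrep_space[OF R]] Ac(5)[OF that(1)] Bc(5)[OF that(2)] by blast
  ultimately show ?thesis
    unfolding is_subrep_def using vs.subspace_sums[OF Ac(7) Bc(7)] Ac(6) Bc(6) by blast
qed

lemma rep_direct_sum_subrep:
  assumes "fd_representation L R" "is_subrep R A" "is_subrep R B" "A \<inter> B = {0}"
  shows "rep_direct_sum (subrep R {a + b | a b. a \<in> A \<and> b \<in> B}) A B"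
proof -
  have "A \<subseteq> {a + b | a b. a \<in> A \<and> b \<in> B}" "B \<subseteq> {a + b | a b. a \<in> A \<and> b \<in> B}"
    using is_subrepD(1)[OF assms(1,2)] is_subrepD(1)[OF assms(1,3)]
    by (force intro: add.right_neutral[symmetric] add.left_neutral[symmetric])+
  then show ?thesis
    using assms unfolding rep_direct_sum_def is_subrep_def by simp
qed

lemma rep_hom_subset_eqI:
  assumes Q: "fd_representation L Q" and R: "fd_representation L R" and U: "is_subrep R U"
    and "hom_dim Q R \<le> hom_dim Q (subrep R U)"
  shows "rep_hom Q (subrep R U) = rep_hom Q R"
proof -
  interpret fs: vector_space "fscale (scl R)"
    by (rule vector_space_fscale) (rule fd_representation.vector_space_scl[OF R])
  show ?thesis
    using rep_hom_subspace[OF Q fd_representation_subrep[OF R U]] assms(4)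
      finitely_spanned_rep_hom[OF Q R] rep_hom_target[OF U, of _ Q]
    by (intro fs.subspace_dim_equal_finitely_spanned) (auto simp: hom_dim_def)
qed

text \<open>\<open>dims\<close> is applied to \<open>K = V\<close> and to \<open>K = U\<close>. By
  \<open>images\<close> the right-hand sides agree, so every endomorphism of \<open>V\<close> takes
  its values in \<open>U\<close>.\<close>

lemma generated_by_images:
  fixes V :: "('g::ab_group_add, 'v::ab_group_add) rep" and W :: "'i \<Rightarrow> ('g, 'w::ab_group_add) rep"
  assumes V: "fd_representation L V"
    and dims: "\<And>K :: ('g, 'v) rep. fd_representation L K \<Longrightarrow>
      int (hom_dim V K) = (\<Sum>i\<in>I. n i * int (hom_dim (W i) K))"
    and U: "is_subrep V U" and images: "\<And>i f. i \<in> I \<Longrightarrow> f \<in> rep_hom (W i) V \<Longrightarrow> f ` space (W i) \<subseteq> U"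
  shows "U = space V"
proof -
  have "rep_hom (W i) (subrep V U) = rep_hom (W i) V" if "i \<in> I" for i
    using images[OF that] rep_hom_target[OF U, of _ "W i"] by blast
  then have "hom_dim (W i) (subrep V U) = hom_dim (W i) V" if "i \<in> I" for i
    using that by (simp add: hom_dim_def)
  then have "int (hom_dim V V) = int (hom_dim V (subrep V U))"
    using dims[OF V] dims[OF fd_representation_subrep[OF V U]] by simp
  then have eq: "rep_hom V (subrep V U) = rep_hom V V"
    using rep_hom_subset_eqI[OF V V U] by simp
  \<comment> \<open>The normalised identity: as an endomorphism it has values in \<open>U\<close>,
    which is all that is wanted.\<close>
  let ?e = "\<lambda>v. if v \<in> space V then v else 0"
  have "?e \<in> rep_hom V V"
    using is_subrepD[OF V is_subrep_space[OF V]] unfolding rep_hom_def linear_on_def by auto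
  then have "?e \<in> rep_hom V (subrep V U)"
    using eq by simp
  from rep_homD(2)[OF this] have "v \<in> U" if "v \<in> space V" for v
    using that by force
  then show ?thesis
    using is_subrepD(5)[OF V U] by blast
qed

text \<open>A subrepresentation \<open>K\<close> of maximal dimension among those meeting \<open>T\<close> and \<open>T'\<close> trivially is a
  common complement: otherwise, \<open>T + K\<close> and \<open>T' + K\<close> having equal multiplicities, some copy
  of a \<open>W i\<close> lies in neither of them, since a vector space is not the union of two proper
  subspaces, and could be added to \<open>K\<close>.\<close>

lemma common_complement:
  fixes V :: "('g::ab_group_add, 'v::ab_group_add) rep" and W :: "'i \<Rightarrow> ('g, 'w::ab_group_add) rep"
  assumes V: "fd_representation L V" and W: "\<And>i. i \<in> I \<Longrightarrow> irreducible_rep L (W i)"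
    and generated: "\<And>U. is_subrep V U \<Longrightarrow>
      (\<And>i f. i \<in> I \<Longrightarrow> f \<in> rep_hom (W i) V \<Longrightarrow> f ` space (W i) \<subseteq> U) \<Longrightarrow> U = space V"
    and T: "is_subrep V T" and T': "is_subrep V T'"
    and mult: "\<And>i. i \<in> I \<Longrightarrow> hom_dim (W i) (subrep V T) = hom_dim (W i) (subrep V T')"
  obtains K where "rep_direct_sum V T K" "rep_direct_sum V T' K"
proof -
  interpret fd_representation L V by (rule V)
  interpret vs: vector_space "scl V" by (rule vector_space_scl)
  define good where "good K \<longleftrightarrow> is_subrep V K \<and> T \<inter> K = {0} \<and> T' \<inter> K = {0}" for K
  note Tc = is_subrepD[OF V T] and T'c = is_subrepD[OF V T']
  have "act V x 0 = 0" for x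
    using linear_on_zero[OF act_linear zero_in_space] .
  then have "good {0}"
    using Tc(1) T'c(1) zero_in_space unfolding good_def is_subrep_def by auto
  moreover have fin: "finitely_spanned (scl V) A" if "is_subrep V A" for A
    using vs.finitely_spanned_mono[OF finitely_spanned_space] is_subrepD(5)[OF V that] by blast
  have "vs.dim K < Suc (vs.dim (space V))" if "good K" for K
    using vs.dim_mono_finitely_spanned[OF _ finitely_spanned_space, of K] that is_subrepD(5)[OF V]
      vs.span_superset[of "space V"] unfolding good_def by (meson less_Suc_eq_le subset_iff)
  ultimately obtain K where K: "good K" and max: "\<And>K'. good K' \<Longrightarrow> vs.dim K' \<le> vs.dim K"
    using ex_has_greatest_nat[of good "{0}" vs.dim "Suc (vs.dim (space V))"] by blast
  have K_sub: "is_subrep V K" and TK: "T \<inter> K = {0}" and T'K: "T' \<inter> K = {0}"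
    using K unfolding good_def by auto
  note Kc = is_subrepD[OF V K_sub]
  define U where "U = {a + b | a b. a \<in> T \<and> b \<in> K}"
  define U' where "U' = {a + b | a b. a \<in> T' \<and> b \<in> K}"
  have U: "is_subrep V U" and U': "is_subrep V U'"
    unfolding U_def U'_def using is_subrep_sums[OF V _ K_sub] T T' by blast+
  have KU: "K \<subseteq> U" "K \<subseteq> U'"
    unfolding U_def U'_def using Tc(1) T'c(1) by (force intro: add.left_neutral[symmetric])+
  \<comment> \<open>By additivity each multiplicity is that in \<open>T\<close> or \<open>T'\<close>
    plus that in the common summand \<open>K\<close>.\<close>
  have mult_eq: "hom_dim (W i) (subrep V U) = hom_dim (W i) (subrep V U')" if "i \<in> I" for i
  proof -
    have Wi: "fd_representation L (W i)" using W[OF that] unfolding irreducible_rep_def by simp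
    show ?thesis
      using hom_dim_direct_sum_right[OF fd_representation_subrep[OF V U] Wi
          rep_direct_sum_subrep[OF V T K_sub TK, folded U_def]]
        hom_dim_direct_sum_right[OF fd_representation_subrep[OF V U'] Wi
          rep_direct_sum_subrep[OF V T' K_sub T'K, folded U'_def]]
        mult[OF that] by (simp add: subrep_def)
  qed
  have "U = space V \<and> U' = space V"
  proof (rule ccontr)
    assume "\<not> (U = space V \<and> U' = space V)"
    then obtain A i f where A: "A = U \<or> A = U'" and i: "i \<in> I"
      and f: "f \<in> rep_hom (W i) V" "\<not> f ` space (W i) \<subseteq> A"
      using generated[OF U] generated[OF U'] by blast
    have Wi: "fd_representation L (W i)" using W[OF i] unfolding irreducible_rep_def by simp
    interpret fs: vector_space "fscale (scl V) :: complex \<Rightarrow> ('w \<Rightarrow> 'v) \<Rightarrow> 'w \<Rightarrow> 'v"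
      by (rule vector_space_fscale) (rule vector_space_scl)
    \<comment> \<open>The map \<open>f\<close> misses only \<open>A\<close>, one of \<open>U\<close>
      and \<open>U'\<close>. Equal multiplicities transfer the failure to the other one, so both Hom
      spaces are proper.\<close>
    have proper: "rep_hom (W i) (subrep V B) \<subset> rep_hom (W i) V" if B: "B = U \<or> B = U'" for B
    proof -
      have BV: "is_subrep V B" and AV: "is_subrep V A" using A B U U' by auto
      have "\<not> hom_dim (W i) V \<le> hom_dim (W i) (subrep V A)"
        using rep_hom_subset_eqI[OF Wi V AV] rep_hom_target[OF AV] f by blast
      then have "hom_dim (W i) (subrep V B) \<noteq> hom_dim (W i) V"
        using A B mult_eq[OF i] by auto
      moreover have "rep_hom (W i) (subrep V B) \<subseteq> rep_hom (W i) V"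
        using rep_hom_target[OF BV] by blast
      ultimately show ?thesis
        by (auto simp: hom_dim_def)
    qed
    obtain g where g: "g \<in> rep_hom (W i) V" "g \<notin> rep_hom (W i) (subrep V U)"
      "g \<notin> rep_hom (W i) (subrep V U')"
      using fs.not_in_union_two_subspaces[OF
          rep_hom_subspace[OF Wi fd_representation_subrep[OF V U], simplified]
          rep_hom_subspace[OF Wi fd_representation_subrep[OF V U'], simplified]
          rep_hom_subspace[OF Wi V] proper proper] by blast
    \<comment> \<open>The preimage of \<open>B\<close> under \<open>g\<close> is a subrepresentation
      of the irreducible \<open>W i\<close> and not everything, hence 0. So the image of
      \<open>g\<close> meets neither \<open>U\<close> nor \<open>U'\<close> outside 0.\<close>
    have trivial: "w = 0" if B: "B = U \<or> B = U'" and w: "w \<in> space (W i)" "g w \<in> B" for B w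
    proof -
      have BV: "is_subrep V B" using B U U' by auto
      have "{w \<in> space (W i). g w \<in> B} \<noteq> space (W i)"
        using g rep_hom_target[OF BV] B by blast
      then have "{w \<in> space (W i). g w \<in> B} = {0}"
        using is_subrep_preimage[OF Wi V g(1) BV] W[OF i] unfolding irreducible_rep_def by blast
      then show ?thesis using w by blast
    qed
    define E where "E = g ` space (W i)"
    have E: "is_subrep V E" unfolding E_def by (rule is_subrep_image[OF Wi V g(1)])
    define K' where "K' = {a + b | a b. a \<in> K \<and> b \<in> E}"
    have K': "is_subrep V K'" unfolding K'_def by (rule is_subrep_sums[OF V K_sub E])
    \<comment> \<open>If \<open>x\<close> in \<open>B\<close> equals \<open>k + g w\<close>, then
      \<open>g w = x - k\<close> lies in \<open>C\<close>, the sum of \<open>B\<close> and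
      \<open>K\<close>; this forces \<open>w = 0\<close>, so \<open>x\<close> lies in
      \<open>B \<inter> K\<close>.\<close>
    have "B \<inter> K' = {0}" if BC: "(B, C) = (T, U) \<or> (B, C) = (T', U')" for B C
    proof -
      have CV: "is_subrep V C" and BC': "B \<subseteq> C" "K \<subseteq> C" "B \<inter> K = {0}" "C = U \<or> C = U'" "0 \<in> B"
        using BC U U' KU TK T'K Kc(1) Tc(1) T'c(1) unfolding U_def U'_def
        by (auto intro: add.right_neutral[symmetric])
      have "x = 0" if x: "x \<in> B" "x \<in> K'" for x
      proof -
        obtain k w where kw: "x = k + g w" "k \<in> K" "w \<in> space (W i)"
          using x(2) unfolding K'_def E_def by blast
        then have "g w = x - k" by simp
        then have "g w \<in> C"
          using is_subrepD(3)[OF V CV, of x k] x(1) kw(2) BC'(1,2) by auto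
        then have "w = 0" using trivial BC'(4) kw(3) by blast
        then have "x \<in> B \<inter> K" using kw rep_hom_zero[OF g(1)] x(1) by simp
        then show ?thesis using BC'(3) by blast
      qed
      then show ?thesis using BC'(5) is_subrepD(1)[OF V K'] by blast
    qed
    then have "good K'"
      unfolding good_def using K' by blast
    have "K \<subseteq> K'"
      unfolding K'_def using is_subrepD(1)[OF V E] by (force intro: add.right_neutral[symmetric])
    \<comment> \<open>Maximality leaves no room for the new copy: it already lies in
      \<open>K\<close>, hence in \<open>U\<close>, which contradicts \<open>trivial\<close> since
      \<open>W i\<close> is nonzero.\<close>
    then have "K = K'"
      using vs.subspace_dim_equal_finitely_spanned[OF Kc(7) _ fin[OF K'] max[OF \<open>good K'\<close>]] by blast
    have "E \<subseteq> K'"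
      unfolding K'_def using Kc(1) by (force intro: add.left_neutral[symmetric])
    then have "g w \<in> U" if "w \<in> space (W i)" for w
      using that \<open>K = K'\<close> KU(1) unfolding E_def by blast
    then have "space (W i) \<subseteq> {0}" using trivial by blast
    then show False
      using W[OF i] is_subrepD(1)[OF Wi is_subrep_space[OF Wi]] unfolding irreducible_rep_def by blast
  qed
  then show thesis
    using that[of K] T T' K_sub TK T'K unfolding rep_direct_sum_def U_def U'_def by blast
qed

section \<open>Irreducible spaces and Krull dimension\<close>

lemma irreducible_subtopology_iff:
  assumes "Z \<subseteq> topspace X"
  shows "irreducible_space (subtopology X Z) \<longleftrightarrow> Z \<noteq> {} \<and>
    (\<forall>A B. closedin X A \<and> closedin X B \<and> Z \<subseteq> A \<union> B \<longrightarrow> Z \<subseteq> A \<or> Z \<subseteq> B)"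
proof -
  have top: "topspace (subtopology X Z) = Z" using assms by auto
  show ?thesis
    unfolding irreducible_space_def top
  proof (intro conj_cong refl iffI allI impI)
    fix A B assume irr: "\<forall>A B. closedin (subtopology X Z) A \<and> closedin (subtopology X Z) B \<and> A \<union> B = Z
        \<longrightarrow> A = Z \<or> B = Z"
      and AB: "closedin X A \<and> closedin X B \<and> Z \<subseteq> A \<union> B"
    have "closedin (subtopology X Z) (A \<inter> Z)" "closedin (subtopology X Z) (B \<inter> Z)"
      using AB by (auto simp: closedin_subtopology)
    moreover have "(A \<inter> Z) \<union> (B \<inter> Z) = Z" using AB by blast
    ultimately have "A \<inter> Z = Z \<or> B \<inter> Z = Z" using irr by blast
    then show "Z \<subseteq> A \<or> Z \<subseteq> B" by blast
  next
    fix A B assume irr: "\<forall>A B. closedin X A \<and> closedin X B \<and> Z \<subseteq> A \<union> B \<longrightarrow> Z \<subseteq> A \<or> Z \<subseteq> B"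
      and AB: "closedin (subtopology X Z) A \<and> closedin (subtopology X Z) B \<and> A \<union> B = Z"
    obtain A' B' where A': "closedin X A'" "A = A' \<inter> Z" and B': "closedin X B'" "B = B' \<inter> Z"
      using AB unfolding closedin_subtopology by blast
    then have "Z \<subseteq> A' \<or> Z \<subseteq> B'" using irr AB by blast
    then show "A = Z \<or> B = Z" using A' B' by blast
  qed
qed

text \<open>Nonempty open subsets of an irreducible set are dense: \<open>Z\<close> is covered by
  \<open>C\<close> and the complement of \<open>U\<close>, and is not contained in the
  latter.\<close>

lemma irreducible_subset_of_union:
  assumes "irreducible_space (subtopology X Z)" "Z \<subseteq> topspace X"
    and "openin X U" "Z \<inter> U \<noteq> {}" "closedin X C" "Z \<inter> U \<subseteq> C"
  shows "Z \<subseteq> C"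
proof -
  have "closedin X (topspace X - U)" using assms(3) by blast
  moreover have "Z \<subseteq> C \<union> (topspace X - U)" using assms(2,6) by blast
  ultimately show ?thesis
    using assms(1,4,5) unfolding irreducible_subtopology_iff[OF assms(2)] by blast
qed

lemma irreducible_open_subset:
  assumes "irreducible_space (subtopology X Z)" "Z \<subseteq> topspace X"
    and "openin X U" "Z \<inter> U \<noteq> {}"
  shows "irreducible_space (subtopology X (Z \<inter> U))"
proof -
  have "Z \<inter> U \<subseteq> A \<or> Z \<inter> U \<subseteq> B" if AB: "closedin X A" "closedin X B" "Z \<inter> U \<subseteq> A \<union> B" for A B
  proof -
    have "Z \<subseteq> A \<union> B"
      using irreducible_subset_of_union[OF assms closedin_Un[OF AB(1,2)] AB(3)] .
    then show ?thesis
      using assms(1) AB(1,2) unfolding irreducible_subtopology_iff[OF assms(2)] by blast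
  qed
  then show ?thesis
    using assms(2,4) by (subst irreducible_subtopology_iff) auto
qed

lemma irreducible_closure:
  assumes "irreducible_space (subtopology X Z)" "Z \<subseteq> topspace X"
  shows "irreducible_space (subtopology X (X closure_of Z))"
proof -
  have "X closure_of Z \<subseteq> A \<or> X closure_of Z \<subseteq> B"
    if AB: "closedin X A" "closedin X B" "X closure_of Z \<subseteq> A \<union> B" for A B
  proof -
    have "Z \<subseteq> A \<union> B" using AB(3) closure_of_subset[OF assms(2)] by blast
    then have "Z \<subseteq> A \<or> Z \<subseteq> B"
      using assms(1) AB(1,2) unfolding irreducible_subtopology_iff[OF assms(2)] by blast
    then show ?thesis using closure_of_minimal AB(1,2) by metis
  qed
  moreover have "X closure_of Z \<noteq> {}"
    using assms(1) closure_of_subset[OF assms(2)]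
    unfolding irreducible_subtopology_iff[OF assms(2)] by blast
  ultimately show ?thesis
    by (subst irreducible_subtopology_iff) (auto simp: closure_of_subset_topspace)
qed

section \<open>Chains of irreducible closed sets and open subspaces\<close>

definition irreducible_chain :: "'a topology \<Rightarrow> nat \<Rightarrow> (nat \<Rightarrow> 'a set) \<Rightarrow> bool" where
  "irreducible_chain X m Z \<longleftrightarrow>
     (\<forall>i\<le>m. closedin X (Z i) \<and> irreducible_space (subtopology X (Z i))) \<and>
     (\<forall>i<m. Z i \<subset> Z (Suc i))"

lemma irreducible_chainD:
  assumes "irreducible_chain X m Z" "i \<le> m"
  shows "closedin X (Z i)" "irreducible_space (subtopology X (Z i))" "Z i \<subseteq> topspace X"
  using assms closedin_subset unfolding irreducible_chain_def by auto

lemma irreducible_chain_mono: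
  assumes "irreducible_chain X m Z" "i \<le> j" "j \<le> m"
  shows "Z i \<subseteq> Z j"
  using assms(2,3)
proof (induction j rule: dec_induct)
  case (step j)
  then have "Z j \<subset> Z (Suc j)" using assms(1) unfolding irreducible_chain_def by auto
  then show ?case using step by auto
qed simp

lemma krull_dim_leI:
  assumes "\<And>m Z. irreducible_chain X m Z \<Longrightarrow> enat m \<le> N"
  shows "krull_dim X \<le> N"
  unfolding krull_dim_def using assms unfolding irreducible_chain_def
  by (intro Sup_least) blast

lemma krull_dim_geI: "irreducible_chain X m Z \<Longrightarrow> enat m \<le> krull_dim X"
  unfolding krull_dim_def irreducible_chain_def by (intro Sup_upper) blast

text \<open>The members increase, so it is enough that the smallest one meets \<open>U\<close>.
  Inclusions stay strict because the trace of \<open>U\<close> on each larger member is dense in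
  it.\<close>

lemma irreducible_chain_restrict:
  assumes chain: "irreducible_chain X m Z" and U: "openin X U" and ne: "Z 0 \<inter> U \<noteq> {}"
  shows "irreducible_chain (subtopology X U) m (\<lambda>i. Z i \<inter> U)"
  unfolding irreducible_chain_def
proof (intro conjI allI impI)
  fix i assume i: "i \<le> m"
  note Zi = irreducible_chainD[OF chain i]
  have ne_i: "Z i \<inter> U \<noteq> {}"
    using irreducible_chain_mono[OF chain _ i] ne by blast
  show "closedin (subtopology X U) (Z i \<inter> U)"
    using Zi(1) by (auto simp: closedin_subtopology)
  show "irreducible_space (subtopology (subtopology X U) (Z i \<inter> U))"
    using irreducible_open_subset[OF Zi(2,3) U ne_i]
    by (simp add: subtopology_subtopology Int_absorb1)
next
  fix i assume i: "i < m"
  have ne_i: "Z (Suc i) \<inter> U \<noteq> {}"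
    using irreducible_chain_mono[OF chain, of 0 "Suc i"] i ne by auto
  have "Z i \<subset> Z (Suc i)" using chain i unfolding irreducible_chain_def by blast
  moreover have "Z i \<inter> U \<noteq> Z (Suc i) \<inter> U"
  proof
    assume "Z i \<inter> U = Z (Suc i) \<inter> U"
    then have "Z (Suc i) \<inter> U \<subseteq> Z i" by blast
    then have "Z (Suc i) \<subseteq> Z i"
      using i irreducible_chainD(2,3)[OF chain, of "Suc i"] irreducible_chainD(1)[OF chain, of i]
        irreducible_subset_of_union[OF _ _ U ne_i, of "Z i"] by simp
    then show False using \<open>Z i \<subset> Z (Suc i)\<close> by blast
  qed
  ultimately show "Z i \<inter> U \<subset> Z (Suc i) \<inter> U" by blast
qed

text \<open>A chain keeps its full length on a neighbourhood of any point of its smallest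
  member.\<close>

lemma krull_dim_open_cover:
  assumes "\<And>p. p \<in> topspace X \<Longrightarrow> \<exists>U. openin X U \<and> p \<in> U \<and> krull_dim (subtopology X U) \<le> N"
  shows "krull_dim X \<le> N"
proof (rule krull_dim_leI)
  fix m Z assume chain: "irreducible_chain X m Z"
  have "topspace (subtopology X (Z 0)) \<noteq> {}"
    using irreducible_chainD(2)[OF chain, of 0] unfolding irreducible_space_def by blast
  then obtain p where p: "p \<in> Z 0" "p \<in> topspace X" by auto
  then obtain U where U: "openin X U" "p \<in> U" "krull_dim (subtopology X U) \<le> N"
    using assms by blast
  then show "enat m \<le> N"
    using krull_dim_geI[OF irreducible_chain_restrict[OF chain U(1)]] p(1) order_trans by blast
qed

text \<open>A chain in \<open>U\<close> is lifted by taking closures in \<open>X\<close>;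
  intersecting these with \<open>U\<close> gives back the original members, so they remain
  distinct.\<close>

lemma krull_dim_open_le:
  assumes U: "openin X U"
  shows "krull_dim (subtopology X U) \<le> krull_dim X"
proof (rule krull_dim_leI)
  fix m Z assume chain: "irreducible_chain (subtopology X U) m Z"
  have UX: "U \<subseteq> topspace X" using openin_subset[OF U] .
  have ZU: "Z i \<subseteq> U" if "i \<le> m" for i
    using irreducible_chainD(3)[OF chain that] UX by auto
  have irr: "irreducible_space (subtopology X (Z i))" if "i \<le> m" for i
    using irreducible_chainD(2)[OF chain that] ZU[OF that]
    by (simp add: subtopology_subtopology Int_absorb1)
  have cl: "(X closure_of Z i) \<inter> U = Z i" if i: "i \<le> m" for i
  proof -
    obtain C where C: "closedin X C" "Z i = C \<inter> U"
      using irreducible_chainD(1)[OF chain i] unfolding closedin_subtopology by blast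
    then have "X closure_of Z i \<subseteq> C" by (intro closure_of_minimal) auto
    then show ?thesis
      using C closure_of_subset[of "Z i" X] ZU[OF i] UX by blast
  qed
  have "irreducible_chain X m (\<lambda>i. X closure_of Z i)"
    unfolding irreducible_chain_def
  proof (intro conjI allI impI)
    fix i assume "i \<le> m"
    then show "irreducible_space (subtopology X (X closure_of Z i))"
      using irreducible_closure[OF irr] ZU UX by blast
  next
    fix i assume i: "i < m"
    then have "Z i \<subset> Z (Suc i)" using chain unfolding irreducible_chain_def by blast
    then show "X closure_of Z i \<subset> X closure_of Z (Suc i)"
      using closure_of_mono[of "Z i" "Z (Suc i)" X] cl[of i] cl[of "Suc i"] i
      by (metis Suc_leI less_imp_le_nat psubsetE psubsetI)
  qed simp
  then show "enat m \<le> krull_dim X" by (rule krull_dim_geI)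
qed

section \<open>Invariance under homeomorphisms; irreducibility from pairs of points\<close>

lemma irreducible_space_homeomorphic:
  assumes "homeomorphic_map X Y f" "irreducible_space X"
  shows "irreducible_space Y"
  unfolding irreducible_space_def
proof (intro conjI allI impI)
  have im: "f ` topspace X = topspace Y" using homeomorphic_imp_surjective_map[OF assms(1)] .
  have cont: "continuous_map X Y f" using assms(1) homeomorphic_imp_continuous_map by blast
  show "topspace Y \<noteq> {}" using assms(2) im unfolding irreducible_space_def by auto
  fix A B assume AB: "closedin Y A \<and> closedin Y B \<and> A \<union> B = topspace Y"
  let ?P = "\<lambda>A. {x \<in> topspace X. f x \<in> A}"
  have "closedin X (?P A)" "closedin X (?P B)"
    using closedin_continuous_map_preimage[OF cont] AB by auto
  moreover have "?P A \<union> ?P B = topspace X" using AB im by blast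
  ultimately have "?P A = topspace X \<or> ?P B = topspace X"
    using assms(2) unfolding irreducible_space_def by blast
  then have "f ` topspace X \<subseteq> A \<or> f ` topspace X \<subseteq> B"
    by blast
  then show "A = topspace Y \<or> B = topspace Y"
    using AB closedin_subset unfolding im by blast
qed

lemma krull_dim_homeomorphic_le:
  assumes f: "homeomorphic_map X Y f"
  shows "krull_dim X \<le> krull_dim Y"
proof (rule krull_dim_leI)
  fix m Z assume chain: "irreducible_chain X m Z"
  have inj: "inj_on f (topspace X)" using homeomorphic_imp_injective_map[OF f] .
  have "irreducible_chain Y m (\<lambda>i. f ` Z i)"
    unfolding irreducible_chain_def
  proof (intro conjI allI impI)
    fix i assume i: "i \<le> m"
    note Zi = irreducible_chainD[OF chain i]
    show closed: "closedin Y (f ` Z i)"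
      using homeomorphic_map_closedness[OF f Zi(3)] Zi(1) by simp
    have "homeomorphic_map (subtopology X (Z i)) (subtopology Y (f ` Z i)) f"
      using Zi(3) closedin_subset[OF closed] inj homeomorphic_imp_surjective_map[OF f]
      by (intro homeomorphic_map_subtopologies_alt[OF f]) (auto dest: inj_onD)
    then show "irreducible_space (subtopology Y (f ` Z i))"
      using irreducible_space_homeomorphic Zi(2) by blast
  next
    fix i assume i: "i < m"
    then have "Z i \<subset> Z (Suc i)" "Z (Suc i) \<subseteq> topspace X"
      using chain irreducible_chainD(3)[OF chain, of "Suc i"] unfolding irreducible_chain_def by auto
    then show "f ` Z i \<subset> f ` Z (Suc i)"
      using inj_on_image_eq_iff[OF inj] by (metis image_mono psubsetE psubsetI subset_trans)
  qed
  then show "enat m \<le> krull_dim Y" by (rule krull_dim_geI)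
qed

lemma krull_dim_homeomorphic:
  assumes "homeomorphic_map X Y f"
  shows "krull_dim X = krull_dim Y"
proof -
  obtain g where "homeomorphic_maps X Y f g" using assms homeomorphic_map_maps by blast
  then have "homeomorphic_map Y X g"
    using homeomorphic_maps_sym homeomorphic_map_maps by blast
  then show ?thesis
    using krull_dim_homeomorphic_le[OF assms] krull_dim_homeomorphic_le[of Y X g] by simp
qed

text \<open>If closed \<open>A\<close> and \<open>B\<close> cover \<open>X\<close> and both are
  proper, choose \<open>p\<close> outside \<open>A\<close> and \<open>q\<close> outside
  \<open>B\<close>. An irreducible open set containing both points would have to lie in
  \<open>A\<close> or in \<open>B\<close>.\<close>

lemma irreducible_space_from_pairs:
  assumes "topspace X \<noteq> {}"
    and pairs: "\<And>p q. p \<in> topspace X \<Longrightarrow> q \<in> topspace X \<Longrightarrow>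
      \<exists>U. openin X U \<and> p \<in> U \<and> q \<in> U \<and> irreducible_space (subtopology X U)"
  shows "irreducible_space X"
  unfolding irreducible_space_def
proof (intro conjI allI impI assms(1))
  fix A B assume AB: "closedin X A \<and> closedin X B \<and> A \<union> B = topspace X"
  show "A = topspace X \<or> B = topspace X"
  proof (rule ccontr)
    assume "\<not> ?thesis"
    then obtain p q where pq: "p \<in> topspace X" "p \<notin> A" "q \<in> topspace X" "q \<notin> B"
      using AB closedin_subset by (metis subset_antisym subsetI)
    then obtain U where U: "openin X U" "p \<in> U" "q \<in> U" "irreducible_space (subtopology X U)"
      using pairs by blast
    have "U \<subseteq> topspace X" using openin_subset[OF U(1)] .
    then have "U \<subseteq> A \<or> U \<subseteq> B"
      using U(4) AB unfolding irreducible_subtopology_iff[OF \<open>U \<subseteq> topspace X\<close>] by blast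
    then show False using pq U by blast
  qed
qed

section \<open>Linear subspaces in the Zariski topology\<close>

lemma zero_in_affine_space: "0 \<in> affine_space I"
  by (simp add: affine_space_def)

lemma subspace_affine_space: "module.subspace fun_scale (affine_space I)"
proof -
  interpret vector_space fun_scale by (rule vector_space_fun_scale)
  show ?thesis
    by (rule subspaceI) (auto simp: affine_space_def fun_scale_def)
qed

lemma topspace_zariski [simp]: "topspace (zariski I) = affine_space I"
proof
  show "topspace (zariski I) \<subseteq> affine_space I"
    unfolding topspace_def openin_zariski zariski_open_def by blast
  have "zariski_open I (affine_space I)"
    unfolding zariski_open_def
    by (intro exI[of _ "{\<lambda>p. 1}"]) (auto intro: polynomial_functions.const)
  then show "affine_space I \<subseteq> topspace (zariski I)"
    using openin_subset openin_zariski by metis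
qed

lemma closedin_zariski_iff:
  "closedin (zariski I) Z \<longleftrightarrow>
    (\<exists>F \<subseteq> polynomial_functions I. Z = {p \<in> affine_space I. \<forall>f\<in>F. f p = 0})"
proof
  assume "closedin (zariski I) Z"
  then have Z: "Z \<subseteq> affine_space I" "zariski_open I (affine_space I - Z)"
    by (auto simp: closedin_def openin_zariski)
  then obtain F where "F \<subseteq> polynomial_functions I"
    "affine_space I - Z = {p \<in> affine_space I. \<exists>f\<in>F. f p \<noteq> 0}"
    unfolding zariski_open_def by blast
  moreover from this Z(1) have "Z = {p \<in> affine_space I. \<forall>f\<in>F. f p = 0}"
    by blast
  ultimately show "\<exists>F \<subseteq> polynomial_functions I. Z = {p \<in> affine_space I. \<forall>f\<in>F. f p = 0}"
    by blast
next
  assume "\<exists>F \<subseteq> polynomial_functions I. Z = {p \<in> affine_space I. \<forall>f\<in>F. f p = 0}"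
  then obtain F where F: "F \<subseteq> polynomial_functions I" "Z = {p \<in> affine_space I. \<forall>f\<in>F. f p = 0}"
    by blast
  then have "affine_space I - Z = {p \<in> affine_space I. \<exists>f\<in>F. f p \<noteq> 0}" by blast
  then show "closedin (zariski I) Z"
    using F by (auto simp: closedin_def openin_zariski zariski_open_def)
qed

lemma closedin_zariski_zero_set:
  "f \<in> polynomial_functions I \<Longrightarrow> closedin (zariski I) {p \<in> affine_space I. f p = 0}"
  unfolding closedin_zariski_iff by (intro exI[of _ "{f}"]) auto

section \<open>Closure properties of polynomial functions\<close>

lemma polynomial_functions_sum:
  "(\<And>a. a \<in> A \<Longrightarrow> f a \<in> polynomial_functions I) \<Longrightarrow> (\<lambda>p. \<Sum>a\<in>A. f a p) \<in> polynomial_functions I"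
  by (induction A rule: infinite_finite_induct)
    (auto intro: polynomial_functions.const polynomial_functions.add)

lemma polynomial_functions_prod:
  "(\<And>a. a \<in> A \<Longrightarrow> f a \<in> polynomial_functions I) \<Longrightarrow> (\<lambda>p. \<Prod>a\<in>A. f a p) \<in> polynomial_functions I"
  by (induction A rule: infinite_finite_induct)
    (auto intro: polynomial_functions.const polynomial_functions.mult)

lemma polynomial_functions_power:
  "f \<in> polynomial_functions I \<Longrightarrow> (\<lambda>p. f p ^ n) \<in> polynomial_functions I"
  by (induction n) (auto intro: polynomial_functions.const polynomial_functions.mult)

lemma polynomial_functions_cmult:
  "f \<in> polynomial_functions I \<Longrightarrow> (\<lambda>p. c * f p) \<in> polynomial_functions I"
  by (auto intro: polynomial_functions.const polynomial_functions.mult)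

lemma polynomial_functions_compose:
  assumes "f \<in> polynomial_functions I" "\<And>i. i \<in> I \<Longrightarrow> (\<lambda>t. \<psi> t i) \<in> polynomial_functions J"
  shows "(\<lambda>t. f (\<psi> t)) \<in> polynomial_functions J"
  using assms(1)
  by induction (auto intro: polynomial_functions.const polynomial_functions.add
      polynomial_functions.mult assms(2))

lemma polynomial_function_on_line:
  assumes "f \<in> polynomial_functions I"
  obtains P where "\<And>t. f (\<lambda>i. p i + t * v i) = poly P t"
proof -
  from assms have "\<exists>P. \<forall>t. f (\<lambda>i. p i + t * v i) = poly P t"
  proof induction
    case (const c)
    show ?case by (rule exI[of _ "[:c:]"]) simp
  next
    case (coord i)
    show ?case by (rule exI[of _ "[:p i, v i:]"]) simp
  next
    case (add f g)
    then obtain P Q where "\<forall>t. f (\<lambda>i. p i + t * v i) = poly P t" "\<forall>t. g (\<lambda>i. p i + t * v i) = poly Q t"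
      by blast
    then show ?case by (intro exI[of _ "P + Q"]) simp
  next
    case (mult f g)
    then obtain P Q where "\<forall>t. f (\<lambda>i. p i + t * v i) = poly P t" "\<forall>t. g (\<lambda>i. p i + t * v i) = poly Q t"
      by blast
    then show ?case by (intro exI[of _ "P * Q"]) simp
  qed
  then show thesis using that by blast
qed

text \<open>On the line through two points, two polynomials not vanishing identically have only finitely
  many zeros, hence do not cover the line by their zero sets.\<close>

lemma irreducible_zariski_if_lines:
  assumes "Z \<subseteq> affine_space I" "Z \<noteq> {}"
    and lines: "\<And>p q t. p \<in> Z \<Longrightarrow> q \<in> Z \<Longrightarrow> (\<lambda>i. p i + t * (q i - p i)) \<in> Z"
  shows "irreducible_space (subtopology (zariski I) Z)"
proof (subst irreducible_subtopology_iff, simp add: assms(1), intro conjI assms(2) allI impI)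
  fix A B assume AB: "closedin (zariski I) A \<and> closedin (zariski I) B \<and> Z \<subseteq> A \<union> B"
  show "Z \<subseteq> A \<or> Z \<subseteq> B"
  proof (rule ccontr)
    assume "\<not> (Z \<subseteq> A \<or> Z \<subseteq> B)"
    then obtain p q where pq: "p \<in> Z" "p \<notin> A" "q \<in> Z" "q \<notin> B" by blast
    obtain F where F: "F \<subseteq> polynomial_functions I" "A = {p \<in> affine_space I. \<forall>f\<in>F. f p = 0}"
      using AB unfolding closedin_zariski_iff by blast
    obtain G where G: "G \<subseteq> polynomial_functions I" "B = {p \<in> affine_space I. \<forall>f\<in>G. f p = 0}"
      using AB unfolding closedin_zariski_iff by blast
    obtain f g where f: "f \<in> F" "f p \<noteq> 0" and g: "g \<in> G" "g q \<noteq> 0"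
      using pq F(2) G(2) assms(1) by blast
    obtain P where P: "\<And>t. f (\<lambda>i. p i + t * (q i - p i)) = poly P t"
      using polynomial_function_on_line[of f I p "\<lambda>i. q i - p i"] f F by blast
    obtain Q where Q: "\<And>t. g (\<lambda>i. p i + t * (q i - p i)) = poly Q t"
      using polynomial_function_on_line[of g I p "\<lambda>i. q i - p i"] g G by blast
    \<comment> \<open>The line passes through \<open>p\<close> at parameter 0 and through
      \<open>q\<close> at parameter 1.\<close>
    have "poly P 0 \<noteq> 0" "poly Q 1 \<noteq> 0"
      using P[of 0] Q[of 1] f g by simp_all
    then have "P * Q \<noteq> 0" by auto
    then obtain t where "poly (P * Q) t \<noteq> 0"
      using poly_all_0_iff_0 by blast
    then have "f (\<lambda>i. p i + t * (q i - p i)) \<noteq> 0" "g (\<lambda>i. p i + t * (q i - p i)) \<noteq> 0"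
      using P Q by auto
    then have "(\<lambda>i. p i + t * (q i - p i)) \<notin> A \<union> B"
      using f(1) g(1) F(2) G(2) by blast
    then show False using lines[OF pq(1,3)] AB by blast
  qed
qed

lemma affine_space_expand:
  assumes "finite I" "p \<in> affine_space I"
  shows "p = (\<Sum>i\<in>I. fun_scale (p i) (\<lambda>j. if j = i then 1 else 0))"
proof
  fix j
  have "(\<Sum>i\<in>I. fun_scale (p i) (\<lambda>j. if j = i then 1 else 0)) j = (\<Sum>i\<in>I. if i = j then p i else 0)"
    unfolding sum_fun_eval by (intro sum.cong) (auto simp: fun_scale_def)
  also have "\<dots> = p j"
    using assms by (auto simp: affine_space_def)
  finally show "p j = (\<Sum>i\<in>I. fun_scale (p i) (\<lambda>j. if j = i then 1 else 0)) j" by simp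
qed

text \<open>Linear algebra supplies a functional that is 0 on \<open>H\<close> and 1 at
  \<open>v\<close>. It serves twice: to cut out translates of \<open>H\<close> by polynomials, and
  to find polynomials with nonzero differential in a direction outside \<open>H\<close>.\<close>

lemma separating_functional:
  assumes "finite I" "module.subspace fun_scale H" "H \<subseteq> affine_space I" "v \<in> affine_space I" "v \<notin> H"
  obtains l where "l \<in> polynomial_functions I" "\<And>h. h \<in> H \<Longrightarrow> l h = 0" "l v \<noteq> 0"
    "\<And>p q t. l (\<lambda>i. p i + t * q i) = l p + t * l q"
proof -
  interpret vector_space_pair "fun_scale :: complex \<Rightarrow> ('a \<Rightarrow> complex) \<Rightarrow> 'a \<Rightarrow> complex"
    "(*) :: complex \<Rightarrow> complex \<Rightarrow> complex"
    by (intro vector_space_pair.intro vector_space_fun_scale) (unfold_locales, auto simp: algebra_simps)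
  obtain B where B: "B \<subseteq> H" "vs1.independent B" "H \<subseteq> vs1.span B"
    using vs1.basis_exists[of H] by metis
  then have "vs1.span B = H" using vs1.span_subspace assms(2) by blast
  then have ind: "vs1.independent (insert v B)"
    using assms(5) B(2) by (intro vs1.independent_insertI) auto
  obtain g where g: "Vector_Spaces.linear fun_scale (*) g"
    "\<And>x. x \<in> insert v B \<Longrightarrow> g x = (if x = v then 1 else 0)"
    using linear_independent_extend[OF ind, of "\<lambda>x. if x = v then 1 else 0"] by blast
  interpret g: Vector_Spaces.linear fun_scale "(*)" g by (rule g(1))
  have gH: "g h = 0" if "h \<in> H" for h
  proof (rule linear_eq_0_on_span[OF g(1)])
    show "g x = 0" if "x \<in> B" for x
      using g(2)[of x] that B(1) assms(5) by auto
    show "h \<in> vs1.span B" using that B(3) by blast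
  qed
  define e where "e j = (\<lambda>i. if i = j then 1 else (0::complex))" for j :: 'a
  \<comment> \<open>\<open>g\<close> is an abstract linear map. On affine space it agrees with this
    combination of coordinates, which is visibly a polynomial function.\<close>
  define l where "l p = (\<Sum>i\<in>I. p i * g (e i))" for p
  have gl: "g p = l p" if "p \<in> affine_space I" for p
  proof -
    have "p = (\<Sum>i\<in>I. fun_scale (p i) (e i))"
      using affine_space_expand[OF assms(1) that] by (simp add: e_def)
    then have "g p = g (\<Sum>i\<in>I. fun_scale (p i) (e i))" by simp
    also have "\<dots> = l p"
      unfolding l_def g.sum by (simp add: g.scale)
    finally show ?thesis .
  qed
  show thesis
  proof (rule that[of l])
    show "l \<in> polynomial_functions I"
      unfolding l_def
      by (intro polynomial_functions_sum polynomial_functions.mult polynomial_functions.const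
          polynomial_functions.coord)
    show "l h = 0" if "h \<in> H" for h
      using gl gH assms(3) that by fastforce
    show "l v \<noteq> 0"
      using gl[OF assms(4)] g(2)[of v] by simp
    show "l (\<lambda>i. p i + t * q i) = l p + t * l q" for p q t
      by (simp add: l_def sum.distrib sum_distrib_left algebra_simps)
  qed
qed

text \<open>Taking for \<open>?F\<close> all polynomials that vanish on the translate leaves only
  one task: a point \<open>x\<close> outside is separated by the affine function
  \<open>l y - l p\<close>.\<close>

lemma closedin_zariski_translate:
  assumes "finite I" and H: "module.subspace fun_scale H" "H \<subseteq> affine_space I" and p: "p \<in> affine_space I"
  shows "closedin (zariski I) {x \<in> affine_space I. x - p \<in> H}"
proof -
  interpret vector_space "fun_scale :: complex \<Rightarrow> ('a \<Rightarrow> complex) \<Rightarrow> 'a \<Rightarrow> complex"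
    by (rule vector_space_fun_scale)
  let ?F = "{f \<in> polynomial_functions I. \<forall>x\<in>affine_space I. x - p \<in> H \<longrightarrow> f x = 0}"
  have "x - p \<in> H" if x: "x \<in> affine_space I" "\<forall>f\<in>?F. f x = 0" for x
  proof (rule ccontr)
    assume xp: "x - p \<notin> H"
    have "x - p \<in> affine_space I"
      using subspace_diff[OF subspace_affine_space] x p by blast
    obtain l where l: "l \<in> polynomial_functions I" "\<And>h. h \<in> H \<Longrightarrow> l h = 0" "l (x - p) \<noteq> 0"
      "\<And>p q t. l (\<lambda>i. p i + t * q i) = l p + t * l q"
      using separating_functional[OF assms(1) H \<open>x - p \<in> affine_space I\<close> xp] by blast
    have diff: "l (y - p) = l y - l p" for y
      using l(4)[of y "- 1" p] by (simp add: fun_diff_def)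
    have mem: "(\<lambda>y. l y + - l p) \<in> polynomial_functions I"
      by (intro polynomial_functions.add polynomial_functions.const l(1))
    have vanish: "l y + - l p = 0" if "y - p \<in> H" for y
      using l(2)[OF that] diff[of y] by simp
    have "(\<lambda>y. l y + - l p) \<in> ?F"
      using mem vanish by simp
    from x(2)[THEN bspec, OF this] have "l x + - l p = 0" .
    then show False using l(3) diff[of x] by simp
  qed
  then have "{x \<in> affine_space I. x - p \<in> H} = {x \<in> affine_space I. \<forall>f\<in>?F. f x = 0}"
    by blast
  then show ?thesis
    unfolding closedin_zariski_iff by (intro exI[of _ ?F]) auto
qed

lemma irreducible_zariski_translate:
  assumes H: "module.subspace fun_scale H" and p: "p \<in> affine_space I"
  shows "irreducible_space (subtopology (zariski I) {x \<in> affine_space I. x - p \<in> H})"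
proof (rule irreducible_zariski_if_lines)
  interpret vector_space "fun_scale :: complex \<Rightarrow> ('a \<Rightarrow> complex) \<Rightarrow> 'a \<Rightarrow> complex"
    by (rule vector_space_fun_scale)
  show "{x \<in> affine_space I. x - p \<in> H} \<noteq> {}"
    using subspace_0[OF H] p by (metis (mono_tags, lifting) diff_self empty_iff mem_Collect_eq)
  fix x y t assume x: "x \<in> {x \<in> affine_space I. x - p \<in> H}" and y: "y \<in> {x \<in> affine_space I. x - p \<in> H}"
  have eq: "(\<lambda>i. x i + t * (y i - x i)) = x + fun_scale t (y - x)"
    by (auto simp: fun_scale_def)
  have "x + fun_scale t (y - x) \<in> affine_space I"
    using x y by (intro subspace_add[OF subspace_affine_space] subspace_diff[OF subspace_affine_space]
        subspace_scale[OF subspace_affine_space]) auto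
  moreover have "x + fun_scale t (y - x) - p = (x - p) + fun_scale t ((y - p) - (x - p))"
    by simp
  moreover have "(x - p) + fun_scale t ((y - p) - (x - p)) \<in> H"
    using x y subspace_add[OF H _ subspace_scale[OF H subspace_diff[OF H]]] by blast
  ultimately show "(\<lambda>i. x i + t * (y i - x i)) \<in> {x \<in> affine_space I. x - p \<in> H}"
    unfolding eq by (metis (no_types, lifting) mem_Collect_eq)
qed auto

text \<open>A line through \<open>p\<close> with direction in \<open>H\<close> stays in
  \<open>H\<close>, so polynomials vanishing on \<open>H\<close> have derivative 0 along it. For
  \<open>v\<close> outside \<open>H\<close> the separating functional vanishes on \<open>H\<close>
  but has derivative \<open>l v \<noteq> 0\<close>.\<close>

lemma tangent_space_linear:
  assumes "finite I" and H: "module.subspace fun_scale H" "H \<subseteq> affine_space I" and p: "p \<in> H"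
  shows "tangent_space I H p = H"
proof -
  interpret vector_space "fun_scale :: complex \<Rightarrow> ('a \<Rightarrow> complex) \<Rightarrow> 'a \<Rightarrow> complex"
    by (rule vector_space_fun_scale)
  have "(\<lambda>i. p i + t * v i) \<in> H" if "v \<in> H" for v t
  proof -
    have "p + fun_scale t v \<in> H" using subspace_add[OF H(1) p subspace_scale[OF H(1) that]] .
    then show ?thesis by (simp add: plus_fun_def fun_scale_def)
  qed
  then have "v \<in> tangent_space I H p" if "v \<in> H" for v
    using that H(2) unfolding tangent_space_def by auto
  moreover have "v \<in> H" if v: "v \<in> tangent_space I H p" for v
  proof (rule ccontr)
    assume vH: "v \<notin> H"
    have "v \<in> affine_space I" using v unfolding tangent_space_def by blast
    obtain l where l: "l \<in> polynomial_functions I" "\<And>h. h \<in> H \<Longrightarrow> l h = 0" "l v \<noteq> 0"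
      "\<And>p q t. l (\<lambda>i. p i + t * q i) = l p + t * l q"
      using separating_functional[OF assms(1) H \<open>v \<in> affine_space I\<close> vH] by blast
    have "deriv (\<lambda>t. l (\<lambda>i. p i + t * v i)) 0 = 0"
      using v l(1,2) unfolding tangent_space_def by blast
    moreover have "((\<lambda>t. l (\<lambda>i. p i + t * v i)) has_field_derivative l v) (at 0)"
      unfolding l(4) by (auto intro!: derivative_eq_intros)
    then have "deriv (\<lambda>t. l (\<lambda>i. p i + t * v i)) 0 = l v"
      by (rule DERIV_imp_deriv)
    ultimately show False using l(3) by simp
  qed
  ultimately show ?thesis by blast
qed

lemma finitely_spanned_affine_space:
  assumes "finite I"
  shows "finitely_spanned fun_scale (affine_space I)"
proof -
  interpret vector_space "fun_scale :: complex \<Rightarrow> ('a \<Rightarrow> complex) \<Rightarrow> 'a \<Rightarrow> complex"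
    by (rule vector_space_fun_scale)
  let ?e = "\<lambda>j i. if i = j then 1 else (0::complex)"
  have "p \<in> span (?e ` I)" if p: "p \<in> affine_space I" for p
  proof -
    have "p = (\<Sum>i\<in>I. fun_scale (p i) (?e i))"
      by (rule affine_space_expand[OF assms p])
    moreover have "(\<Sum>i\<in>I. fun_scale (p i) (?e i)) \<in> span (?e ` I)"
      by (intro span_sum span_scale span_base) auto
    ultimately show ?thesis by simp
  qed
  then show ?thesis
    using assms by (intro finitely_spannedI[of "?e ` I"]) auto
qed

section \<open>The dimension of a linear subspace\<close>

definition monomial_function :: "'i set \<Rightarrow> ('i \<Rightarrow> nat) \<Rightarrow> ('i \<Rightarrow> complex) \<Rightarrow> complex" where
  "monomial_function J \<beta> = (\<lambda>p. \<Prod>j\<in>J. p j ^ \<beta> j)"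

text \<open>The degree is bounded in each variable separately: the exponents fill a box with
  \<open>(D + 1) ^ card J\<close> points, and bounds add up under multiplication.\<close>

definition bounded_degree_functions :: "'i set \<Rightarrow> nat \<Rightarrow> (('i \<Rightarrow> complex) \<Rightarrow> complex) set" where
  "bounded_degree_functions J D =
    module.span fun_scale (monomial_function J ` (J \<rightarrow>\<^sub>E {..D}))"

lemma bounded_degree_functions_mono:
  assumes "D \<le> D'"
  shows "bounded_degree_functions J D \<subseteq> bounded_degree_functions J D'"
proof -
  interpret vector_space "fun_scale :: complex \<Rightarrow> (('i \<Rightarrow> complex) \<Rightarrow> complex) \<Rightarrow> _"
    by (rule vector_space_fun_scale)
  show ?thesis
    unfolding bounded_degree_functions_def
    using assms by (intro span_mono image_mono PiE_mono) auto
qed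

lemma bounded_degree_functions_mult:
  assumes f: "f \<in> bounded_degree_functions J D" and g: "g \<in> bounded_degree_functions J D'"
  shows "(\<lambda>p. f p * g p) \<in> bounded_degree_functions J (D + D')"
proof -
  interpret vector_space "fun_scale :: complex \<Rightarrow> (('a \<Rightarrow> complex) \<Rightarrow> complex) \<Rightarrow> _"
    by (rule vector_space_fun_scale)
  let ?B = "bounded_degree_functions J (D + D')"
  have B: "subspace ?B" unfolding bounded_degree_functions_def by simp
  have mono: "(\<lambda>p. monomial_function J \<beta> p * monomial_function J \<gamma> p) \<in> ?B"
    if "\<beta> \<in> J \<rightarrow>\<^sub>E {..D}" "\<gamma> \<in> J \<rightarrow>\<^sub>E {..D'}" for \<beta> \<gamma>
  proof -
    have "(\<lambda>p. monomial_function J \<beta> p * monomial_function J \<gamma> p)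
        = monomial_function J (\<lambda>j\<in>J. \<beta> j + \<gamma> j)"
      by (auto simp: monomial_function_def power_add prod.distrib)
    moreover have "(\<lambda>j\<in>J. \<beta> j + \<gamma> j) \<in> J \<rightarrow>\<^sub>E {..D + D'}"
      using that by (auto simp: PiE_iff intro: add_mono)
    ultimately show ?thesis
      unfolding bounded_degree_functions_def by (intro span_base) auto
  qed
  have half: "(\<lambda>p. f p * monomial_function J \<gamma> p) \<in> ?B" if "\<gamma> \<in> J \<rightarrow>\<^sub>E {..D'}" for \<gamma>
    using f unfolding bounded_degree_functions_def[of J D]
  proof (induction rule: span_induct_alt)
    case base
    show ?case using subspace_0[OF B] by (simp add: zero_fun_def)
  next
    case (step c x y)
    then obtain \<beta> where "\<beta> \<in> J \<rightarrow>\<^sub>E {..D}" "x = monomial_function J \<beta>" by blast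
    then have "fun_scale c (\<lambda>p. x p * monomial_function J \<gamma> p) + (\<lambda>p. y p * monomial_function J \<gamma> p) \<in> ?B"
      using subspace_add[OF B subspace_scale[OF B mono[OF _ that]] step.IH] by simp
    then show ?case by (simp add: fun_scale_def plus_fun_def algebra_simps)
  qed
  show ?thesis
    using g unfolding bounded_degree_functions_def[of J D']
  proof (induction rule: span_induct_alt)
    case base
    show ?case using subspace_0[OF B] by (simp add: zero_fun_def)
  next
    case (step c x y)
    then obtain \<gamma> where "\<gamma> \<in> J \<rightarrow>\<^sub>E {..D'}" "x = monomial_function J \<gamma>" by blast
    then have "fun_scale c (\<lambda>p. f p * x p) + (\<lambda>p. f p * y p) \<in> ?B"
      using subspace_add[OF B subspace_scale[OF B half] step.IH] by simp
    then show ?case by (simp add: fun_scale_def plus_fun_def algebra_simps)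
  qed
qed

lemma bounded_degree_functions_const: "(\<lambda>p. c) \<in> bounded_degree_functions J D"
proof -
  interpret vector_space "fun_scale :: complex \<Rightarrow> (('a \<Rightarrow> complex) \<Rightarrow> complex) \<Rightarrow> _"
    by (rule vector_space_fun_scale)
  have "(\<lambda>p. c) = fun_scale c (monomial_function J (\<lambda>j\<in>J. 0))"
    by (auto simp: fun_scale_def monomial_function_def)
  moreover have "(\<lambda>j\<in>J. 0) \<in> J \<rightarrow>\<^sub>E {..D}" by auto
  ultimately show ?thesis
    unfolding bounded_degree_functions_def by (metis imageI span_base span_scale)
qed

lemma polynomial_function_bounded_degree:
  assumes "finite J" "f \<in> polynomial_functions J"
  shows "\<exists>D. f \<in> bounded_degree_functions J D"
  using assms(2)
proof induction
  case (const c)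
  show ?case using bounded_degree_functions_const by blast
next
  case (coord i)
  interpret vector_space "fun_scale :: complex \<Rightarrow> (('a \<Rightarrow> complex) \<Rightarrow> complex) \<Rightarrow> _"
    by (rule vector_space_fun_scale)
  have "(\<lambda>p. p i) = monomial_function J (\<lambda>j\<in>J. if j = i then 1 else 0)"
  proof
    fix p :: "'a \<Rightarrow> complex"
    have "monomial_function J (\<lambda>j\<in>J. if j = i then 1 else 0) p = (\<Prod>j\<in>J. if j = i then p j else 1)"
      unfolding monomial_function_def by (intro prod.cong) auto
    then show "p i = monomial_function J (\<lambda>j\<in>J. if j = i then 1 else 0) p"
      using assms(1) coord by (simp add: prod.delta)
  qed
  moreover have "(\<lambda>j\<in>J. if j = i then 1 else 0) \<in> J \<rightarrow>\<^sub>E {..1::nat}" by auto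
  ultimately show ?case
    unfolding bounded_degree_functions_def by (metis imageI span_base)
next
  case (add f g)
  interpret vector_space "fun_scale :: complex \<Rightarrow> (('a \<Rightarrow> complex) \<Rightarrow> complex) \<Rightarrow> _"
    by (rule vector_space_fun_scale)
  obtain D D' where "f \<in> bounded_degree_functions J D" "g \<in> bounded_degree_functions J D'"
    using add.IH by blast
  then have "f \<in> bounded_degree_functions J (max D D')" "g \<in> bounded_degree_functions J (max D D')"
    using bounded_degree_functions_mono[of D "max D D'" J]
      bounded_degree_functions_mono[of D' "max D D'" J] by auto
  then have "f + g \<in> bounded_degree_functions J (max D D')"
    unfolding bounded_degree_functions_def by (rule span_add)
  then show ?case by (auto simp: plus_fun_def)
next
  case (mult f g)
  then show ?case using bounded_degree_functions_mult by blast
qed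

lemma bounded_degree_functions_power:
  assumes "f \<in> bounded_degree_functions J D"
  shows "(\<lambda>p. f p ^ n) \<in> bounded_degree_functions J (n * D)"
proof (induction n)
  case 0
  show ?case using bounded_degree_functions_const[of 1] by simp
next
  case (Suc n)
  then show ?case using bounded_degree_functions_mult[OF assms Suc.IH] by simp
qed

lemma bounded_degree_functions_prod:
  assumes "finite A" "\<And>a. a \<in> A \<Longrightarrow> f a \<in> bounded_degree_functions J (D a)"
  shows "(\<lambda>p. \<Prod>a\<in>A. f a p) \<in> bounded_degree_functions J (\<Sum>a\<in>A. D a)"
  using assms
proof (induction A rule: finite_induct)
  case empty
  show ?case using bounded_degree_functions_const[of 1] by simp
next
  case (insert a A)
  then show ?case
    using bounded_degree_functions_mult[of "f a" J "D a" "\<lambda>p. \<Prod>a\<in>A. f a p" "\<Sum>a\<in>A. D a"] by simp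
qed

lemma dim_bounded_degree_functions:
  assumes "finite J"
  shows "vector_space.dim fun_scale (bounded_degree_functions J D) \<le> (D + 1) ^ card J"
    and "finitely_spanned fun_scale (bounded_degree_functions J D)"
proof -
  interpret vector_space "fun_scale :: complex \<Rightarrow> (('a \<Rightarrow> complex) \<Rightarrow> complex) \<Rightarrow> _"
    by (rule vector_space_fun_scale)
  have fin: "finite (J \<rightarrow>\<^sub>E {..D})" using assms by (intro finite_PiE) auto
  have "dim (bounded_degree_functions J D) \<le> card (monomial_function J ` (J \<rightarrow>\<^sub>E {..D}))"
    unfolding bounded_degree_functions_def using fin by (intro dim_le_card) auto
  also have "\<dots> \<le> card (J \<rightarrow>\<^sub>E {..D})" using fin by (rule card_image_le)
  also have "\<dots> = (D + 1) ^ card J" using assms by (simp add: card_PiE)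
  finally show "dim (bounded_degree_functions J D) \<le> (D + 1) ^ card J" .
  show "finitely_spanned fun_scale (bounded_degree_functions J D)"
    unfolding bounded_degree_functions_def using fin
    by (intro finitely_spannedI[of "monomial_function J ` (J \<rightarrow>\<^sub>E {..D})"]) auto
qed

text \<open>The monomials of degree at most \<open>M\<close> in each of the \<open>m\<close> polynomials number \<open>(M + 1) ^ m\<close> but
  lie in a space of dimension \<open>O(M ^ card J)\<close>.\<close>

lemma algebraically_dependent:
  fixes f :: "nat \<Rightarrow> ('i \<Rightarrow> complex) \<Rightarrow> complex"
  assumes "finite J" "card J < m" "\<And>i. i < m \<Longrightarrow> f i \<in> polynomial_functions J"
  obtains M c where "\<exists>\<alpha> \<in> {..<m} \<rightarrow>\<^sub>E {..M}. c \<alpha> \<noteq> 0"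
    "\<And>p. (\<Sum>\<alpha>\<in>{..<m} \<rightarrow>\<^sub>E {..M}. c \<alpha> * (\<Prod>i<m. f i p ^ \<alpha> i)) = (0::complex)"
proof -
  interpret vector_space "fun_scale :: complex \<Rightarrow> (('i \<Rightarrow> complex) \<Rightarrow> complex) \<Rightarrow> _"
    by (rule vector_space_fun_scale)
  have "\<forall>i. \<exists>d. i < m \<longrightarrow> f i \<in> bounded_degree_functions J d"
    using polynomial_function_bounded_degree[OF assms(1)] assms(3) by blast
  then obtain d where d: "\<And>i. i < m \<Longrightarrow> f i \<in> bounded_degree_functions J (d i)"
    by metis
  define D where "D = (\<Sum>i<m. d i)"
  define N where "N = card J"
  \<comment> \<open>The products below have degree at most \<open>M * D\<close> in each variable,
    and \<open>(M * D + 1) ^ N\<close> is at most \<open>(D + 1) ^ N * (M + 1) ^ N\<close>. This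
    choice turns the constant factor into \<open>M\<close>, which is less than \<open>M + 1\<close>,
    and the one additional function wins.\<close>
  define M where "M = (D + 1) ^ N"
  let ?E = "{..<m} \<rightarrow>\<^sub>E {..M}"
  let ?v = "\<lambda>\<alpha> p. \<Prod>i<m. f i p ^ \<alpha> i"
  have v: "?v \<alpha> \<in> bounded_degree_functions J (M * D)" if "\<alpha> \<in> ?E" for \<alpha>
  proof -
    have "?v \<alpha> \<in> bounded_degree_functions J (\<Sum>i<m. \<alpha> i * d i)"
      using d by (intro bounded_degree_functions_prod bounded_degree_functions_power) auto
    moreover have "(\<Sum>i<m. \<alpha> i * d i) \<le> M * D"
      unfolding D_def sum_distrib_left using that
      by (intro sum_mono mult_right_mono) (auto simp: PiE_iff)
    ultimately show ?thesis using bounded_degree_functions_mono by blast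
  qed
  have "M * D + 1 \<le> (D + 1) * (M + 1)" by simp
  then have "(M * D + 1) ^ N \<le> ((D + 1) * (M + 1)) ^ N" by (rule power_mono) simp
  also have "\<dots> = M * (M + 1) ^ N" by (simp only: power_mult_distrib M_def)
  also have "\<dots> < (M + 1) ^ Suc N" by simp
  also have "\<dots> \<le> (M + 1) ^ m" using assms(2) unfolding N_def by (intro power_increasing) auto
  also have "\<dots> = card ?E" by (simp add: card_PiE)
  finally have "dim (bounded_degree_functions J (M * D)) < card ?E"
    using dim_bounded_degree_functions(1)[OF assms(1), of "M * D"] unfolding N_def by linarith
  moreover have "finite ?E" by (intro finite_PiE) auto
  moreover have "?v ` ?E \<subseteq> bounded_degree_functions J (M * D)" using v by blast
  ultimately obtain c where c: "\<exists>\<alpha>\<in>?E. c \<alpha> \<noteq> 0" "(\<Sum>\<alpha>\<in>?E. fun_scale (c \<alpha>) (?v \<alpha>)) = 0"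
    using family_relation[OF _ _ dim_bounded_degree_functions(2)[OF assms(1)]] by blast
  have "(\<Sum>\<alpha>\<in>?E. c \<alpha> * ?v \<alpha> p) = 0" for p
    using fun_cong[OF c(2), of p] by (simp add: sum_fun_eval fun_scale_def)
  then show thesis using that c(1) by blast
qed

text \<open>Choosing \<open>f i\<close> in the ideal of \<open>Z i\<close> but not in that of \<open>Z (Suc i)\<close> along a chain of irreducible
  closed sets gives functions that are algebraically independent on the last member: in a relation
  divide by powers of the last function, which does not vanish on an irreducible set, and restrict
  to the previous member, where it does.\<close>

lemma chain_algebraically_independent:
  fixes Z :: "nat \<Rightarrow> ('i \<Rightarrow> complex) set" and f :: "nat \<Rightarrow> ('i \<Rightarrow> complex) \<Rightarrow> complex"
  assumes irr: "\<And>i. i \<le> m \<Longrightarrow> irreducible_space (subtopology (zariski I) (Z i))"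
    and sub: "\<And>i. i \<le> m \<Longrightarrow> Z i \<subseteq> affine_space I"
    and inc: "\<And>i. i < m \<Longrightarrow> Z i \<subseteq> Z (Suc i)"
    and poly: "\<And>i. i < m \<Longrightarrow> f i \<in> polynomial_functions I"
    and van: "\<And>i p. i < m \<Longrightarrow> p \<in> Z i \<Longrightarrow> f i p = 0"
    and nonvan: "\<And>i. i < m \<Longrightarrow> \<exists>p\<in>Z (Suc i). f i p \<noteq> 0"
    and "l \<le> m"
    and rel: "\<And>p. p \<in> Z l \<Longrightarrow> (\<Sum>\<alpha>\<in>{..<l} \<rightarrow>\<^sub>E {..M}. c \<alpha> * (\<Prod>i<l. f i p ^ \<alpha> i)) = 0"
    and "\<alpha> \<in> {..<l} \<rightarrow>\<^sub>E {..M}"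
  shows "c \<alpha> = 0"
  using \<open>l \<le> m\<close> rel \<open>\<alpha> \<in> {..<l} \<rightarrow>\<^sub>E {..M}\<close>
proof (induction l arbitrary: c \<alpha>)
  case 0
  \<comment> \<open>With no functions there is a single exponent and the product is empty, so the
    relation at any point of the nonempty \<open>Z 0\<close> reads
    \<open>c \<alpha> = 0\<close>.\<close>
  have "topspace (subtopology (zariski I) (Z 0)) \<noteq> {}"
    using irr[of 0] unfolding irreducible_space_def by blast
  then obtain p where "p \<in> Z 0" by auto
  then show ?case using "0.prems"(2)[of p] "0.prems"(3) by simp
next
  case (Suc l)
  have l: "l < m" using Suc.prems(1) by simp
  let ?E = "{..<l} \<rightarrow>\<^sub>E {..M}"
  \<comment> \<open>The relation is read as a polynomial in the last function \<open>f l\<close>;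
    \<open>P j\<close> is the coefficient of its \<open>j\<close>-th power.\<close>
  define P where "P j p = (\<Sum>\<beta>\<in>?E. c (\<beta>(l := j)) * (\<Prod>i<l. f i p ^ \<beta> i))" for j p
  have P_poly: "P j \<in> polynomial_functions I" for j
    unfolding P_def using poly l
    by (intro polynomial_functions_sum polynomial_functions_cmult polynomial_functions_prod
        polynomial_functions_power) auto
  have relP: "(\<Sum>j\<le>M. P j p * f l p ^ j) = 0" if p: "p \<in> Z (Suc l)" for p
  proof -
    have inj: "inj_on (\<lambda>(y, g). g(l := y)) ({..M} \<times> ?E)"
      by (rule inj_combinator) simp
    have "0 = (\<Sum>\<alpha>\<in>{..<Suc l} \<rightarrow>\<^sub>E {..M}. c \<alpha> * (\<Prod>i<Suc l. f i p ^ \<alpha> i))"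
      using Suc.prems(2)[OF p] by simp
    also have "\<dots> = (\<Sum>(j, \<beta>)\<in>{..M} \<times> ?E. c (\<beta>(l := j)) * (\<Prod>i<Suc l. f i p ^ (\<beta>(l := j)) i))"
      unfolding lessThan_Suc PiE_insert_eq using inj
      by (subst sum.reindex) (auto simp: case_prod_unfold comp_def intro!: sum.cong)
    also have "\<dots> = (\<Sum>(j, \<beta>)\<in>{..M} \<times> ?E. c (\<beta>(l := j)) * (\<Prod>i<l. f i p ^ \<beta> i) * f l p ^ j)"
      by (intro sum.cong) (auto simp: algebra_simps)
    also have "\<dots> = (\<Sum>j\<le>M. \<Sum>\<beta>\<in>?E. c (\<beta>(l := j)) * (\<Prod>i<l. f i p ^ \<beta> i) * f l p ^ j)"
      by (simp add: sum.cartesian_product)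
    also have "\<dots> = (\<Sum>j\<le>M. P j p * f l p ^ j)"
      unfolding P_def by (simp add: sum_distrib_right)
    finally show ?thesis by simp
  qed
  have coeff: "\<forall>\<beta>\<in>?E. c (\<beta>(l := j)) = 0" if "j \<le> M" for j
    using that
  proof (induction j rule: less_induct)
    case (less j)
    \<comment> \<open>Once the coefficients below \<open>j\<close> are known to vanish, the relation
      is \<open>f l p ^ j * Q p = 0\<close>.\<close>
    define Q where "Q p = (\<Sum>k\<in>{j..M}. P k p * f l p ^ (k - j))" for p
    have Q_poly: "Q \<in> polynomial_functions I"
      unfolding Q_def using poly[OF l]
      by (intro polynomial_functions_sum polynomial_functions.mult polynomial_functions_power P_poly)
    have zero: "f l p ^ j * Q p = 0" if p: "p \<in> Z (Suc l)" for p
    proof -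
      have "P k p = 0" if k: "k < j" for k
      proof -
        have "c (\<beta>(l := k)) = 0" if "\<beta> \<in> ?E" for \<beta>
          using less.IH[OF k] k less.prems that by (meson less_imp_le order_trans)
        then show ?thesis
          unfolding P_def by (intro sum.neutral ballI) (simp only: mult_zero_left)
      qed
      then have "(\<Sum>k\<le>M. P k p * f l p ^ k) = (\<Sum>k\<in>{j..M}. P k p * f l p ^ k)"
        by (intro sum.mono_neutral_right) auto
      also have "\<dots> = f l p ^ j * Q p"
        unfolding Q_def sum_distrib_left
        by (intro sum.cong) (auto simp: power_add[symmetric])
      finally show ?thesis using relP[OF p] by simp
    qed
    \<comment> \<open>Two closed sets cover the irreducible \<open>Z (Suc l)\<close>, and
      \<open>nonvan\<close> excludes the one where \<open>f l\<close> vanishes.\<close>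
    have "Z (Suc l) \<subseteq> {p \<in> affine_space I. f l p = 0} \<union> {p \<in> affine_space I. Q p = 0}"
      using zero sub[of "Suc l"] Suc.prems(1) by auto
    moreover have "closedin (zariski I) {p \<in> affine_space I. f l p = 0}"
      "closedin (zariski I) {p \<in> affine_space I. Q p = 0}"
      using closedin_zariski_zero_set poly[OF l] Q_poly by blast+
    moreover have "Z (Suc l) \<subseteq> topspace (zariski I)" using sub[of "Suc l"] Suc.prems(1) by simp
    ultimately have "Z (Suc l) \<subseteq> {p \<in> affine_space I. f l p = 0} \<or>
        Z (Suc l) \<subseteq> {p \<in> affine_space I. Q p = 0}"
      using irr[of "Suc l"] Suc.prems(1) irreducible_subtopology_iff by blast
    then have Q0: "Q p = 0" if "p \<in> Z (Suc l)" for p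
      using nonvan[OF l] that by blast
    have "P j p = 0" if p: "p \<in> Z l" for p
    proof -
      \<comment> \<open>On \<open>Z l\<close> the function \<open>f l\<close> is 0, and only the
        term with exponent \<open>k - j = 0\<close> survives. What remains is a relation among the
        first \<open>l\<close> functions.\<close>
      have "Q p = (\<Sum>k\<in>{j..M}. if k = j then P k p else 0)"
        unfolding Q_def using van[OF l p] by (intro sum.cong) auto
      also have "\<dots> = P j p" using less.prems by simp
      finally show ?thesis using Q0 inc[OF l] p by auto
    qed
    then have "(\<Sum>\<beta>\<in>?E. c (\<beta>(l := j)) * (\<Prod>i<l. f i p ^ \<beta> i)) = 0" if "p \<in> Z l" for p
      using that unfolding P_def by blast
    then show ?case
      using Suc.IH[of "\<lambda>\<beta>. c (\<beta>(l := j))"] less_imp_le[OF l] by blast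
  qed
  have "\<alpha> l \<le> M" "restrict \<alpha> {..<l} \<in> ?E"
    using Suc.prems(3) by (auto simp: PiE_iff)
  moreover have "\<alpha> = (restrict \<alpha> {..<l})(l := \<alpha> l)"
    using Suc.prems(3) by (auto simp: PiE_iff extensional_def fun_eq_iff)
  ultimately show ?case using coeff by metis
qed

text \<open>Functions separating consecutive members of a chain of length \<open>m\<close> are
  independent on the last member. Pulled back to a parametrisation of \<open>H\<close> by
  \<open>dim H\<close> variables they would be dependent if \<open>m\<close> exceeded
  \<open>dim H\<close>.\<close>

lemma krull_dim_linear_le:
  assumes I: "finite I" and H: "module.subspace fun_scale H" "H \<subseteq> affine_space I"
  shows "krull_dim (subtopology (zariski I) H) \<le> enat (vector_space.dim fun_scale H)"
proof (rule krull_dim_leI)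
  interpret vector_space "fun_scale :: complex \<Rightarrow> ('a \<Rightarrow> complex) \<Rightarrow> _"
    by (rule vector_space_fun_scale)
  fix m Z assume chain: "irreducible_chain (subtopology (zariski I) H) m Z"
  obtain B where B: "B \<subseteq> H" "independent B" "finite B" "H \<subseteq> span B" "card B = dim H"
    using finitely_spanned_basis[OF finitely_spanned_mono[OF finitely_spanned_affine_space[OF I] H(2)]] .
  \<comment> \<open>The basis vectors themselves index the parameters, so \<open>H\<close> becomes
    the image of a polynomial map in \<open>card B\<close> variables.\<close>
  define \<psi> where "\<psi> t = (\<Sum>b\<in>B. fun_scale (t b) b)" for t :: "('a \<Rightarrow> complex) \<Rightarrow> complex"
  have \<psi>_poly: "(\<lambda>t. \<psi> t i) \<in> polynomial_functions B" for i
    unfolding \<psi>_def sum_fun_eval fun_scale_def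
    by (intro polynomial_functions_sum polynomial_functions.mult polynomial_functions.const
        polynomial_functions.coord)
  have \<psi>_onto: "\<exists>t. \<psi> t = x" if "x \<in> H" for x
  proof -
    have "x \<in> range (\<lambda>t. \<Sum>b\<in>B. fun_scale (t b) b)"
      using that B(4) unfolding span_finite[OF B(3)] by blast
    then obtain t where "x = (\<Sum>b\<in>B. fun_scale (t b) b)" ..
    then show ?thesis unfolding \<psi>_def by (intro exI[of _ t]) simp
  qed
  have ZH: "Z i \<subseteq> H" "Z i \<subseteq> affine_space I" if "i \<le> m" for i
    using irreducible_chainD(3)[OF chain that] by auto
  have irr: "irreducible_space (subtopology (zariski I) (Z i))" if "i \<le> m" for i
    using irreducible_chainD(2)[OF chain that] ZH(1)[OF that]
    by (simp add: subtopology_subtopology Int_absorb1)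
  have "\<exists>f\<in>polynomial_functions I. (\<forall>p\<in>Z i. f p = 0) \<and> (\<exists>p\<in>Z (Suc i). f p \<noteq> 0)" if i: "i < m" for i
  proof -
    obtain C where C: "closedin (zariski I) C" "Z i = C \<inter> H"
      using irreducible_chainD(1)[OF chain] i unfolding closedin_subtopology by (metis less_imp_le)
    obtain F where F: "F \<subseteq> polynomial_functions I" "C = {p \<in> affine_space I. \<forall>f\<in>F. f p = 0}"
      using C(1) unfolding closedin_zariski_iff by blast
    have "Z i \<subset> Z (Suc i)" using chain i unfolding irreducible_chain_def by blast
    then obtain q where q: "q \<in> Z (Suc i)" "q \<notin> Z i" by blast
    then have "q \<in> H" "q \<in> affine_space I" using ZH[of "Suc i"] i by auto
    then obtain f where "f \<in> F" "f q \<noteq> 0" using q(2) C(2) F(2) by blast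
    moreover have "\<forall>p\<in>Z i. f p = 0" using \<open>f \<in> F\<close> C(2) F(2) by blast
    ultimately show ?thesis using F(1) q(1) by blast
  qed
  then obtain f where f: "\<And>i. i < m \<Longrightarrow> f i \<in> polynomial_functions I"
    "\<And>i p. i < m \<Longrightarrow> p \<in> Z i \<Longrightarrow> f i p = 0" "\<And>i. i < m \<Longrightarrow> \<exists>p\<in>Z (Suc i). f i p \<noteq> 0"
    by metis
  have "m \<le> card B"
  proof (rule ccontr)
    assume "\<not> m \<le> card B"
    then have "card B < m" by simp
    moreover have "(\<lambda>t. f i (\<psi> t)) \<in> polynomial_functions B" if "i < m" for i
      by (rule polynomial_functions_compose[OF f(1)[OF that]]) (rule \<psi>_poly)
    ultimately obtain M c where c: "\<exists>\<alpha> \<in> {..<m} \<rightarrow>\<^sub>E {..M}. c \<alpha> \<noteq> 0"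
      "\<And>t. (\<Sum>\<alpha>\<in>{..<m} \<rightarrow>\<^sub>E {..M}. c \<alpha> * (\<Prod>i<m. f i (\<psi> t) ^ \<alpha> i)) = 0"
      using algebraically_dependent[OF B(3), of m "\<lambda>i t. f i (\<psi> t)"] by blast
    have rel: "(\<Sum>\<alpha>\<in>{..<m} \<rightarrow>\<^sub>E {..M}. c \<alpha> * (\<Prod>i<m. f i p ^ \<alpha> i)) = 0" if "p \<in> Z m" for p
    proof -
      obtain t where "\<psi> t = p" using \<psi>_onto ZH(1)[of m] \<open>p \<in> Z m\<close> by blast
      then show ?thesis using c(2)[of t] by simp
    qed
    have inc: "Z i \<subseteq> Z (Suc i)" if "i < m" for i
      using irreducible_chain_mono[OF chain, of i "Suc i"] that by simp
    have "c \<alpha> = 0" if "\<alpha> \<in> {..<m} \<rightarrow>\<^sub>E {..M}" for \<alpha>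
      using chain_algebraically_independent[OF irr ZH(2) inc f order_refl rel that] .
    then show False using c(1) by blast
  qed
  then show "enat m \<le> enat (dim H)" using B(5) by simp
qed

text \<open>The chain consists of the translates to \<open>p\<close> of the spans of the first
  \<open>j\<close> basis vectors. It starts with the point \<open>p\<close> of \<open>U\<close>, so
  it survives restriction to \<open>U\<close> at full length, however small \<open>U\<close>
  is.\<close>

lemma krull_dim_linear_open_ge:
  assumes I: "finite I" and H: "module.subspace fun_scale H" "H \<subseteq> affine_space I"
    and U: "openin (subtopology (zariski I) H) U" "p \<in> U"
  shows "enat (vector_space.dim fun_scale H)
    \<le> krull_dim (subtopology (subtopology (zariski I) H) U)"
proof -
  interpret vector_space "fun_scale :: complex \<Rightarrow> ('a \<Rightarrow> complex) \<Rightarrow> _"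
    by (rule vector_space_fun_scale)
  have p: "p \<in> H" "p \<in> affine_space I" using openin_subset[OF U(1)] U(2) by auto
  obtain B where B: "B \<subseteq> H" "independent B" "finite B" "H \<subseteq> span B" "card B = dim H"
    using finitely_spanned_basis[OF finitely_spanned_mono[OF finitely_spanned_affine_space[OF I] H(2)]] .
  obtain h where h: "bij_betw h {..<dim H} B"
    using ex_bij_betw_nat_finite[OF B(3)] B(5) by (auto simp: atLeast0LessThan)
  define S where "S j = span (h ` {..<j})" for j
  have hB: "h i \<in> B" if "i < dim H" for i using h that by (auto simp: bij_betw_def)
  have S_sub: "S j \<subseteq> H" if "j \<le> dim H" for j
    unfolding S_def using hB B(1) that by (intro span_minimal H(1)) auto
  have S: "subspace (S j)" for j unfolding S_def by simp
  define Z where "Z j = {x \<in> affine_space I. x - p \<in> S j}" for j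
  have ZH: "Z j \<subseteq> H" if "j \<le> dim H" for j
  proof
    fix x assume "x \<in> Z j"
    then have "x - p \<in> H" using S_sub[OF that] unfolding Z_def by blast
    then have "(x - p) + p \<in> H" using subspace_add[OF H(1) _ p(1)] by blast
    then show "x \<in> H" by simp
  qed
  have chain: "irreducible_chain (subtopology (zariski I) H) (dim H) Z"
    unfolding irreducible_chain_def
  proof (intro conjI allI impI)
    fix j assume j: "j \<le> dim H"
    have "S j \<subseteq> affine_space I" using S_sub[OF j] H(2) by blast
    then have "closedin (zariski I) (Z j)"
      unfolding Z_def by (intro closedin_zariski_translate I S p(2))
    then show "closedin (subtopology (zariski I) H) (Z j)"
      using ZH[OF j] by (intro closedin_subset_topspace) auto
    show "irreducible_space (subtopology (subtopology (zariski I) H) (Z j))"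
      using irreducible_zariski_translate[OF S p(2), of j] ZH[OF j]
      by (simp add: subtopology_subtopology Int_absorb1 Z_def)
  next
    fix j assume j: "j < dim H"
    have "S j \<subseteq> S (Suc j)" unfolding S_def by (intro span_mono) auto
    then have "Z j \<subseteq> Z (Suc j)" unfolding Z_def by blast
    moreover have "p + h j \<in> Z (Suc j)"
    proof -
      have "h j \<in> S (Suc j)" unfolding S_def by (intro span_base) auto
      moreover have "p + h j \<in> affine_space I"
        using subspace_add[OF H(1) p(1)] hB[OF j] B(1) H(2) by blast
      ultimately show ?thesis unfolding Z_def by simp
    qed
    moreover have "p + h j \<notin> Z j"
    proof
      assume "p + h j \<in> Z j"
      then have "h j \<in> span (h ` {..<j})" unfolding Z_def S_def by simp
      moreover have "h ` {..<j} \<subseteq> B - {h j}"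
        using h j hB by (auto simp: bij_betw_def dest!: inj_onD)
      ultimately have "h j \<in> span (B - {h j})" using span_mono by blast
      then show False using B(2) hB[OF j] unfolding dependent_def by blast
    qed
    ultimately show "Z j \<subset> Z (Suc j)" by blast
  qed
  have "p \<in> Z 0" using p subspace_0[OF S] unfolding Z_def by simp
  then have "Z 0 \<inter> U \<noteq> {}" using U(2) by blast
  then show ?thesis
    using krull_dim_geI[OF irreducible_chain_restrict[OF chain U(1)]] by blast
qed

lemma krull_dim_linear:
  assumes "finite I" "module.subspace fun_scale H" "H \<subseteq> affine_space I"
  shows "krull_dim (subtopology (zariski I) H) = enat (vector_space.dim fun_scale H)"
proof -
  interpret vector_space "fun_scale :: complex \<Rightarrow> ('a \<Rightarrow> complex) \<Rightarrow> _"
    by (rule vector_space_fun_scale)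
  have "openin (subtopology (zariski I) H) H"
    using openin_topspace[of "subtopology (zariski I) H"] assms(3) by (simp add: Int_absorb1)
  from krull_dim_linear_open_ge[OF assms this subspace_0[OF assms(2)]]
  show ?thesis
    using krull_dim_linear_le[OF assms] by (simp add: subtopology_subtopology)
qed

text \<open>\<open>local_dim\<close> is an infimum over neighbourhoods: \<open>H\<close> itself
  gives the upper bound, and every neighbourhood of \<open>p\<close> contains a chain of length
  \<open>dim H\<close>.\<close>

lemma nonsingular_linear:
  assumes "finite I" "module.subspace fun_scale H" "H \<subseteq> affine_space I" "p \<in> H"
  shows "nonsingular_at I H p"
proof -
  have "openin (subtopology (zariski I) H) H"
    using openin_topspace[of "subtopology (zariski I) H"] assms(3) by (simp add: Int_absorb1)
  then have "local_dim (subtopology (zariski I) H) p \<le> enat (vector_space.dim fun_scale H)"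
    unfolding local_dim_def using krull_dim_linear[OF assms(1-3)] assms(4)
    by (intro INF_lower2[of H]) (auto simp: subtopology_subtopology)
  moreover have "enat (vector_space.dim fun_scale H) \<le> local_dim (subtopology (zariski I) H) p"
    unfolding local_dim_def
    by (intro INF_greatest) (use krull_dim_linear_open_ge[OF assms(1-3)] in auto)
  ultimately show ?thesis
    unfolding nonsingular_at_def tangent_space_linear[OF assms] by simp
qed

section \<open>Charts of the Grassmannian\<close>

lemma det_polynomial_function:
  assumes "\<And>i j. i < m \<Longrightarrow> j < m \<Longrightarrow> (\<lambda>c. E c i j) \<in> polynomial_functions I"
  shows "(\<lambda>c. Determinant.det (Matrix.mat m m (\<lambda>(i, j). E c i j))) \<in> polynomial_functions I"
proof -
  have perm: "p i < m" if "p permutes {0..<m}" "i < m" for p i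
    using permutes_in_image[OF that(1), of i] that(2) by simp
  have "(\<lambda>c. \<Sum>p\<in>{p. p permutes {0..<m}}. signof p * (\<Prod>i\<in>{0..<m}. E c i (p i)))
      \<in> polynomial_functions I"
    by (intro polynomial_functions_sum polynomial_functions_cmult polynomial_functions_prod assms)
      (auto intro: perm)
  moreover have "Determinant.det (Matrix.mat m m (\<lambda>(i, j). E c i j))
      = (\<Sum>p\<in>{p. p permutes {0..<m}}. signof p * (\<Prod>i\<in>{0..<m}. E c i (p i)))" for c
    unfolding Determinant.det_def by (auto simp: perm intro!: sum.cong prod.cong)
  ultimately show ?thesis by simp
qed

lemma adj_mat_polynomial_function:
  assumes "\<And>i j. i < m \<Longrightarrow> j < m \<Longrightarrow> (\<lambda>c. E c i j) \<in> polynomial_functions I"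
    and "i < m" "j < m"
  shows "(\<lambda>c. adj_mat (Matrix.mat m m (\<lambda>(i, j). E c i j)) $$ (i, j)) \<in> polynomial_functions I"
proof -
  \<comment> \<open>The index shift that skips the deleted row or column; the adjugate is
    transposed, hence row \<open>j\<close> and column \<open>i\<close>.\<close>
  let ?k = "\<lambda>i i'. if i' < i then i' else Suc i'"
  have "adj_mat (Matrix.mat m m (\<lambda>(i, j). E c i j)) $$ (i, j)
      = (- 1) ^ (j + i) * Determinant.det (Matrix.mat (m - 1) (m - 1)
          (\<lambda>(i', j'). E c (?k j i') (?k i j')))" for c
  proof -
    have "mat_delete (Matrix.mat m m (\<lambda>(i, j). E c i j)) j i
        = Matrix.mat (m - 1) (m - 1) (\<lambda>(i', j'). E c (?k j i') (?k i j'))"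
      unfolding mat_delete_def by (rule eq_matI) auto
    then show ?thesis using assms(2,3) by (simp add: adj_mat_def cofactor_def)
  qed
  moreover have "(\<lambda>c. (- 1) ^ (j + i) * Determinant.det (Matrix.mat (m - 1) (m - 1)
          (\<lambda>(i', j'). E c (?k j i') (?k i j')))) \<in> polynomial_functions I"
    by (intro polynomial_functions_cmult det_polynomial_function assms(1)) auto
  ultimately show ?thesis by simp
qed

text \<open>Transition maps have coordinates \<open>p j c / q c\<close>. Multiplying a pulled back
  polynomial by a power of \<open>q\<close> makes it polynomial without changing its zeros where
  \<open>q\<close> is nonzero.\<close>

lemma clear_denominators:
  assumes "g \<in> polynomial_functions J" "\<And>j. j \<in> J \<Longrightarrow> p j \<in> polynomial_functions I"
    and "q \<in> polynomial_functions I"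
  obtains h k where "h \<in> polynomial_functions I"
    "\<And>c. q c \<noteq> 0 \<Longrightarrow> h c = q c ^ k * g (\<lambda>j. p j c / q c)"
proof -
  from assms(1) have "\<exists>h k. h \<in> polynomial_functions I \<and>
    (\<forall>c. q c \<noteq> 0 \<longrightarrow> h c = q c ^ k * g (\<lambda>j. p j c / q c))"
  proof induction
    case (const a)
    show ?case
      by (rule exI[of _ "\<lambda>c. a"], rule exI[of _ 0]) (simp add: polynomial_functions.const)
  next
    case (coord j)
    show ?case
      by (rule exI[of _ "p j"], rule exI[of _ 1]) (simp add: assms(2) coord)
  next
    case (add f g)
    then obtain h k h' k' where h: "h \<in> polynomial_functions I" "h' \<in> polynomial_functions I"
      "\<And>c. q c \<noteq> 0 \<Longrightarrow> h c = q c ^ k * f (\<lambda>j. p j c / q c)"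
      "\<And>c. q c \<noteq> 0 \<Longrightarrow> h' c = q c ^ k' * g (\<lambda>j. p j c / q c)"
      by metis
    show ?case
    proof (intro exI conjI allI impI)
      show "(\<lambda>c. q c ^ k' * h c + q c ^ k * h' c) \<in> polynomial_functions I"
        by (intro polynomial_functions.add polynomial_functions.mult polynomial_functions_power
            assms(3) h(1,2))
      show "q c ^ k' * h c + q c ^ k * h' c
          = q c ^ (k + k') * (f (\<lambda>j. p j c / q c) + g (\<lambda>j. p j c / q c))" if "q c \<noteq> 0" for c
        using h(3,4)[OF that] by (simp add: power_add algebra_simps)
    qed
  next
    case (mult f g)
    then obtain h k h' k' where h: "h \<in> polynomial_functions I" "h' \<in> polynomial_functions I"
      "\<And>c. q c \<noteq> 0 \<Longrightarrow> h c = q c ^ k * f (\<lambda>j. p j c / q c)"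
      "\<And>c. q c \<noteq> 0 \<Longrightarrow> h' c = q c ^ k' * g (\<lambda>j. p j c / q c)"
      by metis
    show ?case
    proof (intro exI conjI allI impI)
      show "(\<lambda>c. h c * h' c) \<in> polynomial_functions I"
        by (intro polynomial_functions.mult h(1,2))
      show "h c * h' c = q c ^ (k + k') * (f (\<lambda>j. p j c / q c) * g (\<lambda>j. p j c / q c))"
        if "q c \<noteq> 0" for c
        using h(3,4)[OF that] by (simp add: power_add algebra_simps)
    qed
  qed
  then show thesis using that by blast
qed

text \<open>The coefficients belong to the indices and not to the set of vectors, so repeated
  members do no harm.\<close>

lemma (in vector_space) span_family:
  assumes "finite K"
  shows "span (v ` K) = range (\<lambda>u. \<Sum>k\<in>K. scale (u k) (v k))"
proof (rule span_unique)
  show "v ` K \<subseteq> range (\<lambda>u. \<Sum>k\<in>K. scale (u k) (v k))"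
  proof
    fix x assume "x \<in> v ` K"
    then obtain k where k: "k \<in> K" "x = v k" by blast
    have "x = (\<Sum>l\<in>K. if l = k then v l else 0)" using k assms by simp
    also have "\<dots> = (\<Sum>l\<in>K. scale (if l = k then 1 else 0) (v l))"
      by (intro sum.cong) auto
    finally show "x \<in> range (\<lambda>u. \<Sum>k\<in>K. scale (u k) (v k))" by (rule range_eqI[of _ _ "\<lambda>l. if l = k then 1 else 0"])
  qed
  show "subspace (range (\<lambda>u. \<Sum>k\<in>K. scale (u k) (v k)))"
  proof (rule subspaceI)
    show "0 \<in> range (\<lambda>u. \<Sum>k\<in>K. scale (u k) (v k))"
      by (rule range_eqI[of _ _ "\<lambda>k. 0"]) simp
    show "x + y \<in> range (\<lambda>u. \<Sum>k\<in>K. scale (u k) (v k))"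
      if xy: "x \<in> range (\<lambda>u. \<Sum>k\<in>K. scale (u k) (v k))" "y \<in> range (\<lambda>u. \<Sum>k\<in>K. scale (u k) (v k))"
      for x y
    proof -
      obtain u w where "x = (\<Sum>k\<in>K. scale (u k) (v k))" "y = (\<Sum>k\<in>K. scale (w k) (v k))"
        using xy by blast
      then show ?thesis
        by (intro range_eqI[of _ _ "\<lambda>k. u k + w k"]) (simp add: scale_left_distrib sum.distrib)
    qed
    show "scale c x \<in> range (\<lambda>u. \<Sum>k\<in>K. scale (u k) (v k))"
      if x: "x \<in> range (\<lambda>u. \<Sum>k\<in>K. scale (u k) (v k))" for c x
    proof -
      obtain u where "x = (\<Sum>k\<in>K. scale (u k) (v k))" using x by blast
      then show ?thesis
        by (intro range_eqI[of _ _ "\<lambda>k. c * u k"]) (simp add: scale_sum_right)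
    qed
  qed
  show "range (\<lambda>u. \<Sum>k\<in>K. scale (u k) (v k)) \<subseteq> T" if "v ` K \<subseteq> T" "subspace T" for T
    using that by (auto intro!: subspace_sum subspace_scale)
qed

section \<open>Matrices of coefficients and uniqueness of chart coordinates\<close>

definition basis_comb ::
  "(complex \<Rightarrow> 'v \<Rightarrow> 'v) \<Rightarrow> nat \<Rightarrow> (nat \<Rightarrow> 'v::ab_group_add) \<Rightarrow> (nat \<Rightarrow> complex) \<Rightarrow> 'v" where
  "basis_comb s n b u = (\<Sum>f<n. s (u f) (b f))"

text \<open>The coefficients of the generators of \<open>gr_chart\<close>: the identity matrix followed by \<open>c\<close>.\<close>

definition chart_row :: "nat \<Rightarrow> (nat \<times> nat \<Rightarrow> complex) \<Rightarrow> nat \<Rightarrow> nat \<Rightarrow> complex" where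
  "chart_row d c i f = (if f < d then (if f = i then 1 else 0) else c (i, f))"

locale grassmannian_setting = vector_space s
  for s :: "complex \<Rightarrow> 'v \<Rightarrow> 'v::ab_group_add" +
  fixes V :: "'v set" and d n :: nat
  assumes subspace_V: "subspace V"
    and n_def: "n = dim V"
    and d_le: "d \<le> n"
begin

lemma comb_sum: "(\<Sum>k\<in>K. s (w k) (basis_comb s n b (A k))) = basis_comb s n b (\<lambda>f. \<Sum>k\<in>K. w k * A k f)"
proof -
  have "(\<Sum>k\<in>K. s (w k) (basis_comb s n b (A k))) = (\<Sum>k\<in>K. \<Sum>f<n. s (w k * A k f) (b f))"
    unfolding basis_comb_def by (simp add: scale_sum_right)
  also have "\<dots> = (\<Sum>f<n. \<Sum>k\<in>K. s (w k * A k f) (b f))" by (rule sum.swap)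
  finally show ?thesis unfolding basis_comb_def by (simp add: scale_sum_left)
qed

lemma comb_cong: "(\<And>f. f < n \<Longrightarrow> u f = w f) \<Longrightarrow> basis_comb s n b u = basis_comb s n b w"
  unfolding basis_comb_def by (intro sum.cong) auto

lemma comb_in_V:
  assumes "ordered_basis s V b"
  shows "basis_comb s n b u \<in> V"
proof -
  have "span (b ` {..<n}) = V" using assms unfolding ordered_basis_def n_def by blast
  moreover have "basis_comb s n b u \<in> span (b ` {..<n})"
    unfolding basis_comb_def by (intro span_sum span_scale span_base) auto
  ultimately show ?thesis by simp
qed

lemma comb_exists:
  assumes "ordered_basis s V b" "x \<in> V"
  obtains u where "x = basis_comb s n b u"
proof -
  have "x \<in> span (b ` {..<n})" using assms unfolding ordered_basis_def n_def by blast
  then show thesis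
    using that unfolding span_family[OF finite_lessThan] basis_comb_def by blast
qed

lemma comb_unique:
  assumes "ordered_basis s V b" "basis_comb s n b u = basis_comb s n b w" "f < n"
  shows "u f = w f"
proof -
  have inj: "inj_on b {..<n}" and ind: "independent (b ` {..<n})"
    using assms(1) unfolding ordered_basis_def n_def by auto
  have "(\<Sum>f<n. s (u f - w f) (b f)) = 0"
    using assms(2) unfolding basis_comb_def by (simp add: scale_left_diff_distrib sum_subtractf)
  moreover have "(\<Sum>x\<in>b ` {..<n}. s ((\<lambda>x. u (inv_into {..<n} b x) - w (inv_into {..<n} b x)) x) x)
      = (\<Sum>f<n. s (u f - w f) (b f))"
    using inj by (subst sum.reindex) (auto intro!: sum.cong)
  ultimately have "(\<lambda>x. u (inv_into {..<n} b x) - w (inv_into {..<n} b x)) (b f) = 0"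
    using assms(3) by (intro independentD[OF ind finite_imageI[OF finite_lessThan] order_refl]) auto
  then show ?thesis using inj assms(3) by simp
qed

lemma gr_chart_eq: "gr_chart s V d b c = span ((\<lambda>i. basis_comb s n b (chart_row d c i)) ` {..<d})"
proof -
  have "b i + (\<Sum>j\<in>{d..<n}. s (c (i, j)) (b j)) = basis_comb s n b (chart_row d c i)" if "i < d" for i
  proof -
    have "basis_comb s n b (chart_row d c i)
        = (\<Sum>f<d. s (chart_row d c i f) (b f)) + (\<Sum>f\<in>{d..<n}. s (chart_row d c i f) (b f))"
      unfolding basis_comb_def
      using d_le by (subst sum.union_disjoint[symmetric]) (auto intro!: sum.cong)
    also have "(\<Sum>f<d. s (chart_row d c i f) (b f)) = (\<Sum>f<d. if f = i then b f else 0)"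
      by (intro sum.cong) (auto simp: chart_row_def)
    also have "\<dots> = b i" using that by simp
    also have "(\<Sum>f\<in>{d..<n}. s (chart_row d c i f) (b f)) = (\<Sum>f\<in>{d..<n}. s (c (i, f)) (b f))"
      by (intro sum.cong) (auto simp: chart_row_def)
    finally show ?thesis by simp
  qed
  then show ?thesis
    unfolding gr_chart_def n_def[symmetric] by (intro arg_cong[of _ _ span] image_cong) auto
qed

lemma gr_chart_in_grassmannian:
  assumes b: "ordered_basis s V b"
  shows "gr_chart s V d b c \<in> grassmannian s V d"
proof -
  let ?t = "\<lambda>i. basis_comb s n b (chart_row d c i)"
  have comb0: "w i = 0" if "(\<Sum>i<d. s (w i) (?t i)) = 0" "i < d" for w i
  proof -
    have "basis_comb s n b (\<lambda>f. \<Sum>i<d. w i * chart_row d c i f) = basis_comb s n b (\<lambda>f. 0)"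
      using that(1) unfolding comb_sum by (simp add: basis_comb_def)
    from comb_unique[OF b this, of i] have "(\<Sum>k<d. w k * chart_row d c k i) = 0"
      using that(2) d_le by simp
    moreover have "(\<Sum>k<d. w k * chart_row d c k i) = (\<Sum>k<d. if k = i then w k else 0)"
      using that(2) by (intro sum.cong) (auto simp: chart_row_def)
    ultimately show ?thesis using that(2) by simp
  qed
  have inj: "inj_on ?t {..<d}"
  proof (rule inj_onI)
    fix i j assume ij: "i \<in> {..<d}" "j \<in> {..<d}" "?t i = ?t j"
    then have "chart_row d c i i = chart_row d c j i"
      using comb_unique[OF b ij(3), of i] d_le by simp
    then show "i = j" using ij by (auto simp: chart_row_def split: if_splits)
  qed
  have ind: "independent (?t ` {..<d})"
  proof (rule independent_if_scalars_zero)
    fix w x assume sum: "(\<Sum>x\<in>?t ` {..<d}. s (w x) x) = 0" and x: "x \<in> ?t ` {..<d}"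
    have "(\<Sum>i<d. s (w (?t i)) (?t i)) = 0"
      using sum sum.reindex[OF inj, of "\<lambda>x. s (w x) x"] by (simp add: comp_def)
    then show "w x = 0" using comb0[of "\<lambda>i. w (?t i)"] x by auto
  qed simp
  have "dim (span (?t ` {..<d})) = card (?t ` {..<d})"
    using dim_span_eq_card_independent[OF ind] .
  also have "\<dots> = d" using card_image[OF inj] by simp
  finally have "dim (span (?t ` {..<d})) = d" .
  moreover have "span (?t ` {..<d}) \<subseteq> V"
    using comb_in_V[OF b] by (intro span_minimal subspace_V) auto
  ultimately show ?thesis
    unfolding grassmannian_def gr_chart_eq by simp
qed

text \<open>\<open>P\<close> is the matrix that row reduces \<open>A\<close> to the identity
  followed by \<open>c\<close>.\<close>

lemma gr_chart_rows:
  assumes b: "ordered_basis s V b"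
    and eq: "span ((\<lambda>i. basis_comb s n b (A i)) ` {..<d}) = gr_chart s V d b c"
  obtains P where "\<And>i f. i < d \<Longrightarrow> f < n \<Longrightarrow> chart_row d c i f = (\<Sum>k<d. P i k * A k f)"
proof -
  have "\<exists>u. \<forall>f<n. chart_row d c i f = (\<Sum>k<d. u k * A k f)" if i: "i < d" for i
  proof -
    have "basis_comb s n b (chart_row d c i) \<in> span ((\<lambda>i. basis_comb s n b (A i)) ` {..<d})"
      unfolding eq gr_chart_eq using i by (intro span_base) auto
    then obtain u where "basis_comb s n b (chart_row d c i) = (\<Sum>k<d. s (u k) (basis_comb s n b (A k)))"
      unfolding span_family[OF finite_lessThan] by blast
    then show ?thesis
      unfolding comb_sum using comb_unique[OF b] by blast
  qed
  then have "\<forall>i. \<exists>u. i < d \<longrightarrow> (\<forall>f<n. chart_row d c i f = (\<Sum>k<d. u k * A k f))" by blast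
  then show thesis using that by metis
qed

text \<open>Both row families begin with an identity block. Comparing the first \<open>d\<close>
  columns shows that the matrix relating them is the identity.\<close>

lemma gr_chart_inj:
  assumes b: "ordered_basis s V b"
    and c: "c \<in> affine_space (chart_index s V d)" "c' \<in> affine_space (chart_index s V d)"
    and eq: "gr_chart s V d b c = gr_chart s V d b c'"
  shows "c = c'"
proof
  obtain P where P: "\<And>i f. i < d \<Longrightarrow> f < n \<Longrightarrow> chart_row d c' i f = (\<Sum>k<d. P i k * chart_row d c k f)"
    using gr_chart_rows[OF b eq[unfolded gr_chart_eq[of b c]]] by blast
  have Pid: "P i k = (if k = i then 1 else 0)" if "i < d" "k < d" for i k
  proof -
    have "(\<Sum>l<d. P i l * chart_row d c l k) = (\<Sum>l<d. if l = k then P i l else 0)"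
      using that by (intro sum.cong) (auto simp: chart_row_def)
    then have "chart_row d c' i k = P i k"
      using P[of i k] that d_le by simp
    then show ?thesis using that by (simp add: chart_row_def)
  qed
  fix x :: "nat \<times> nat"
  show "c x = c' x"
  proof (cases "x \<in> chart_index s V d")
    case True
    then obtain i f where x: "x = (i, f)" "i < d" "d \<le> f" "f < n"
      unfolding chart_index_def n_def by auto
    have "c' x = (\<Sum>k<d. P i k * chart_row d c k f)"
      using P[OF x(2,4)] x by (simp add: chart_row_def)
    also have "\<dots> = (\<Sum>k<d. if k = i then chart_row d c k f else 0)"
      using x(2) by (intro sum.cong) (auto simp: Pid)
    also have "\<dots> = c x" using x by (simp add: chart_row_def)
    finally show ?thesis by simp
  next
    case False
    then have "c x = 0" "c' x = 0" using c unfolding affine_space_def by blast+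
    then show ?thesis by simp
  qed
qed

text \<open>The first \<open>d\<close> columns of \<open>gr_chart_rows\<close> say
  \<open>P * A = 1\<close> for the leading block. A nonzero leading minor is thus necessary for
  lying in the chart; row reduction shows that it suffices.\<close>

lemma gr_chart_det_nonzero:
  assumes b: "ordered_basis s V b"
    and eq: "span ((\<lambda>i. basis_comb s n b (A i)) ` {..<d}) = gr_chart s V d b c"
  shows "Determinant.det (Matrix.mat d d (\<lambda>(i, j). A i j)) \<noteq> (0::complex)"
proof -
  obtain P where P: "\<And>i f. i < d \<Longrightarrow> f < n \<Longrightarrow> chart_row d c i f = (\<Sum>k<d. P i k * A k f)"
    using gr_chart_rows[OF b eq] by blast
  let ?P = "Matrix.mat d d (\<lambda>(i, j). P i j)" and ?A = "Matrix.mat d d (\<lambda>(i, j). A i j)"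
  have "?P * ?A = 1\<^sub>m d"
  proof (rule eq_matI)
    fix i j assume ij: "i < dim_row (1\<^sub>m d :: complex mat)" "j < dim_col (1\<^sub>m d :: complex mat)"
    then have "(?P * ?A) $$ (i, j) = (\<Sum>k<d. P i k * A k j)"
      by (simp add: scalar_prod_def atLeast0LessThan)
    also have "\<dots> = chart_row d c i j" using P[of i j] ij d_le by simp
    finally show "(?P * ?A) $$ (i, j) = 1\<^sub>m d $$ (i, j)"
      using ij by (auto simp: chart_row_def)
  qed auto
  then have "Determinant.det ?P * Determinant.det ?A = 1"
    using det_mult[of ?P d ?A] by simp
  then show ?thesis by auto
qed

text \<open>Multiply by the inverse of the leading \<open>d \<times> d\<close> block. Its adjugate and determinant are
  polynomial in the entries, which makes transition maps rational.\<close>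

lemma gr_chart_row_reduce:
  assumes "Determinant.det (Matrix.mat d d (\<lambda>(i, j). A i j)) \<noteq> (0::complex)"
  shows "span ((\<lambda>i. basis_comb s n b (A i)) ` {..<d}) = gr_chart s V d b
    (\<lambda>(i, j). (if (i, j) \<in> chart_index s V d
        then \<Sum>k<d. adj_mat (Matrix.mat d d (\<lambda>(i, j). A i j)) $$ (i, k) * A k j else 0)
      / Determinant.det (Matrix.mat d d (\<lambda>(i, j). A i j)))"
    (is "_ = gr_chart s V d b ?c")
proof -
  let ?A = "Matrix.mat d d (\<lambda>(i, j). A i j)"
  define D where "D = Determinant.det ?A"
  define N where "N i k = adj_mat ?A $$ (i, k) / D" for i k
  have D: "D \<noteq> 0" using assms unfolding D_def .
  have carrier: "?A \<in> carrier_mat d d" by simp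
  have NA: "(\<Sum>k<d. N i k * A k j) = (if i = j then 1 else 0)" if "i < d" "j < d" for i j
  proof -
    have "(adj_mat ?A * ?A) $$ (i, j) = (\<Sum>k<d. adj_mat ?A $$ (i, k) * A k j)"
      using that adj_mat(1)[OF carrier] by (simp add: scalar_prod_def atLeast0LessThan)
    then have "(\<Sum>k<d. adj_mat ?A $$ (i, k) * A k j) = (if i = j then D else 0)"
      unfolding adj_mat(3)[OF carrier] using that by (auto simp: D_def)
    then show ?thesis
      using D unfolding N_def by (simp add: sum_divide_distrib[symmetric])
  qed
  have AN: "(\<Sum>k<d. A i k * N k j) = (if i = j then 1 else 0)" if "i < d" "j < d" for i j
  proof -
    have "(?A * adj_mat ?A) $$ (i, j) = (\<Sum>k<d. A i k * adj_mat ?A $$ (k, j))"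
      using that adj_mat(1)[OF carrier] by (simp add: scalar_prod_def atLeast0LessThan)
    then have "(\<Sum>k<d. A i k * adj_mat ?A $$ (k, j)) = (if i = j then D else 0)"
      unfolding adj_mat(2)[OF carrier] using that by (auto simp: D_def)
    then show ?thesis
      using D unfolding N_def by (simp add: sum_divide_distrib[symmetric])
  qed
  have row: "chart_row d ?c i f = (\<Sum>k<d. N i k * A k f)" if "i < d" "f < n" for i f
  proof (cases "f < d")
    case True
    then show ?thesis using NA[OF that(1) True] by (simp add: chart_row_def)
  next
    case False
    then show ?thesis
      using that unfolding chart_row_def chart_index_def n_def N_def D_def
      by (simp add: sum_divide_distrib)
  qed
  \<comment> \<open>The other direction, from \<open>A * N = 1\<close>: the rows of \<open>A\<close>
    are combinations of the reduced rows, so both families have the same span.\<close>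
  have row_inv: "A k f = (\<Sum>i<d. A k i * chart_row d ?c i f)" if "k < d" "f < n" for k f
  proof -
    have "(\<Sum>i<d. A k i * chart_row d ?c i f) = (\<Sum>i<d. A k i * (\<Sum>l<d. N i l * A l f))"
      using row that(2) by (intro sum.cong) auto
    also have "\<dots> = (\<Sum>l<d. (\<Sum>i<d. A k i * N i l) * A l f)"
      unfolding sum_distrib_left sum_distrib_right by (subst sum.swap) (simp add: algebra_simps)
    also have "\<dots> = (\<Sum>l<d. if l = k then A l f else 0)"
      using that(1) AN by (intro sum.cong) auto
    also have "\<dots> = A k f" using that(1) by simp
    finally show ?thesis by simp
  qed
  show ?thesis
    unfolding gr_chart_eq
  proof (subst span_eq, intro conjI image_subsetI)
    fix k assume "k \<in> {..<d}"
    then have "basis_comb s n b (A k) = (\<Sum>i<d. s (A k i) (basis_comb s n b (chart_row d ?c i)))"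
      unfolding comb_sum using row_inv by (intro comb_cong) auto
    then show "basis_comb s n b (A k) \<in> span ((\<lambda>i. basis_comb s n b (chart_row d ?c i)) ` {..<d})"
      unfolding span_family[OF finite_lessThan] by blast
  next
    fix i assume "i \<in> {..<d}"
    then have "basis_comb s n b (chart_row d ?c i) = (\<Sum>k<d. s (N i k) (basis_comb s n b (A k)))"
      unfolding comb_sum using row by (intro comb_cong) auto
    then show "basis_comb s n b (chart_row d ?c i) \<in> span ((\<lambda>i. basis_comb s n b (A i)) ` {..<d})"
      unfolding span_family[OF finite_lessThan] by blast
  qed
qed

text \<open>Openness must be verified in every chart \<open>b'\<close>. There the image of
  \<open>Z\<close> consists of the \<open>c\<close> for which the leading minor \<open>D c\<close>
  is nonzero and the transition map \<open>g\<close> sends \<open>c\<close> into \<open>Z\<close>;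
  clearing denominators describes this by polynomials.\<close>

lemma openin_gr_chart_image:
  assumes b: "ordered_basis s V b" and Z: "openin (zariski (chart_index s V d)) Z"
  shows "openin (gr_zariski s V d) (gr_chart s V d b ` Z)"
  unfolding openin_gr_zariski gr_open_def
proof (intro conjI allI impI)
  let ?I = "chart_index s V d"
  show "gr_chart s V d b ` Z \<subseteq> grassmannian s V d"
    using gr_chart_in_grassmannian[OF b] by blast
  fix b' assume b': "ordered_basis s V b'"
  obtain F where F: "F \<subseteq> polynomial_functions ?I" "Z = {p \<in> affine_space ?I. \<exists>f\<in>F. f p \<noteq> 0}"
    using Z unfolding openin_zariski zariski_open_def by blast
  have "\<forall>e. \<exists>u. e < n \<longrightarrow> b' e = basis_comb s n b u"
  proof
    fix e
    show "\<exists>u. e < n \<longrightarrow> b' e = basis_comb s n b u"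
    proof (cases "e < n")
      case True
      have "span (b' ` {..<n}) = V" using b' unfolding ordered_basis_def n_def by blast
      then have "b' e \<in> V" using True span_base[of "b' e" "b' ` {..<n}"] by blast
      then show ?thesis using comb_exists[OF b] by blast
    qed simp
  qed
  then obtain Q where Q: "\<And>e. e < n \<Longrightarrow> b' e = basis_comb s n b (Q e)" by metis
  \<comment> \<open>The generators of the chart for \<open>b'\<close>, expressed in coordinates with
    respect to \<open>b\<close>.\<close>
  define M where "M c i f = (\<Sum>e<n. chart_row d c i e * Q e f)" for c i f
  have chart': "gr_chart s V d b' c = span ((\<lambda>i. basis_comb s n b (M c i)) ` {..<d})" for c
  proof -
    have "basis_comb s n b' (chart_row d c i) = basis_comb s n b (M c i)" for i
    proof -
      have "basis_comb s n b' (chart_row d c i) = (\<Sum>e<n. s (chart_row d c i e) (basis_comb s n b (Q e)))"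
        unfolding basis_comb_def[of s n b'] using Q by (intro sum.cong) auto
      also have "\<dots> = basis_comb s n b (M c i)"
        unfolding comb_sum M_def ..
      finally show ?thesis .
    qed
    then show ?thesis unfolding gr_chart_eq by simp
  qed
  have M_poly: "(\<lambda>c. M c i f) \<in> polynomial_functions ?I" if "i < d" for i f
    unfolding M_def
  proof (intro polynomial_functions_sum polynomial_functions.mult polynomial_functions.const)
    fix e assume "e \<in> {..<n}"
    then show "(\<lambda>c. chart_row d c i e) \<in> polynomial_functions ?I"
      using that unfolding chart_row_def
      by (cases "e < d") (auto intro: polynomial_functions.const polynomial_functions.coord
          simp: chart_index_def n_def)
  qed
  define A where "A c = Matrix.mat d d (\<lambda>(i, j). M c i j)" for c
  define D where "D c = Determinant.det (A c)" for c
  \<comment> \<open>The value 0 off the index set keeps \<open>g c\<close> in affine space, where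
    chart coordinates are unique.\<close>
  define p where "p x c = (if x \<in> ?I then \<Sum>k<d. adj_mat (A c) $$ (fst x, k) * M c k (snd x) else 0)"
    for x c
  define g where "g c = (\<lambda>x. p x c / D c)" for c
  have D_poly: "D \<in> polynomial_functions ?I"
    unfolding D_def A_def by (intro det_polynomial_function M_poly)
  have p_poly: "p x \<in> polynomial_functions ?I" if "x \<in> ?I" for x
  proof -
    have "(\<lambda>c. \<Sum>k<d. adj_mat (A c) $$ (fst x, k) * M c k (snd x)) \<in> polynomial_functions ?I"
      unfolding A_def using that
      by (intro polynomial_functions_sum polynomial_functions.mult adj_mat_polynomial_function M_poly)
        (auto simp: chart_index_def)
    then show ?thesis using that unfolding p_def by simp
  qed
  have g_affine: "g c \<in> affine_space ?I" for c
    unfolding g_def p_def affine_space_def by simp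
  have transition: "gr_chart s V d b' c \<in> gr_chart s V d b ` Z \<longleftrightarrow> D c \<noteq> 0 \<and> g c \<in> Z" for c
  proof
    assume "gr_chart s V d b' c \<in> gr_chart s V d b ` Z"
    then obtain c' where c': "c' \<in> Z" "gr_chart s V d b' c = gr_chart s V d b c'" by blast
    then have D: "D c \<noteq> 0"
      using gr_chart_det_nonzero[OF b] unfolding chart' D_def A_def by blast
    have "gr_chart s V d b' c = gr_chart s V d b (g c)"
      using gr_chart_row_reduce[of "M c" b] D
      unfolding chart' D_def A_def g_def p_def by (simp add: case_prod_unfold)
    then have "c' = g c"
      using c' F(2) g_affine by (intro gr_chart_inj[OF b]) auto
    then show "D c \<noteq> 0 \<and> g c \<in> Z" using D c' by simp
  next
    assume D: "D c \<noteq> 0 \<and> g c \<in> Z"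
    have "gr_chart s V d b' c = gr_chart s V d b (g c)"
      using gr_chart_row_reduce[of "M c" b] D
      unfolding chart' D_def A_def g_def p_def by (simp add: case_prod_unfold)
    then show "gr_chart s V d b' c \<in> gr_chart s V d b ` Z" using D by blast
  qed
  have "\<forall>f. \<exists>h. f \<in> F \<longrightarrow> h \<in> polynomial_functions ?I \<and> (\<forall>c. D c \<noteq> 0 \<longrightarrow> (h c = 0 \<longleftrightarrow> f (g c) = 0))"
  proof
    fix f
    show "\<exists>h. f \<in> F \<longrightarrow> h \<in> polynomial_functions ?I \<and> (\<forall>c. D c \<noteq> 0 \<longrightarrow> (h c = 0 \<longleftrightarrow> f (g c) = 0))"
    proof (cases "f \<in> F")
      case True
      then obtain h k where "h \<in> polynomial_functions ?I"
        "\<And>c. D c \<noteq> 0 \<Longrightarrow> h c = D c ^ k * f (\<lambda>x. p x c / D c)"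
        using clear_denominators[where p = p, OF subsetD[OF F(1) True] p_poly D_poly] by blast
      then show ?thesis unfolding g_def by auto
    qed simp
  qed
  then obtain h where h: "\<And>f. f \<in> F \<Longrightarrow> h f \<in> polynomial_functions ?I"
    "\<And>f c. f \<in> F \<Longrightarrow> D c \<noteq> 0 \<Longrightarrow> h f c = 0 \<longleftrightarrow> f (g c) = 0"
    by metis
  \<comment> \<open>The factor \<open>D c\<close> joins the condition \<open>D c \<noteq> 0\<close>
    with the nonvanishing of \<open>h f c\<close> in one polynomial.\<close>
  let ?H = "(\<lambda>f c. D c * h f c) ` F"
  have "chart_preimage s V d b' (gr_chart s V d b ` Z) = {c \<in> affine_space ?I. \<exists>f\<in>?H. f c \<noteq> 0}"
    unfolding chart_preimage_def transition using g_affine h(2) F(2) by auto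
  moreover have "?H \<subseteq> polynomial_functions ?I"
    using h(1) D_poly by (auto intro: polynomial_functions.mult)
  ultimately show "openin (zariski ?I) (chart_preimage s V d b' (gr_chart s V d b ` Z))"
    unfolding openin_zariski zariski_open_def by blast
qed

section \<open>Charts as homeomorphisms onto open sets\<close>

definition chart_domain :: "(nat \<Rightarrow> 'v) \<Rightarrow> 'v set set" where
  "chart_domain b = gr_chart s V d b ` affine_space (chart_index s V d)"

lemma openin_chart_domain:
  assumes "ordered_basis s V b"
  shows "openin (gr_zariski s V d) (chart_domain b)"
  unfolding chart_domain_def using openin_gr_chart_image[OF assms] openin_topspace topspace_zariski
  by metis

lemma homeomorphic_gr_chart:
  assumes b: "ordered_basis s V b"
  shows "homeomorphic_map (zariski (chart_index s V d))
    (subtopology (gr_zariski s V d) (chart_domain b)) (gr_chart s V d b)"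
proof (rule bijective_open_imp_homeomorphic_map)
  let ?X = "zariski (chart_index s V d)" and ?Y = "subtopology (gr_zariski s V d) (chart_domain b)"
  have top: "topspace ?Y = chart_domain b"
    using openin_subset[OF openin_chart_domain[OF b]] by auto
  show "gr_chart s V d b ` topspace ?X = topspace ?Y"
    unfolding top by (simp add: chart_domain_def)
  show "inj_on (gr_chart s V d b) (topspace ?X)"
    using gr_chart_inj[OF b] by (auto intro: inj_onI)
  show "continuous_map ?X ?Y (gr_chart s V d b)"
    unfolding continuous_map_def top
  proof (intro conjI allI impI)
    show "gr_chart s V d b \<in> topspace ?X \<rightarrow> chart_domain b"
      by (simp add: chart_domain_def)
    fix U assume "openin ?Y U"
    then obtain W where W: "openin (gr_zariski s V d) W" "U = W \<inter> chart_domain b"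
      unfolding openin_subtopology by blast
    have "{x \<in> topspace ?X. gr_chart s V d b x \<in> U} = chart_preimage s V d b W"
      unfolding W(2) chart_preimage_def chart_domain_def by auto
    then show "openin ?X {x \<in> topspace ?X. gr_chart s V d b x \<in> U}"
      using W(1) b unfolding openin_gr_zariski gr_open_def by simp
  qed
  show "open_map ?X ?Y (gr_chart s V d b)"
    unfolding open_map_def
  proof (intro allI impI)
    fix U assume U: "openin ?X U"
    have "gr_chart s V d b ` U \<subseteq> chart_domain b"
      using openin_subset[OF U] unfolding chart_domain_def by auto
    then show "openin ?Y (gr_chart s V d b ` U)"
      using openin_gr_chart_image[OF b U] unfolding openin_subtopology
      by (intro exI[of _ "gr_chart s V d b ` U"]) auto
  qed
qed

end

section \<open>Charts adapted to a decomposition\<close>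

lemma adapted_basis:
  fixes s :: "complex \<Rightarrow> 'v::ab_group_add \<Rightarrow> 'v"
  assumes vs: "vector_space s" and V: "finitely_spanned s V"
    and T: "module.subspace s T" and K: "module.subspace s K" and TK: "T \<inter> K = {0}"
    and sum: "{a + b | a b. a \<in> T \<and> b \<in> K} = V"
  obtains b where "ordered_basis s V b"
    "module.span s (b ` {..<vector_space.dim s T}) = T"
    "module.span s (b ` {vector_space.dim s T..<vector_space.dim s V}) = K"
    "vector_space.dim s T \<le> vector_space.dim s V"
proof -
  interpret vector_space s by (rule vs)
  have "T \<subseteq> V" "K \<subseteq> V"
    unfolding sum[symmetric] using subspace_0[OF T] subspace_0[OF K]
    by (force intro: add.right_neutral[symmetric] add.left_neutral[symmetric])+
  note fT = finitely_spanned_mono[OF V \<open>T \<subseteq> V\<close>] and fK = finitely_spanned_mono[OF V \<open>K \<subseteq> V\<close>]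
  have dimV: "dim V = dim T + dim K"
    using dim_direct_sum[OF T fT K fK TK] unfolding sum .
  obtain B where B: "B \<subseteq> T" "independent B" "finite B" "T \<subseteq> span B" "card B = dim T"
    using finitely_spanned_basis[OF fT] .
  obtain C where C: "C \<subseteq> K" "independent C" "finite C" "K \<subseteq> span C" "card C = dim K"
    using finitely_spanned_basis[OF fK] .
  obtain g where g: "bij_betw g {0..<dim T} B"
    using ex_bij_betw_nat_finite[OF B(3)] B(5) by auto
  obtain h where h: "bij_betw h {0..<dim K} C"
    using ex_bij_betw_nat_finite[OF C(3)] C(5) by auto
  define b where "b i = (if i < dim T then g i else h (i - dim T))" for i
  have bB: "b ` {..<dim T} = B"
    using g unfolding bij_betw_def b_def by (auto simp: image_iff atLeast0LessThan)
  have bC: "b ` {dim T..<dim V} = C"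
  proof -
    have "b ` {dim T..<dim V} = h ` ((\<lambda>i. i - dim T) ` {dim T..<dim V})"
      unfolding image_image by (intro image_cong) (auto simp: b_def)
    also have "(\<lambda>i. i - dim T) ` {dim T..<dim V} = {0..<dim K}"
    proof (intro equalityI subsetI)
      fix i assume "i \<in> {0..<dim K}"
      then show "i \<in> (\<lambda>i. i - dim T) ` {dim T..<dim V}"
        using dimV by (intro image_eqI[of _ _ "i + dim T"]) auto
    qed (use dimV in auto)
    finally show ?thesis using h unfolding bij_betw_def by simp
  qed
  have sT: "span (b ` {..<dim T}) = T" and sK: "span (b ` {dim T..<dim V}) = K"
    unfolding bB bC using span_subspace[OF B(1,4) T] span_subspace[OF C(1,4) K] by auto
  have "{..<dim V} = {..<dim T} \<union> {dim T..<dim V}" using dimV by auto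
  then have spanV: "span (b ` {..<dim V}) = V"
    using sT sK sum unfolding image_Un span_Un by (simp add: image_Un span_Un)
  \<comment> \<open>A basis \<open>E\<close> extracted from the listed vectors has
    \<open>dim V\<close> members, as many as there are indices. So nothing is dropped, and the list
    is injective and independent.\<close>
  obtain E where E: "E \<subseteq> b ` {..<dim V}" "independent E" "b ` {..<dim V} \<subseteq> span E"
    using maximal_independent_subset[of "b ` {..<dim V}"] by blast
  have "span E = V"
    using spanV E(1,3) span_mono[OF E(1)] span_minimal[OF E(3) subspace_span] by blast
  then have "card E = dim V"
    using dim_span_eq_card_independent[OF E(2)] by simp
  moreover have "card (b ` {..<dim V}) \<le> dim V"
    using card_image_le[of "{..<dim V}" b] by simp
  ultimately have "E = b ` {..<dim V}" and card: "card (b ` {..<dim V}) = dim V"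
    using card_seteq[OF _ E(1)] card_mono[OF _ E(1)] by auto
  then have "independent (b ` {..<dim V})" "inj_on b {..<dim V}"
    using E(2) eq_card_imp_inj_on[of "{..<dim V}" b] by auto
  then show thesis
    using that[of b] spanV sT sK dimV unfolding ordered_basis_def by simp
qed

locale adapted_chart = fd_representation L V
  for L :: "'g::ab_group_add lie_alg" and V :: "('g, 'v::ab_group_add) rep" +
  fixes T K :: "'v set" and b :: "nat \<Rightarrow> 'v" and d n :: nat
  assumes d_def: "d = vector_space.dim (scl V) T"
    and n_def: "n = vector_space.dim (scl V) (space V)"
    and sum: "rep_direct_sum V T K"
    and basis: "ordered_basis (scl V) (space V) b"
    and span_T: "module.span (scl V) (b ` {..<d}) = T"
    and span_K: "module.span (scl V) (b ` {d..<n}) = K"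
    and d_le: "d \<le> n"
begin

sublocale gs: grassmannian_setting "scl V" "space V" d n
proof (intro grassmannian_setting.intro grassmannian_setting_axioms.intro vector_space_scl n_def d_le)
  show "module.subspace (scl V) (space V)" by (rule subspace_space)
qed

abbreviation index :: "(nat \<times> nat) set" where
  "index \<equiv> chart_index (scl V) (space V) d"

abbreviation chart :: "(nat \<times> nat \<Rightarrow> complex) \<Rightarrow> 'v set" where
  "chart \<equiv> gr_chart (scl V) (space V) d b"

lemma T_sub: "is_subrep V T" and K_sub: "is_subrep V K" and TK: "T \<inter> K = {0}"
  using sum unfolding rep_direct_sum_def by auto

lemmas V_closed = is_subrepD[OF fd_representation_axioms is_subrep_space[OF fd_representation_axioms]]
lemmas T_closed = is_subrepD[OF fd_representation_axioms T_sub]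
lemmas K_closed = is_subrepD[OF fd_representation_axioms K_sub]

definition coord :: "'v \<Rightarrow> nat \<Rightarrow> complex" where
  "coord x = (SOME u. x = basis_comb (scl V) n b u)"

lemma coord: "x \<in> space V \<Longrightarrow> basis_comb (scl V) n b (coord x) = x"
  unfolding coord_def using gs.comb_exists[OF basis] by (metis (mono_tags, lifting) someI_ex)

lemma coord_unique:
  assumes "x = basis_comb (scl V) n b u" "f < n"
  shows "coord x f = u f"
proof -
  have "x \<in> space V" using gs.comb_in_V[OF basis] assms(1) by simp
  then have "basis_comb (scl V) n b (coord x) = x" by (rule coord)
  also note assms(1)
  finally have "basis_comb (scl V) n b (coord x) = basis_comb (scl V) n b u" .
  from gs.comb_unique[OF basis this assms(2)] show ?thesis .
qed

lemma coord_comb_T: "x = (\<Sum>i<d. scl V (u i) (b i)) \<Longrightarrow> f < n \<Longrightarrow> coord x f = (if f < d then u f else 0)"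
proof (rule coord_unique)
  assume x: "x = (\<Sum>i<d. scl V (u i) (b i))"
  have "basis_comb (scl V) n b (\<lambda>f. if f < d then u f else 0)
      = (\<Sum>f<d. scl V (if f < d then u f else 0) (b f))"
    unfolding basis_comb_def using d_le by (intro sum.mono_neutral_right) auto
  then show "x = basis_comb (scl V) n b (\<lambda>f. if f < d then u f else 0)"
    unfolding x by simp
qed

lemma coord_comb_K:
  "x = (\<Sum>j\<in>{d..<n}. scl V (u j) (b j)) \<Longrightarrow> f < n \<Longrightarrow> coord x f = (if d \<le> f then u f else 0)"
proof (rule coord_unique)
  assume x: "x = (\<Sum>j\<in>{d..<n}. scl V (u j) (b j))"
  have "basis_comb (scl V) n b (\<lambda>f. if d \<le> f then u f else 0)
      = (\<Sum>f\<in>{d..<n}. scl V (if d \<le> f then u f else 0) (b f))"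
    unfolding basis_comb_def using d_le by (intro sum.mono_neutral_right) auto
  then show "x = basis_comb (scl V) n b (\<lambda>f. if d \<le> f then u f else 0)"
    unfolding x by (auto intro!: sum.cong)
qed

lemma coord_T:
  assumes "x \<in> T"
  shows "(\<Sum>i<d. scl V (coord x i) (b i)) = x"
proof -
  obtain u where u: "x = (\<Sum>i<d. scl V (u i) (b i))"
    using assms unfolding span_T[symmetric] gs.span_family[OF finite_lessThan] by blast
  have "(\<Sum>i<d. scl V (coord x i) (b i)) = (\<Sum>i<d. scl V (u i) (b i))"
    using coord_comb_T[OF u] d_le by (intro sum.cong) auto
  then show ?thesis using u by simp
qed

lemma coord_K:
  assumes "x \<in> K"
  shows "(\<Sum>j\<in>{d..<n}. scl V (coord x j) (b j)) = x"
proof -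
  obtain u where u: "x = (\<Sum>j\<in>{d..<n}. scl V (u j) (b j))"
    using assms unfolding span_K[symmetric] gs.span_family[OF finite_atLeastLessThan] by blast
  have "(\<Sum>j\<in>{d..<n}. scl V (coord x j) (b j)) = (\<Sum>j\<in>{d..<n}. scl V (u j) (b j))"
    using coord_comb_K[OF u] by (intro sum.cong) auto
  then show ?thesis using u by simp
qed

lemma coord_add: "x \<in> space V \<Longrightarrow> y \<in> space V \<Longrightarrow> f < n \<Longrightarrow> coord (x + y) f = coord x f + coord y f"
  by (rule coord_unique)
    (simp_all add: basis_comb_def gs.scale_left_distrib sum.distrib coord[unfolded basis_comb_def])

lemma coord_scale: "x \<in> space V \<Longrightarrow> f < n \<Longrightarrow> coord (scl V c x) f = c * coord x f"
  by (rule coord_unique)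
    (simp_all add: basis_comb_def gs.scale_scale[symmetric] gs.scale_sum_right[symmetric]
      coord[unfolded basis_comb_def] del: gs.scale_scale)

definition column :: "(nat \<times> nat \<Rightarrow> complex) \<Rightarrow> nat \<Rightarrow> 'v" where
  "column c i = (\<Sum>j\<in>{d..<n}. scl V (c (i, j)) (b j))"

text \<open>The linear map from \<open>T\<close> to \<open>K\<close> with matrix \<open>c\<close>,
  continued by 0 as \<open>rep_hom\<close> requires.\<close>

definition graph_map :: "(nat \<times> nat \<Rightarrow> complex) \<Rightarrow> 'v \<Rightarrow> 'v" where
  "graph_map c x = (if x \<in> T then \<Sum>i<d. scl V (coord x i) (column c i) else 0)"

lemma column_in_K: "column c i \<in> K"
  unfolding column_def span_K[symmetric] by (intro gs.span_sum gs.span_scale gs.span_base) auto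

lemma graph_map_in_K: "graph_map c x \<in> K"
  unfolding graph_map_def using column_in_K K_closed(1,7)
  by (auto intro!: gs.subspace_sum gs.subspace_scale)

lemma graph_map_linear: "linear_on (scl V) (scl V) T (graph_map c)"
proof -
  have "coord (x + y) i = coord x i + coord y i" if "x \<in> T" "y \<in> T" "i < d" for x y i
    using coord_add[OF T_closed(5)[OF that(1)] T_closed(5)[OF that(2)]] that(3) d_le by simp
  moreover have "coord (scl V a x) i = a * coord x i" if "x \<in> T" "i < d" for x a i
    using coord_scale[OF T_closed(5)[OF that(1)]] that(2) d_le by simp
  ultimately show ?thesis
    unfolding linear_on_def graph_map_def using T_closed(2,4)
    by (simp add: gs.scale_left_distrib sum.distrib gs.scale_sum_right)
qed

lemma chart_eq_graph: "chart c = (\<lambda>x. x + graph_map c x) ` T"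
proof -
  have comb: "(\<Sum>i<d. scl V (u i) (b i + column c i)) = x + graph_map c x"
    if x: "x = (\<Sum>i<d. scl V (u i) (b i))" for u x
  proof -
    have "x \<in> T"
      unfolding x span_T[symmetric] by (intro gs.span_sum gs.span_scale gs.span_base) auto
    moreover have "(\<Sum>i<d. scl V (coord x i) (column c i)) = (\<Sum>i<d. scl V (u i) (column c i))"
      using coord_comb_T[OF x] d_le by (intro sum.cong) auto
    ultimately show ?thesis
      unfolding graph_map_def by (simp add: gs.scale_right_distrib sum.distrib x)
  qed
  have chart: "chart c = range (\<lambda>u. \<Sum>i<d. scl V (u i) (b i + column c i))"
    unfolding gr_chart_def column_def n_def[symmetric] by (rule gs.span_family) simp
  show ?thesis
  proof (intro equalityI subsetI)
    fix y assume "y \<in> chart c"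
    then obtain u where "y = (\<Sum>i<d. scl V (u i) (b i + column c i))" unfolding chart by blast
    moreover have "(\<Sum>i<d. scl V (u i) (b i)) \<in> T"
      unfolding span_T[symmetric] by (intro gs.span_sum gs.span_scale gs.span_base) auto
    ultimately show "y \<in> (\<lambda>x. x + graph_map c x) ` T"
      using comb[OF refl, of u] by (intro image_eqI[of _ _ "\<Sum>i<d. scl V (u i) (b i)"]) auto
  next
    fix y assume "y \<in> (\<lambda>x. x + graph_map c x) ` T"
    then obtain x where x: "x \<in> T" "y = x + graph_map c x" by blast
    show "y \<in> chart c"
      unfolding chart x(2)
      by (rule range_eqI[of _ _ "coord x"]) (rule comb[OF coord_T[OF x(1), symmetric], symmetric])
  qed
qed

text \<open>Linearity in the matrix, not in the vector. It makes the passage from matrices to maps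
  an isomorphism of vector spaces, so that dimensions can be compared.\<close>

lemma graph_map_linear_in_matrix:
  "linear_on fun_scale (fscale (scl V)) U graph_map"
  unfolding linear_on_def graph_map_def column_def fscale_def fun_scale_def
  by (auto simp: fun_eq_iff gs.scale_left_distrib gs.scale_right_distrib sum.distrib
      gs.scale_sum_right mult_ac)

lemma graph_map_inj: "inj_on graph_map (affine_space index)"
proof (rule inj_onI, rule ext)
  fix c c' :: "nat \<times> nat \<Rightarrow> complex" and x
  assume c: "c \<in> affine_space index" "c' \<in> affine_space index" and eq: "graph_map c = graph_map c'"
  show "c x = c' x"
  proof (cases "x \<in> index")
    case True
    then obtain i j where x: "x = (i, j)" "i < d" "d \<le> j" "j < n"
      unfolding chart_index_def n_def by auto
    have bi: "b i = (\<Sum>k<d. scl V (if k = i then 1 else 0) (b k))"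
    proof -
      have "(\<Sum>k<d. scl V (if k = i then 1 else 0) (b k)) = (\<Sum>k<d. if k = i then b k else 0)"
        by (intro sum.cong) auto
      then show ?thesis using x(2) by simp
    qed
    have graph: "graph_map a (b i) = column a i" for a
    proof -
      have "b i \<in> T" unfolding span_T[symmetric] using x(2) by (intro gs.span_base) auto
      then have "graph_map a (b i) = (\<Sum>k<d. scl V (coord (b i) k) (column a k))"
        unfolding graph_map_def by simp
      also have "\<dots> = (\<Sum>k<d. if k = i then column a k else 0)"
        using coord_comb_T[OF bi] d_le by (intro sum.cong) auto
      finally show ?thesis using x(2) by simp
    qed
    have "column c i = column c' i" using graph eq by metis
    then show ?thesis
      using coord_comb_K[OF column_def[of c i] x(4)] coord_comb_K[OF column_def[of c' i] x(4)] x by simp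
  next
    case False
    then have "c x = 0" "c' x = 0" using c unfolding affine_space_def by blast+
    then show ?thesis by simp
  qed
qed

text \<open>The entries of \<open>c\<close> are the coordinates of the images of the basis vectors
  of \<open>T\<close>. Only coordinates from \<open>d\<close> on are recorded, which loses nothing
  because the images lie in \<open>K\<close>.\<close>

lemma graph_map_surj:
  assumes f: "f \<in> rep_hom (subrep V T) (subrep V K)"
  obtains c where "c \<in> affine_space index" "graph_map c = f"
proof -
  define c where "c = (\<lambda>(i, j). if (i, j) \<in> index then coord (f (b i)) j else 0)"
  have bT: "b i \<in> T" if "i < d" for i
    unfolding span_T[symmetric] using that by (intro gs.span_base) auto
  have col: "column c i = f (b i)" if i: "i < d" for i
  proof -
    have "column c i = (\<Sum>j\<in>{d..<n}. scl V (coord (f (b i)) j) (b j))"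
      unfolding column_def c_def using i
      by (intro sum.cong) (auto simp: chart_index_def n_def)
    also have "\<dots> = f (b i)"
      using rep_homD(2)[OF f] bT[OF i] by (intro coord_K) simp
    finally show ?thesis .
  qed
  have "graph_map c x = f x" for x
  proof (cases "x \<in> T")
    case True
    obtain g where g: "Vector_Spaces.linear (scl V) (scl V) g" "\<And>u. u \<in> T \<Longrightarrow> g u = f u"
      using linear_on_extend[OF vector_space_scl vector_space_scl _ T_closed(7)]
        rep_homD(1)[OF f] by auto
    interpret g: Vector_Spaces.linear "scl V" "scl V" g by (rule g(1))
    have "graph_map c x = (\<Sum>i<d. scl V (coord x i) (g (b i)))"
      unfolding graph_map_def using True col g(2) bT by (auto intro!: sum.cong)
    also have "\<dots> = g (\<Sum>i<d. scl V (coord x i) (b i))"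
      by (simp add: g.sum g.scale)
    also have "\<dots> = f x" using coord_T[OF True] g(2)[OF True] by simp
    finally show ?thesis .
  next
    case False
    then show ?thesis using rep_homD(4)[OF f] unfolding graph_map_def by simp
  qed
  then have "graph_map c = f" by blast
  moreover have "c \<in> affine_space index" unfolding affine_space_def c_def by auto
  ultimately show thesis using that by blast
qed

lemma chart_zero: "chart 0 = T"
proof -
  have "graph_map 0 x = 0" for x
    unfolding graph_map_def column_def by simp
  then show ?thesis unfolding chart_eq_graph by simp
qed

text \<open>The graph of a linear map from \<open>T\<close> to \<open>K\<close> is a subrepresentation iff the map is equivariant,
  in which case projection along \<open>K\<close> identifies it with \<open>T\<close>.\<close>

lemma chart_in_Gr_rep_iff:
  assumes S: "is_subrep V S" and T: "T \<in> Gr_rep V S"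
  shows "chart c \<in> Gr_rep V S \<longleftrightarrow> graph_map c \<in> rep_hom (subrep V T) (subrep V K)"
proof
  note act_add = act_linear[unfolded linear_on_def, THEN conjunct1, rule_format]
  assume "chart c \<in> Gr_rep V S"
  then have sub: "is_subrep V (chart c)" unfolding Gr_rep_def by blast
  have "graph_map c (act V y x) = act V y (graph_map c x)" if x: "x \<in> T" for x y
  proof -
    have gx: "graph_map c x \<in> K" by (rule graph_map_in_K)
    have "x + graph_map c x \<in> chart c" unfolding chart_eq_graph using x by blast
    then have "act V y (x + graph_map c x) \<in> chart c"
      using is_subrepD(6)[OF fd_representation_axioms sub] by blast
    then obtain x' where x': "x' \<in> T" "act V y (x + graph_map c x) = x' + graph_map c x'"
      unfolding chart_eq_graph by blast
    have "act V y x + act V y (graph_map c x) = x' + graph_map c x'"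
      using x'(2) act_add[OF T_closed(5)[OF x] K_closed(5)[OF gx]] by simp
    \<comment> \<open>Sorting by components gives a vector in \<open>T\<close> equal to one in
      \<open>K\<close>. Both are therefore 0, so \<open>x'\<close> is \<open>act V y x\<close> and
      the second equation is equivariance.\<close>
    then have "act V y x - x' = graph_map c x' - act V y (graph_map c x)"
      by (simp add: algebra_simps)
    moreover have "act V y x - x' \<in> T" using T_closed(3)[OF T_closed(6)[OF x] x'(1)] .
    moreover have "graph_map c x' - act V y (graph_map c x) \<in> K"
      using K_closed(3)[OF graph_map_in_K K_closed(6)[OF gx]] .
    ultimately have "act V y x - x' = 0" "graph_map c x' - act V y (graph_map c x) = 0"
      using TK by (metis IntI singletonD)+
    then show ?thesis by simp
  qed
  then show "graph_map c \<in> rep_hom (subrep V T) (subrep V K)"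
    unfolding rep_hom_def
  proof (intro CollectI conjI)
    show "graph_map c ` space (subrep V T) \<subseteq> space (subrep V K)" using graph_map_in_K by auto
    show "\<forall>v. v \<notin> space (subrep V T) \<longrightarrow> graph_map c v = 0" by (simp add: graph_map_def)
  qed (use graph_map_linear in simp_all)
next
  assume f: "graph_map c \<in> rep_hom (subrep V T) (subrep V K)"
  \<comment> \<open>The parametrisation of the graph by \<open>T\<close>, inverse to projection
    along \<open>K\<close>; equivariance of \<open>graph_map c\<close> makes it an isomorphism of
    representations.\<close>
  let ?g = "\<lambda>x. if x \<in> T then x + graph_map c x else 0"
  note fdT = fd_representation_subrep[OF fd_representation_axioms T_sub]
  note act_add = act_linear[unfolded linear_on_def, THEN conjunct1, rule_format]
  have g: "?g \<in> rep_hom (subrep V T) V"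
    unfolding rep_hom_def linear_on_def
    using T_closed V_closed(2) K_closed(5)[OF graph_map_in_K] rep_homD[OF f]
    by (auto simp: gs.scale_right_distrib act_add)
  have im: "?g ` space (subrep V T) = chart c" unfolding chart_eq_graph by (auto simp: image_iff)
  have sub: "is_subrep V (chart c)"
    using is_subrep_image[OF fdT fd_representation_axioms g] unfolding im .
  have "inj_on ?g (space (subrep V T))"
  proof (rule rep_hom_inj_on[OF fdT g])
    fix x assume "x \<in> space (subrep V T)" "?g x = 0"
    then have x: "x \<in> T" "x + graph_map c x = 0" by auto
    then have "x = 0 - graph_map c x" by (simp add: eq_neg_iff_add_eq_0)
    moreover have "0 - graph_map c x \<in> K" using K_closed(3)[OF K_closed(1) graph_map_in_K] .
    ultimately have "x \<in> K" by metis
    then show "x = 0" using x(1) TK by blast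
  qed
  then have iso: "rep_iso (subrep V T) (subrep V (chart c))"
    unfolding rep_iso_def bij_betw_def using im rep_homD(1,3)[OF g]
    by (intro exI[of _ ?g]) simp
  show "chart c \<in> Gr_rep V S"
    using sub rep_iso_trans[OF rep_iso_sym[OF fdT iso]] T unfolding Gr_rep_def by blast
qed

text \<open>By \<open>chart_in_Gr_rep_iff\<close> membership means that \<open>graph_map c\<close>
  is equivariant, a linear condition on \<open>c\<close>, and every equivariant map from
  \<open>T\<close> to \<open>K\<close> has a unique matrix.\<close>

lemma
  assumes S: "is_subrep V S" and T: "T \<in> Gr_rep V S"
  defines "H \<equiv> chart_preimage (scl V) (space V) d b (Gr_rep V S)"
  shows chart_preimage_subspace: "module.subspace fun_scale H"
    and chart_preimage_dim: "vector_space.dim fun_scale H = hom_dim (subrep V T) (subrep V K)"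
proof -
  interpret fs: vector_space "fun_scale :: complex \<Rightarrow> (nat \<times> nat \<Rightarrow> complex) \<Rightarrow> _"
    by (rule vector_space_fun_scale)
  interpret gsf: vector_space "fscale (scl V) :: complex \<Rightarrow> ('v \<Rightarrow> 'v) \<Rightarrow> _"
    by (rule vector_space_fscale[OF vector_space_scl])
  let ?R = "rep_hom (subrep V T) (subrep V K)"
  note fdT = fd_representation_subrep[OF fd_representation_axioms T_sub]
  note fdK = fd_representation_subrep[OF fd_representation_axioms K_sub]
  have H: "H = {c \<in> affine_space index. graph_map c \<in> ?R}"
    unfolding H_def chart_preimage_def using chart_in_Gr_rep_iff[OF S T] by simp
  have R: "gsf.subspace ?R" using rep_hom_subspace[OF fdT fdK] by simp
  note lin = graph_map_linear_in_matrix[of UNIV, unfolded linear_on_def]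
  have z: "graph_map 0 = 0" by (auto simp: graph_map_def column_def)
  show sub: "fs.subspace H"
    unfolding H
    using lin gsf.subspace_0[OF R] gsf.subspace_add[OF R] gsf.subspace_scale[OF R] z
      fs.subspace_0[OF subspace_affine_space] fs.subspace_add[OF subspace_affine_space]
      fs.subspace_scale[OF subspace_affine_space]
    by (intro fs.subspaceI) auto
  have "graph_map ` H = ?R"
  proof (intro equalityI subsetI)
    fix f assume f: "f \<in> ?R"
    then obtain c where "c \<in> affine_space index" "graph_map c = f" by (rule graph_map_surj)
    then show "f \<in> graph_map ` H" using f unfolding H by blast
  qed (auto simp: H)
  moreover have "inj_on graph_map H" using graph_map_inj by (rule inj_on_subset) (auto simp: H)
  moreover have "finite index" by (simp add: chart_index_def)
  then have "finitely_spanned fun_scale H"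
    using fs.finitely_spanned_mono[OF finitely_spanned_affine_space, of index H] by (auto simp: H)
  ultimately show "fs.dim H = hom_dim (subrep V T) (subrep V K)"
    using dim_image_linear_on(1)[OF vector_space_fun_scale vector_space_fscale[OF vector_space_scl]
        graph_map_linear_in_matrix sub]
    by (simp add: hom_dim_def)
qed

text \<open>Let \<open>q'\<close> be the projection onto \<open>K\<close> along \<open>T'\<close>.
  For \<open>x\<close> in \<open>T\<close> the vector \<open>x - q' x = p' x\<close> lies in
  \<open>T'\<close>, so \<open>T'\<close> is the graph over \<open>T\<close> of the restriction of
  \<open>- q'\<close>.\<close>

lemma complement_in_chart_domain:
  assumes sum': "rep_direct_sum V T' K"
  shows "T' \<in> gs.chart_domain b"
proof -
  obtain p q where pq: "p \<in> rep_hom V (subrep V T)" "q \<in> rep_hom V (subrep V K)"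
    "\<And>v. v \<in> space V \<Longrightarrow> v = p v + q v"
    "\<And>a. a \<in> T \<Longrightarrow> p a = a" "\<And>a. a \<in> T \<Longrightarrow> q a = 0"
    "\<And>b. b \<in> K \<Longrightarrow> p b = 0" "\<And>b. b \<in> K \<Longrightarrow> q b = b"
    using rep_direct_sumE[OF fd_representation_axioms sum] by blast
  obtain p' q' where pq': "p' \<in> rep_hom V (subrep V T')" "q' \<in> rep_hom V (subrep V K)"
    "\<And>v. v \<in> space V \<Longrightarrow> v = p' v + q' v"
    "\<And>a. a \<in> T' \<Longrightarrow> p' a = a" "\<And>a. a \<in> T' \<Longrightarrow> q' a = 0"
    "\<And>b. b \<in> K \<Longrightarrow> p' b = 0" "\<And>b. b \<in> K \<Longrightarrow> q' b = b"
    using rep_direct_sumE[OF fd_representation_axioms sum'] by blast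
  have T': "is_subrep V T'" using sum' unfolding rep_direct_sum_def by blast
  note fdT = fd_representation_subrep[OF fd_representation_axioms T_sub]
  note fdK = fd_representation_subrep[OF fd_representation_axioms K_sub]
  interpret gsf: vector_space "fscale (scl V) :: complex \<Rightarrow> ('v \<Rightarrow> 'v) \<Rightarrow> _"
    by (rule vector_space_fscale[OF vector_space_scl])
  have "(\<lambda>v. if v \<in> T then q' v else 0) \<in> rep_hom (subrep V T) (subrep V K)"
    by (rule rep_hom_source[OF fd_representation_axioms T_sub pq'(2)])
  then have "- (\<lambda>v. if v \<in> T then q' v else 0) \<in> rep_hom (subrep V T) (subrep V K)"
    using gsf.subspace_neg rep_hom_subspace[OF fdT fdK] by simp
  then obtain c where c: "c \<in> affine_space index" "graph_map c = - (\<lambda>v. if v \<in> T then q' v else 0)"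
    by (rule graph_map_surj)
  have "x + graph_map c x = p' x" if "x \<in> T" for x
    using pq'(3)[OF T_closed(5)[OF that]] that c(2) by (simp add: algebra_simps)
  then have "chart c = p' ` T" unfolding chart_eq_graph by simp
  also have "p' ` T = T'"
  proof (intro equalityI subsetI)
    fix x assume "x \<in> p' ` T"
    then show "x \<in> T'" using rep_homD(2)[OF pq'(1)] T_closed(5) by auto
  next
    fix x assume x: "x \<in> T'"
    then have xV: "x \<in> space V" using is_subrepD(5)[OF fd_representation_axioms T'] by blast
    have px: "p x \<in> T" "q x \<in> K" using rep_homD(2)[OF pq(1) xV] rep_homD(2)[OF pq(2) xV] by auto
    have "x = p' (p x + q x)" using pq'(4)[OF x] pq(3)[OF xV] by simp
    also have "\<dots> = p' (p x)"
      using rep_homD(5)[OF pq'(1) T_closed(5)[OF px(1)] K_closed(5)[OF px(2)]] pq'(6)[OF px(2)] by simp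
    finally show "x \<in> p' ` T" using px(1) by blast
  qed
  finally show ?thesis using c(1) unfolding gs.chart_domain_def by blast
qed

end

section \<open>The variety of subrepresentations of a given class\<close>

lemma Gr_rep_memD:
  assumes V: "fd_representation L V" and S: "is_subrep V S" and T: "T \<in> Gr_rep V S"
  shows "is_subrep V T" "rep_iso (subrep V T) (subrep V S)"
    "vector_space.dim (scl V) T = vector_space.dim (scl V) S"
proof -
  show sub: "is_subrep V T" and iso: "rep_iso (subrep V T) (subrep V S)"
    using T unfolding Gr_rep_def by auto
  obtain f where f: "bij_betw f T S" "linear_on (scl V) (scl V) T f"
    using iso unfolding rep_iso_def by auto
  have vs: "vector_space (scl V)" by (rule fd_representation.vector_space_scl[OF V])
  have "finitely_spanned (scl V) T"
    using fd_representation.finitely_spanned_space[OF fd_representation_subrep[OF V sub]] by simp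
  then show "vector_space.dim (scl V) T = vector_space.dim (scl V) S"
    using dim_image_linear_on(1)[OF vs vs f(2) is_subrepD(7)[OF V sub]] f(1)
    by (simp add: bij_betw_def)
qed

lemma homeomorphic_map_chart_preimage:
  assumes gs: "grassmannian_setting s V d n" and b: "ordered_basis s V b"
  shows "homeomorphic_map (subtopology (zariski (chart_index s V d)) (chart_preimage s V d b X))
    (subtopology (gr_zariski s V d) (X \<inter> grassmannian_setting.chart_domain s V d b)) (gr_chart s V d b)"
proof -
  interpret grassmannian_setting s V d n by (rule gs)
  have dom: "chart_domain b \<subseteq> topspace (gr_zariski s V d)"
    using openin_subset[OF openin_chart_domain[OF b]] .
  have "gr_chart s V d b ` (topspace (zariski (chart_index s V d)) \<inter> chart_preimage s V d b X)
      = topspace (subtopology (gr_zariski s V d) (chart_domain b)) \<inter> (X \<inter> chart_domain b)"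
    using dom unfolding chart_preimage_def chart_domain_def by auto
  from homeomorphic_map_subtopologies[OF homeomorphic_gr_chart[OF b] this]
  show ?thesis by (simp add: subtopology_subtopology Int_absorb1 Int_commute)
qed

text \<open>In a good chart the set is a linear subspace of dimension \<open>r\<close>.
  Irreducibility follows since two points always share such a chart, the dimension because these
  charts cover, and smoothness at \<open>T\<close> from a chart centred at \<open>T\<close>.\<close>

lemma Gr_rep_geometry:
  fixes V :: "('g::ab_group_add, 'v::ab_group_add) rep"
  assumes V: "fd_representation L V" and S: "is_subrep V S"
    and complement: "\<And>T T'. T \<in> Gr_rep V S \<Longrightarrow> T' \<in> Gr_rep V S \<Longrightarrow>
      \<exists>K. rep_direct_sum V T K \<and> rep_direct_sum V T' K"
    and hom: "\<And>T K. T \<in> Gr_rep V S \<Longrightarrow> rep_direct_sum V T K \<Longrightarrow>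
      hom_dim (subrep V T) (subrep V K) = r"
  defines "d \<equiv> vector_space.dim (scl V) S"
  defines "G \<equiv> gr_zariski (scl V) (space V) d"
  shows "locally_closed_in G (Gr_rep V S)"
    and "irreducible_space (subtopology G (Gr_rep V S))"
    and "gr_smooth (scl V) (space V) d (Gr_rep V S)"
    and "krull_dim (subtopology G (Gr_rep V S)) = enat r"
proof -
  interpret fd_representation L V by (rule V)
  interpret vs: vector_space "scl V" by (rule vector_space_scl)
  let ?X = "Gr_rep V S" and ?I = "chart_index (scl V) (space V) d"
  let ?pre = "\<lambda>b. chart_preimage (scl V) (space V) d b (Gr_rep V S)"
  define n where "n = vs.dim (space V)"
  have fin: "finite ?I" by (simp add: chart_index_def)
  have S_in: "S \<in> ?X" using S rep_iso_refl unfolding Gr_rep_def by blast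
  have d_le: "d \<le> n"
    unfolding d_def n_def
    using vs.dim_mono_finitely_spanned[OF _ finitely_spanned_space, of S] is_subrepD(5)[OF V S]
      vs.span_superset[of "space V"] by blast
  interpret gs: grassmannian_setting "scl V" "space V" d n
    using subspace_space d_le by unfold_locales (simp_all add: n_def)
  \<comment> \<open>Goodness is recorded for the chart alone, without \<open>T\<close> and
    \<open>K\<close>, so that the good charts form one covering family.\<close>
  define good where "good b \<longleftrightarrow> ordered_basis (scl V) (space V) b \<and>
    module.subspace fun_scale (?pre b) \<and> vector_space.dim fun_scale (?pre b) = r" for b
  have charts: "\<exists>b. good b \<and> gr_chart (scl V) (space V) d b 0 = T \<and>
      T \<in> gs.chart_domain b \<and> T' \<in> gs.chart_domain b" if TT': "T \<in> ?X" "T' \<in> ?X" for T T'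
  proof -
    obtain K where K: "rep_direct_sum V T K" "rep_direct_sum V T' K"
      using complement[OF TT'] by blast
    have sub: "is_subrep V T" "is_subrep V K" "T \<inter> K = {0}"
      "{a + b | a b. a \<in> T \<and> b \<in> K} = space V"
      using K(1) unfolding rep_direct_sum_def by auto
    have dT: "vs.dim T = d" using Gr_rep_memD(3)[OF V S TT'(1)] unfolding d_def .
    obtain b where b: "ordered_basis (scl V) (space V) b" "vs.span (b ` {..<d}) = T"
      "vs.span (b ` {d..<n}) = K"
      using adapted_basis[OF vector_space_scl finitely_spanned_space is_subrepD(7)[OF V sub(1)]
          is_subrepD(7)[OF V sub(2)] sub(3,4)] unfolding dT n_def by blast
    interpret adapted_chart L V T K b d n
      using dT n_def K(1) b d_le by unfold_locales simp_all
    have "good b"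
      unfolding good_def
      using b(1) chart_preimage_subspace[OF S TT'(1)] chart_preimage_dim[OF S TT'(1)]
        hom[OF TT'(1) K(1)] by simp
    moreover have "T \<in> gs.chart_domain b" "T' \<in> gs.chart_domain b"
      using complement_in_chart_domain K by blast+
    ultimately show ?thesis using chart_zero by blast
  qed
  have pre_sub: "?pre b \<subseteq> affine_space ?I" for b
    unfolding chart_preimage_def by blast
  have X_top: "?X \<subseteq> topspace G"
  proof
    fix T assume "T \<in> ?X"
    then obtain b where "good b" "T \<in> gs.chart_domain b" using charts by blast
    then show "T \<in> topspace G"
      using openin_subset[OF gs.openin_chart_domain] unfolding good_def G_def by blast
  qed
  then have top: "topspace (subtopology G ?X) = ?X" by auto
  have piece_open: "openin (subtopology G ?X) (?X \<inter> gs.chart_domain b)" if "good b" for b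
    using gs.openin_chart_domain[of b] that unfolding good_def G_def openin_subtopology by blast
  have homeo: "homeomorphic_map (subtopology (zariski ?I) (?pre b))
      (subtopology (subtopology G ?X) (?X \<inter> gs.chart_domain b)) (gr_chart (scl V) (space V) d b)"
    if "good b" for b
    using homeomorphic_map_chart_preimage[OF gs.grassmannian_setting_axioms, of b ?X] that
    unfolding good_def G_def by (simp add: subtopology_subtopology)
  have irr: "irreducible_space (subtopology (subtopology G ?X) (?X \<inter> gs.chart_domain b))"
    if b: "good b" for b
  proof -
    interpret fs: vector_space "fun_scale :: complex \<Rightarrow> (nat \<times> nat \<Rightarrow> complex) \<Rightarrow> _"
      by (rule vector_space_fun_scale)
    have "{x \<in> affine_space ?I. x - 0 \<in> ?pre b} = ?pre b" using pre_sub by auto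
    then have "irreducible_space (subtopology (zariski ?I) (?pre b))"
      using irreducible_zariski_translate[OF _ zero_in_affine_space, of "?pre b" ?I] b
      unfolding good_def by simp
    then show ?thesis using irreducible_space_homeomorphic homeo[OF b] by blast
  qed
  have krull: "krull_dim (subtopology (subtopology G ?X) (?X \<inter> gs.chart_domain b)) = enat r"
    if b: "good b" for b
    using krull_dim_homeomorphic[OF homeo[OF b]] krull_dim_linear[OF fin _ pre_sub] b
    unfolding good_def by simp

  show "irreducible_space (subtopology G ?X)"
  proof (rule irreducible_space_from_pairs)
    show "topspace (subtopology G ?X) \<noteq> {}" unfolding top using S_in by blast
    fix T T' assume "T \<in> topspace (subtopology G ?X)" "T' \<in> topspace (subtopology G ?X)"
    then have TT': "T \<in> ?X" "T' \<in> ?X" unfolding top by auto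
    then obtain b where "good b" "T \<in> gs.chart_domain b" "T' \<in> gs.chart_domain b"
      using charts by blast
    then show "\<exists>U. openin (subtopology G ?X) U \<and> T \<in> U \<and> T' \<in> U \<and>
        irreducible_space (subtopology (subtopology G ?X) U)"
      using piece_open irr TT' by (intro exI[of _ "?X \<inter> gs.chart_domain b"]) auto
  qed

  show "krull_dim (subtopology G ?X) = enat r"
  proof (rule antisym)
    show "krull_dim (subtopology G ?X) \<le> enat r"
    proof (rule krull_dim_open_cover)
      fix T assume "T \<in> topspace (subtopology G ?X)"
      then have T: "T \<in> ?X" unfolding top .
      then obtain b where "good b" "T \<in> gs.chart_domain b" using charts by blast
      then show "\<exists>U. openin (subtopology G ?X) U \<and> T \<in> U \<and>
          krull_dim (subtopology (subtopology G ?X) U) \<le> enat r"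
        using piece_open krull T by (intro exI[of _ "?X \<inter> gs.chart_domain b"]) auto
    qed
    \<comment> \<open>A single good chart gives the lower bound; one exists because \<open>S\<close>
      is a point of the variety.\<close>
    obtain b where "good b" using charts[OF S_in S_in] by blast
    then show "enat r \<le> krull_dim (subtopology G ?X)"
      using krull_dim_open_le[OF piece_open] krull by metis
  qed

  show "gr_smooth (scl V) (space V) d ?X"
    unfolding gr_smooth_def
  proof
    fix T assume T: "T \<in> ?X"
    then obtain b where b: "good b" "gr_chart (scl V) (space V) d b 0 = T"
      using charts by blast
    have c: "0 \<in> ?pre b"
      using T b(2) zero_in_affine_space unfolding chart_preimage_def by blast
    have "nonsingular_at ?I (?pre b) 0"
      using nonsingular_linear[OF fin _ pre_sub c] b(1) unfolding good_def by blast
    then show "\<exists>b c. ordered_basis (scl V) (space V) b \<and> c \<in> ?pre b \<and>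
        gr_chart (scl V) (space V) d b c = T \<and> nonsingular_at ?I (?pre b) c"
      using b c unfolding good_def by blast
  qed

  show "locally_closed_in G ?X"
    unfolding locally_closed_in_def
  proof (intro exI conjI)
    let ?U = "\<Union>b\<in>Collect good. gs.chart_domain b"
    \<comment> \<open>Within a good chart domain the variety is closed, being a linear subspace in
      coordinates. Removing all these open differences leaves a closed set that cuts the variety out
      of the union \<open>?U\<close> of the domains.\<close>
    have off: "openin G (gs.chart_domain b - ?X)" if b: "good b" for b
    proof -
      interpret fs: vector_space "fun_scale :: complex \<Rightarrow> (nat \<times> nat \<Rightarrow> complex) \<Rightarrow> _"
        by (rule vector_space_fun_scale)
      have "{x \<in> affine_space ?I. x - 0 \<in> ?pre b} = ?pre b" using pre_sub by auto
      then have "closedin (zariski ?I) (?pre b)"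
        using closedin_zariski_translate[OF fin _ pre_sub zero_in_affine_space, of b] b
        unfolding good_def by simp
      then have "openin (zariski ?I) (affine_space ?I - ?pre b)"
        unfolding closedin_def by simp
      then have "openin G (gr_chart (scl V) (space V) d b ` (affine_space ?I - ?pre b))"
        using gs.openin_gr_chart_image b unfolding good_def G_def by blast
      also have "gr_chart (scl V) (space V) d b ` (affine_space ?I - ?pre b) = gs.chart_domain b - ?X"
        unfolding gs.chart_domain_def chart_preimage_def by auto
      finally show ?thesis .
    qed
    show "openin G ?U"
      using gs.openin_chart_domain unfolding good_def G_def by blast
    have "openin G (\<Union>b\<in>Collect good. gs.chart_domain b - ?X)"
      using off by blast
    then show "closedin G (topspace G - (\<Union>b\<in>Collect good. gs.chart_domain b - ?X))"
      by blast
    have "?X \<subseteq> ?U" using charts by blast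
    then show "?X = ?U \<inter> (topspace G - (\<Union>b\<in>Collect good. gs.chart_domain b - ?X))"
      using X_top by blast
  qed
qed

theorem proposition31:
  fixes L :: "'g::ab_group_add lie_alg"
    and k :: nat
    and W :: "nat \<Rightarrow> ('g, 'w::ab_group_add) rep"
    and V :: "('g, 'v::ab_group_add) rep"
    and S :: "'v set"
    and n s :: "nat \<Rightarrow> int"
  assumes "semisimple_lie_algebra L"
    and "\<And>i. i \<in> {1..k} \<Longrightarrow> irreducible_rep L (W i)"
    and "\<And>i j. i \<in> {1..k} \<Longrightarrow> j \<in> {1..k} \<Longrightarrow> i \<noteq> j \<Longrightarrow> \<not> rep_iso (W i) (W j)"
    and "fd_representation L V"
    and "is_subrep V S"
    and "cl L V = (\<Otimes>\<^bsub>rep_ring L\<^esub>i\<in>{1..k}. cl L (W i) [^]\<^bsub>rep_ring L\<^esub> n i)"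
    and "cl L (subrep V S) = (\<Otimes>\<^bsub>rep_ring L\<^esub>i\<in>{1..k}. cl L (W i) [^]\<^bsub>rep_ring L\<^esub> s i)"
  defines "d \<equiv> vector_space.dim (scl V) S"
  defines "G \<equiv> gr_zariski (scl V) (space V) d"
  shows "locally_closed_in G (Gr_rep V S)
    \<and> irreducible_space (subtopology G (Gr_rep V S))
    \<and> gr_smooth (scl V) (space V) d (Gr_rep V S)
    \<and> ereal_of_enat (krull_dim (subtopology G (Gr_rep V S)))
        = ereal (real_of_int (\<Sum>i=1..k. (n i - s i) * s i))"
proof -
  note irr = assms(2) and noniso = assms(3) and V = assms(4) and S = assms(5)
  have W: "fd_representation L (W i)" if "i \<in> {1..k}" for i
    using irr[OF that] unfolding irreducible_rep_def by blast
  note fdS = fd_representation_subrep[OF V S]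
  note left_V = hom_dim_class_left[OF V W _ finite_atLeastAtMost assms(6)]
    and left_S = hom_dim_class_left[OF fdS W _ finite_atLeastAtMost assms(7)]
    and right_V = hom_dim_class_right[OF V W _ finite_atLeastAtMost assms(6)]
    and right_S = hom_dim_class_right[OF fdS W _ finite_atLeastAtMost assms(7)]
  \<comment> \<open>Since the \<open>W i\<close> are pairwise non-isomorphic, the matrix of the
    numbers \<open>hom_dim (W j) (W i)\<close> is the identity, and the class formula returns its
    own coefficients as multiplicities.\<close>
  have schur: "(\<Sum>i\<in>{1..k}. m i * int (hom_dim (W j) (W i))) = m j" if j: "j \<in> {1..k}"
    for m :: "nat \<Rightarrow> int" and j
  proof -
    have "m i * int (hom_dim (W j) (W i)) = (if i = j then m i else 0)" if i: "i \<in> {1..k}" for i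
      using hom_dim_irreducible_self[OF irr[OF i]]
        hom_dim_irreducible_not_iso[OF irr[OF j] irr[OF i] noniso[OF j i]] by auto
    then have "(\<Sum>i\<in>{1..k}. m i * int (hom_dim (W j) (W i))) = (\<Sum>i\<in>{1..k}. if i = j then m i else 0)"
      by (intro sum.cong) auto
    then show ?thesis using j by simp
  qed
  have mult_V: "int (hom_dim (W j) V) = n j" if "j \<in> {1..k}" for j
    using right_V[OF _ W[OF that]] schur[OF that] by simp
  have mult: "int (hom_dim (W j) (subrep V T)) = s j" if j: "j \<in> {1..k}" and T: "T \<in> Gr_rep V S" for j T
    using right_S[OF _ W[OF j]] schur[OF j] Gr_rep_memD[OF V S T]
      hom_dim_iso_right[OF fd_representation_subrep[OF V] fdS W[OF j]] by simp
  have complement: "\<exists>K. rep_direct_sum V T K \<and> rep_direct_sum V T' K"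
    if T: "T \<in> Gr_rep V S" and T': "T' \<in> Gr_rep V S" for T T'
  proof -
    have generated: "U = space V" if "is_subrep V U"
      "\<And>i f. i \<in> {1..k} \<Longrightarrow> f \<in> rep_hom (W i) V \<Longrightarrow> f ` space (W i) \<subseteq> U" for U
      by (rule generated_by_images[OF V left_V that])
    have eq: "hom_dim (W i) (subrep V T) = hom_dim (W i) (subrep V T')" if "i \<in> {1..k}" for i
      using mult[OF that T] mult[OF that T'] by simp
    show ?thesis
      by (rule common_complement[OF V irr generated Gr_rep_memD(1)[OF V S T]
            Gr_rep_memD(1)[OF V S T'] eq]) blast+
  qed
  \<comment> \<open>\<open>K\<close> has multiplicities \<open>n i - s i\<close> by additivity, and
    expanding the first argument, isomorphic to \<open>S\<close>, by its class contributes the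
    weights \<open>s i\<close>.\<close>
  have hom: "int (hom_dim (subrep V T) (subrep V K)) = (\<Sum>i=1..k. (n i - s i) * s i)"
    if T: "T \<in> Gr_rep V S" and K: "rep_direct_sum V T K" for T K
  proof -
    note T' = Gr_rep_memD[OF V S T]
    have fdT: "fd_representation L (subrep V T)" by (rule fd_representation_subrep[OF V T'(1)])
    have fdK: "fd_representation L (subrep V K)"
      using fd_representation_subrep[OF V] K unfolding rep_direct_sum_def by blast
    have "int (hom_dim (W i) (subrep V K)) = n i - s i" if i: "i \<in> {1..k}" for i
      using hom_dim_direct_sum_right[OF V W[OF i] K] mult_V[OF i] mult[OF i T] by simp
    moreover have "hom_dim (subrep V T) (subrep V K) = hom_dim (subrep V S) (subrep V K)"
      by (rule hom_dim_iso_left[OF fdT fdS fdK T'(2)])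
    ultimately show ?thesis
      using left_S[OF _ fdK] by (simp add: mult.commute)
  qed
  have hom_nat: "hom_dim (subrep V T) (subrep V K) = nat (\<Sum>i=1..k. (n i - s i) * s i)"
    if "T \<in> Gr_rep V S" "rep_direct_sum V T K" for T K
    using hom[OF that] by simp
  \<comment> \<open>A complement of \<open>S\<close> exists, so the sum is the dimension of an
    actual Hom space. It is therefore nonnegative, and the conversion by \<open>nat\<close> keeps
    its value.\<close>
  have "S \<in> Gr_rep V S" using S rep_iso_refl unfolding Gr_rep_def by blast
  then have "0 \<le> (\<Sum>i=1..k. (n i - s i) * s i)"
    using complement hom by (metis of_nat_0_le_iff)
  then show ?thesis
    using Gr_rep_geometry[OF V S complement hom_nat] unfolding d_def G_def by simp
qed

end
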